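(* Let $N\ge2$ and $0<R_0<R_1$. For $p>1$ and $s\in[0,R_1-R_0)$ let $\lambda_1(p,s)$ be the first eigenvalue of $-\Delta_p$ (with zero Dirichlet boundary condition) on $\Omega_s=B_{R_1}(0)\setminus\overline{B_{R_0}(se_1)}\subset\mathbb{R}^N$, and set $$\Lambda_\infty(s):=\lim_{p\to\infty}\lambda_1^{1/p}(p,s),\qquad \Lambda_1(s):=\lim_{p\to1}\lambda_1(p,s).$$ Then $\Lambda_\infty$ and $\Lambda_1$ are continuous on $[0,R_1-R_0)$ and: (i) $\Lambda_\infty$ is strictly decreasing on $[0,R_1-R_0)$; (ii) $\Lambda_1$ is decreasing (i.e. nonincreasing) on $[0,R_1-R_0)$. Moreover, there exists $s^*\in[0,R_1-R_0)$ such that $\Lambda_1(0)=\Lambda_1(s^* )>\Lambda_1(s)$ for all $s\in(s^*,R_1-R_0)$.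
   Context: $B_r(z)$ is the open ball of radius $r>0$ centred at $z\in\mathbb{R}^N$, and $e_1$ is the first coordinate vector. $\Delta_p u=\operatorname{div}(|\nabla u|^{p-2}\nabla u)$. The first eigenvalue is $$\lambda_1(p,s)=\inf\left\{\int_{\Omega_s}|\nabla u|^p\,dx:\ u\in W_0^{1,p}(\Omega_s)\setminus\{0\},\ \|u\|_p=1\right\}.$$ It is known that both limits defining $\Lambda_\infty(s)$ and $\Lambda_1(s)$ exist (the limit $p\to1$ is taken over $p>1$). *)

theory Defs
  imports "HOL-Analysis.Analysis"
begin

definition partial_deriv :: "'n::finite \<Rightarrow> (real^'n \<Rightarrow> real) \<Rightarrow> real^'n \<Rightarrow> real"
  where "partial_deriv i f x = frechet_derivative f (at x) (axis i 1)"

primrec C_k :: "nat \<Rightarrow> (real^'n::finite \<Rightarrow> real) \<Rightarrow> bool"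
  where
    "C_k 0 f \<longleftrightarrow> continuous_on UNIV f"
  | "C_k (Suc k) f \<longleftrightarrow> f differentiable_on UNIV \<and> (\<forall>i. C_k k (partial_deriv i f))"

definition test_functions :: "(real^'n::finite) set \<Rightarrow> (real^'n \<Rightarrow> real) set"
  where "test_functions \<Omega> =
    {\<phi>. (\<forall>k. C_k k \<phi>) \<and> compact (closure {x. \<phi> x \<noteq> 0}) \<and> closure {x. \<phi> x \<noteq> 0} \<subseteq> \<Omega>}"

text \<open>
  Elements of the Lebesgue and Sobolev spaces below are functions on the whole space, of which only
  the values on \<open>\<Omega>\<close> matter; they represent classes modulo equality almost everywhere in \<open>\<Omega>\<close>.
\<close>

definition Lp_space :: "real \<Rightarrow> (real^'n::finite) set \<Rightarrow> (real^'n \<Rightarrow> 'b::euclidean_space) set"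
  where "Lp_space p \<Omega> =
    {f \<in> borel_measurable (lebesgue_on \<Omega>). integrable (lebesgue_on \<Omega>) (\<lambda>x. norm (f x) powr p)}"

definition Lp_norm :: "real \<Rightarrow> (real^'n::finite) set \<Rightarrow> (real^'n \<Rightarrow> 'b::euclidean_space) \<Rightarrow> real"
  where "Lp_norm p \<Omega> f = (LINT x|lebesgue_on \<Omega>. norm (f x) powr p) powr (1 / p)"

definition locally_integrable_on ::
    "(real^'n::finite \<Rightarrow> 'b::euclidean_space) \<Rightarrow> (real^'n) set \<Rightarrow> bool"
    (infixr \<open>locally'_integrable'_on\<close> 46)
  where "f locally_integrable_on \<Omega> \<longleftrightarrow>
    (\<forall>K. compact K \<and> K \<subseteq> \<Omega> \<longrightarrow> f absolutely_integrable_on K)"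

definition is_weak_grad ::
    "(real^'n::finite) set \<Rightarrow> (real^'n \<Rightarrow> real) \<Rightarrow> (real^'n \<Rightarrow> real^'n) \<Rightarrow> bool"
  where "is_weak_grad \<Omega> u G \<longleftrightarrow>
    u locally_integrable_on \<Omega> \<and> G locally_integrable_on \<Omega> \<and>
    (\<forall>\<phi>\<in>test_functions \<Omega>. \<forall>i.
      (LINT x|lebesgue_on \<Omega>. u x * partial_deriv i \<phi> x) = - (LINT x|lebesgue_on \<Omega>. G x $ i * \<phi> x))"

text \<open>
  On an open set a weak gradient is unique up to a null set, so the integrals below do not depend
  on the representative that is chosen here.
\<close>

definition weak_grad :: "(real^'n::finite) set \<Rightarrow> (real^'n \<Rightarrow> real) \<Rightarrow> real^'n \<Rightarrow> real^'n"
  where "weak_grad \<Omega> u = (SOME G. is_weak_grad \<Omega> u G)"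

definition W1p :: "real \<Rightarrow> (real^'n::finite) set \<Rightarrow> (real^'n \<Rightarrow> real) set"
  where "W1p p \<Omega> = {u \<in> Lp_space p \<Omega>. \<exists>G \<in> Lp_space p \<Omega>. is_weak_grad \<Omega> u G}"

definition W1p_norm :: "real \<Rightarrow> (real^'n::finite) set \<Rightarrow> (real^'n \<Rightarrow> real) \<Rightarrow> real"
  where "W1p_norm p \<Omega> u = Lp_norm p \<Omega> u + Lp_norm p \<Omega> (weak_grad \<Omega> u)"

definition W1p_0 :: "real \<Rightarrow> (real^'n::finite) set \<Rightarrow> (real^'n \<Rightarrow> real) set"
  where "W1p_0 p \<Omega> =
    {u \<in> W1p p \<Omega>. \<forall>\<epsilon>>0. \<exists>\<phi>\<in>test_functions \<Omega>. W1p_norm p \<Omega> (\<lambda>x. u x - \<phi> x) < \<epsilon>}"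

definition first_eigenvalue :: "real \<Rightarrow> (real^'n::finite) set \<Rightarrow> real"
  where "first_eigenvalue p \<Omega> =
    Inf {LINT x|lebesgue_on \<Omega>. norm (weak_grad \<Omega> u x) powr p | u.
      u \<in> W1p_0 p \<Omega> \<and> \<not> (AE x in lebesgue_on \<Omega>. u x = 0) \<and> Lp_norm p \<Omega> u = 1}"

text \<open>
  The coordinates of \<open>real^'n\<close> carry no order, so the index \<open>j\<close> of the direction in which the hole
  is shifted is a parameter; \<open>axis j 1\<close> plays the role of the first coordinate vector.
\<close>

definition eccentric_annulus :: "'n::finite \<Rightarrow> real \<Rightarrow> real \<Rightarrow> real \<Rightarrow> (real^'n) set"
  where "eccentric_annulus j R0 R1 s = ball 0 R1 - closure (ball (s *\<^sub>R axis j 1) R0)"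

definition lambda1 :: "'n::finite \<Rightarrow> real \<Rightarrow> real \<Rightarrow> real \<Rightarrow> real \<Rightarrow> real"
  where "lambda1 j R0 R1 p s = first_eigenvalue p (eccentric_annulus j R0 R1 s)"

definition Lambda_inf :: "'n::finite \<Rightarrow> real \<Rightarrow> real \<Rightarrow> real \<Rightarrow> real"
  where "Lambda_inf j R0 R1 s = Lim at_top (\<lambda>p. lambda1 j R0 R1 p s powr (1 / p))"

definition Lambda_1 :: "'n::finite \<Rightarrow> real \<Rightarrow> real \<Rightarrow> real \<Rightarrow> real"
  where "Lambda_1 j R0 R1 s = Lim (at_right 1) (\<lambda>p. lambda1 j R0 R1 p s)"

end

(*
  Both limits are identified with geometric quantities of the annulus Omega_s. Testing with smoothed
  cones over the largest inscribed ball, and a Hardy-type inequality obtained from a vector field that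
  points along the gradient of the distance to the boundary, give Lambda_inf(s) = 2 / (R1 - R0 + s).
  The limit p -> 1 is the infimum h(s) of int |grad phi| / int |phi| over test functions, since
  (h / p)^p <= lambda_1(p, s). Polarization with respect to the hyperplane halfway between two
  positions of the hole shows that h is nonincreasing, and transporting test functions by a shear that
  moves the hole shows that h is continuous. Finally h(0) is at least perimeter / volume, by a
  calibration of the concentric annulus, whereas for a hole almost touching the outer sphere one gets
  below this value by cutting off the cusp; so the last s with h(s) = h(0) lies inside the interval.
*)
theory Submission
  imports Defs
begin

section \<open>Smooth functions\<close>

text \<open>Everything is reduced to integral inequalities for test functions. These are dense in
  \<open>W1p_0\<close> by definition, and an inequality between \<open>mass p\<close> and
  \<open>energy p\<close> survives the closure, so neither eigenfunctions nor functions of bounded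
  variation occur; sets of finite perimeter are replaced by smooth cut-offs. The price is that
  natural competitors are not smooth: polarized functions are only Lipschitz and cones have kinks.
  Each is replaced by a regularisation whose gradient is no larger, or larger only by an error whose
  integral tends to 0. The number \<open>2 / (R1 - R0 + s)\<close> is the reciprocal of the
  inradius. The obstacle for the lower bound is the ridge where the two spheres are equally far; the
  two normal fields are blended across it, and the gradient of the blending function contributes
  with the favourable sign. At the cusp, the gap between the tangent spheres has height of order
  \<epsilon>^2 inside a cylinder of radius \<epsilon>. Its volume \<epsilon>^(N+1), met by a
  gradient of size 1/\<epsilon>, costs \<epsilon>^N, while the cap removed from the outer sphere has
  area of order \<epsilon>^(N-1).\<close>

definition grad :: "(real^'n::finite \<Rightarrow> real) \<Rightarrow> real^'n \<Rightarrow> real^'n"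
  where "grad f x = (\<chi> i. partial_deriv i f x)"

definition smooth :: "(real^'n::finite \<Rightarrow> real) \<Rightarrow> bool"
  where "smooth f \<longleftrightarrow> (\<forall>k. C_k k f)"

lemma partial_deriv_eqI:
  "(f has_derivative f') (at x) \<Longrightarrow> partial_deriv i f x = f' (axis i 1)"
  unfolding partial_deriv_def using frechet_derivative_at by metis

lemma grad_eqI:
  assumes "(f has_derivative (\<lambda>h. g \<bullet> h)) (at x)"
  shows "grad f x = g"
  unfolding grad_def using partial_deriv_eqI[OF assms]
  by (simp add: vec_eq_iff inner_axis)

lemma has_derivative_grad:
  assumes "f differentiable (at x)"
  shows "(f has_derivative (\<lambda>h. grad f x \<bullet> h)) (at x)"
proof -
  obtain f' where f': "(f has_derivative f') (at x)"
    using assms differentiable_def by blast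
  have lin: "linear f'" using f' has_derivative_linear by blast
  have "f' h = grad f x \<bullet> h" for h
  proof -
    have "f' h = f' (\<Sum>i\<in>UNIV. (h $ i) *\<^sub>R axis i 1)"
      by (simp add: basis_expansion scalar_mult_eq_scaleR[symmetric])
    also have "\<dots> = (\<Sum>i\<in>UNIV. h $ i * f' (axis i 1))"
      by (simp add: linear_sum[OF lin] linear_scale[OF lin])
    also have "\<dots> = grad f x \<bullet> h"
      by (simp add: grad_def partial_deriv_eqI[OF f'] inner_vec_def mult.commute)
    finally show ?thesis .
  qed
  then show ?thesis using f' by presburger
qed

lemma C_k_Suc_imp: "C_k (Suc k) f \<Longrightarrow> C_k k f"
proof (induction k arbitrary: f)
  case 0
  then show ?case by (simp add: differentiable_imp_continuous_on)
next
  case (Suc k)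
  then show ?case by (metis C_k.simps(2))
qed

lemma smooth_partial_deriv: "smooth f \<Longrightarrow> smooth (partial_deriv i f)"
  unfolding smooth_def by (metis C_k.simps(2))

lemma smooth_differentiable: "smooth f \<Longrightarrow> f differentiable (at x)"
  unfolding smooth_def by (metis C_k.simps(2) differentiable_on_def UNIV_I)

lemma smooth_has_derivative: "smooth f \<Longrightarrow> (f has_derivative (\<lambda>h. grad f x \<bullet> h)) (at x)"
  by (simp add: has_derivative_grad smooth_differentiable)

lemma smooth_continuous_on: "smooth f \<Longrightarrow> continuous_on S f"
  unfolding smooth_def by (metis C_k.simps(1) continuous_on_subset subset_UNIV)

lemma smooth_continuous_grad: "smooth f \<Longrightarrow> continuous_on S (grad f)"
  unfolding grad_def using smooth_continuous_on[OF smooth_partial_deriv]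
  by (auto intro!: continuous_intros)

lemma differentiable_on_UNIV_I: "(\<And>x. (f has_derivative f' x) (at x)) \<Longrightarrow> f differentiable_on UNIV"
  by (meson differentiable_at_imp_differentiable_on differentiableI)

lemma C_k_const: "C_k k (\<lambda>x. c)"
proof (induction k arbitrary: c)
  case (Suc k)
  have "partial_deriv i (\<lambda>x. c) = (\<lambda>x. 0)" for i :: 'a
    by (rule ext) (simp add: partial_deriv_eqI[OF has_derivative_const])
  then show ?case using Suc by simp
qed simp

lemma C_k_linear:
  assumes "bounded_linear f"
  shows "C_k k f"
proof (cases k)
  case 0
  then show ?thesis using assms by (simp add: linear_continuous_on)
next
  case (Suc m)
  have *: "(f has_derivative f) (at x)" for x
    using assms by (simp add: bounded_linear_imp_has_derivative)
  then have "partial_deriv i f = (\<lambda>x. f (axis i 1))" for i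
    using partial_deriv_eqI by blast
  moreover have "f differentiable_on UNIV"
    by (rule differentiable_on_UNIV_I[OF *])
  ultimately show ?thesis using Suc by (simp add: C_k_const)
qed

lemma C_k_add: "C_k k f \<Longrightarrow> C_k k g \<Longrightarrow> C_k k (\<lambda>x. f x + g x)"
proof (induction k arbitrary: f g)
  case 0
  then show ?case by (simp add: continuous_on_add)
next
  case (Suc k)
  have d: "(f has_derivative (\<lambda>h. grad f x \<bullet> h)) (at x)" "(g has_derivative (\<lambda>h. grad g x \<bullet> h)) (at x)" for x
    using Suc.prems by (auto intro!: has_derivative_grad simp: differentiable_on_def)
  have "partial_deriv i (\<lambda>x. f x + g x) = (\<lambda>x. partial_deriv i f x + partial_deriv i g x)" for i
    using partial_deriv_eqI[OF has_derivative_add[OF d]] partial_deriv_eqI[OF d(1)] partial_deriv_eqI[OF d(2)]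
    by auto
  with Suc show ?case by (auto intro!: differentiable_on_add)
qed

lemma C_k_mult: "C_k k f \<Longrightarrow> C_k k g \<Longrightarrow> C_k k (\<lambda>x. f x * g x)"
proof (induction k arbitrary: f g)
  case 0
  then show ?case by (simp add: continuous_on_mult)
next
  case (Suc k)
  have d: "(f has_derivative (\<lambda>h. grad f x \<bullet> h)) (at x)" "(g has_derivative (\<lambda>h. grad g x \<bullet> h)) (at x)" for x
    using Suc.prems by (auto intro!: has_derivative_grad simp: differentiable_on_def)
  have "partial_deriv i (\<lambda>x. f x * g x) = (\<lambda>x. f x * partial_deriv i g x + partial_deriv i f x * g x)" for i
    using partial_deriv_eqI[OF has_derivative_mult[OF d]] partial_deriv_eqI[OF d(1)] partial_deriv_eqI[OF d(2)]
    by auto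
  moreover have "C_k k f" "C_k k g" using Suc.prems C_k_Suc_imp by blast+
  moreover have "(\<lambda>x. f x * g x) differentiable_on UNIV"
    using Suc.prems by (auto simp: differentiable_on_def)
  ultimately show ?case using Suc by (auto intro!: C_k_add)
qed

lemma C_k_sum: "(\<And>l. l \<in> A \<Longrightarrow> C_k k (f l)) \<Longrightarrow> C_k k (\<lambda>x. \<Sum>l\<in>A. f l x)"
  by (induction A rule: infinite_finite_induct) (auto intro: C_k_const C_k_add)

lemma C_k_prod: "(\<And>l. l \<in> A \<Longrightarrow> C_k k (f l)) \<Longrightarrow> C_k k (\<lambda>x. \<Prod>l\<in>A. f l x)"
  by (induction A rule: infinite_finite_induct) (auto intro: C_k_const C_k_mult)

text \<open>Here \<open>F\<close> lists all derivatives of one scalar function, so differentiating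
  \<open>F m\<close> after \<open>f\<close> gives \<open>F (Suc m)\<close> after \<open>f\<close>
  times a derivative of \<open>f\<close>, a composition of the same kind; the induction therefore
  runs over all \<open>m\<close> at once. The set \<open>U\<close> admits functions, such as powers,
  that are smooth only on a part of the line.\<close>

lemma C_k_compose_1D:
  assumes F: "\<And>m t. t \<in> U \<Longrightarrow> (F m has_real_derivative F (Suc m) t) (at t)"
  shows "(\<And>x. f x \<in> U) \<Longrightarrow> C_k k f \<Longrightarrow> C_k k (\<lambda>x. F m (f x))"
proof (induction k arbitrary: m)
  case 0
  have "continuous_on U (F m)"
    using F DERIV_isCont by (metis continuous_at_imp_continuous_on)
  with 0 show ?case
    by (auto intro: continuous_on_compose2)
next
  case (Suc k)
  have d: "(f has_derivative (\<lambda>h. grad f x \<bullet> h)) (at x)" for x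
    using Suc.prems by (auto intro!: has_derivative_grad simp: differentiable_on_def)
  have c: "((\<lambda>x. F m (f x)) has_derivative (\<lambda>h. F (Suc m) (f x) * (grad f x \<bullet> h))) (at x)" for x
    using has_derivative_compose[OF d, of "F m" "\<lambda>h. F (Suc m) (f x) * h"] F[OF Suc.prems(1)[of x]]
    by (simp add: has_field_derivative_def)
  have "partial_deriv i (\<lambda>x. F m (f x)) = (\<lambda>x. F (Suc m) (f x) * partial_deriv i f x)" for i
    using partial_deriv_eqI[OF c] partial_deriv_eqI[OF d] by auto
  moreover have "C_k k f" using Suc.prems C_k_Suc_imp by blast
  moreover have "(\<lambda>x. F m (f x)) differentiable_on UNIV"
    by (rule differentiable_on_UNIV_I[OF c])
  ultimately show ?case using Suc by (auto intro!: C_k_mult)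
qed

text \<open>The chain rule yields products of \<open>partial_deriv l f\<close> after
  \<open>T\<close> with derivatives of the components of \<open>T\<close>. Induction on the order of
  \<open>f\<close> settles the first factor; the second would lose one order in each step, so the
  components are of class \<open>C_k\<close> for every order from the start.\<close>

lemma C_k_compose_map:
  fixes T :: "real^'n::finite \<Rightarrow> real^'m::finite"
  assumes T: "\<And>k l. C_k k (\<lambda>x. T x $ l)"
  shows "C_k k f \<Longrightarrow> C_k k (\<lambda>x. f (T x))"
proof (induction k arbitrary: f)
  case 0
  have "continuous_on UNIV T"
    using T[of 0] by (subst continuous_on_componentwise)
      (auto simp: Basis_vec_def inner_axis)
  with 0 show ?case by (auto intro: continuous_on_compose2)
next
  case (Suc k)
  have d: "(f has_derivative (\<lambda>h. grad f x \<bullet> h)) (at x)" for x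
    using Suc.prems by (auto intro!: has_derivative_grad simp: differentiable_on_def)
  have t: "((\<lambda>x. T x $ l) has_derivative (\<lambda>h. grad (\<lambda>x. T x $ l) x \<bullet> h)) (at x)" for x l
    using T[of 1] by (auto intro!: has_derivative_grad simp: differentiable_on_def)
  have t': "(T has_derivative (\<lambda>h. \<chi> l. grad (\<lambda>x. T x $ l) x \<bullet> h)) (at x)" for x
    using t by (subst has_derivative_componentwise_within)
      (auto simp: Basis_vec_def inner_axis)
  have c: "((\<lambda>x. f (T x)) has_derivative (\<lambda>h. grad f (T x) \<bullet> (\<chi> l. grad (\<lambda>x. T x $ l) x \<bullet> h))) (at x)" for x
    using has_derivative_compose[OF t' d] by simp
  have "partial_deriv i (\<lambda>x. f (T x)) =
     (\<lambda>x. \<Sum>l\<in>UNIV. partial_deriv l f (T x) * partial_deriv i (\<lambda>x. T x $ l) x)" for i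
  proof
    fix x
    have "partial_deriv i (\<lambda>x. f (T x)) x
        = grad f (T x) \<bullet> (\<chi> l. grad (\<lambda>x. T x $ l) x \<bullet> axis i 1)"
      by (rule partial_deriv_eqI[OF c])
    also have "\<dots> = (\<Sum>l\<in>UNIV. partial_deriv l f (T x) * partial_deriv i (\<lambda>x. T x $ l) x)"
      by (simp add: inner_vec_def[of "grad f (T x)"] inner_axis) (simp add: grad_def)
    finally show "partial_deriv i (\<lambda>x. f (T x)) x =
      (\<Sum>l\<in>UNIV. partial_deriv l f (T x) * partial_deriv i (\<lambda>x. T x $ l) x)" .
  qed
  moreover have "(\<lambda>x. f (T x)) differentiable_on UNIV"
    by (rule differentiable_on_UNIV_I[OF c])
  moreover have "C_k k (partial_deriv i (\<lambda>x. T x $ l))" for i l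
    using T[of "Suc k"] by simp
  moreover have "C_k k (\<lambda>x. partial_deriv l f (T x))" for l
    using Suc by simp
  ultimately show ?case by (simp add: C_k_mult C_k_sum)
qed

named_theorems smooth_intros

lemma smooth_const [smooth_intros]: "smooth (\<lambda>x. c)"
  and smooth_add [smooth_intros]: "smooth f \<Longrightarrow> smooth g \<Longrightarrow> smooth (\<lambda>x. f x + g x)"
  and smooth_mult [smooth_intros]: "smooth f \<Longrightarrow> smooth g \<Longrightarrow> smooth (\<lambda>x. f x * g x)"
  and smooth_sum: "(\<And>l. l \<in> A \<Longrightarrow> smooth (h l)) \<Longrightarrow> smooth (\<lambda>x. \<Sum>l\<in>A. h l x)"
  and smooth_prod: "(\<And>l. l \<in> A \<Longrightarrow> smooth (h l)) \<Longrightarrow> smooth (\<lambda>x. \<Prod>l\<in>A. h l x)"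
  by (auto simp: smooth_def intro!: C_k_const C_k_add C_k_mult C_k_sum C_k_prod)

lemma smooth_minus [smooth_intros]: "smooth f \<Longrightarrow> smooth (\<lambda>x. - f x)"
  using smooth_mult[OF smooth_const[of "-1"]] by auto

lemma smooth_diff [smooth_intros]: "smooth f \<Longrightarrow> smooth g \<Longrightarrow> smooth (\<lambda>x. f x - g x)"
  using smooth_add[OF _ smooth_minus, of f g] by auto

lemma smooth_power [smooth_intros]: "smooth f \<Longrightarrow> smooth (\<lambda>x. f x ^ m)"
  by (induction m) (auto intro!: smooth_intros)

lemma smooth_divide_const [smooth_intros]: "smooth f \<Longrightarrow> smooth (\<lambda>x. f x / c)"
  using smooth_mult[OF _ smooth_const[of "1/c"], of f] by auto

lemma smooth_linear: "bounded_linear f \<Longrightarrow> smooth f"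
  by (auto simp: smooth_def intro!: C_k_linear)

lemma smooth_component [smooth_intros]: "smooth (\<lambda>x. x $ i)"
  by (intro smooth_linear bounded_linear_vec_nth)

lemma smooth_compose_1D:
  assumes "\<And>m t. t \<in> U \<Longrightarrow> (F m has_real_derivative F (Suc m) t) (at t)" "\<And>x. f x \<in> U" "smooth f"
  shows "smooth (\<lambda>x. F m (f x))"
  using C_k_compose_1D[of U F f] assms by (auto simp: smooth_def)

lemma smooth_compose_map:
  assumes "\<And>l. smooth (\<lambda>x. T x $ l)" "smooth f"
  shows "smooth (\<lambda>x. f (T x))"
  using C_k_compose_map[of T] assms by (auto simp: smooth_def)

lemma smooth_norm_square: "smooth (\<lambda>x. (norm (x - c))\<^sup>2)"
proof -
  have "(\<lambda>x. (norm (x - c))\<^sup>2) = (\<lambda>x. \<Sum>i\<in>UNIV. (x $ i - c $ i)^2)"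
    unfolding fun_eq_iff power2_norm_eq_inner inner_vec_def by (simp add: power2_eq_square)
  then show ?thesis by (auto intro!: smooth_intros smooth_sum)
qed

lemma smooth_powr:
  assumes "smooth f" "\<And>x. f x > 0"
  shows "smooth (\<lambda>x. f x powr a)"
proof -
  \<comment> \<open>The m-th derivative of the power in closed form, with the falling factorial of
    \<open>a\<close> as coefficient.\<close>
  define F where "F m t = (\<Prod>i<m. a - real i) * t powr (a - real m)" for m t
  have F: "(F m has_real_derivative F (Suc m) t) (at t)" if "t \<in> {0<..}" for m t
  proof -
    have "(F m has_real_derivative (\<Prod>i<m. a - real i) * ((a - real m) * t powr (a - real m - 1))) (at t)"
      unfolding F_def using that by (intro DERIV_cmult has_real_derivative_powr) auto
    then show ?thesis by (simp add: F_def algebra_simps)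
  qed
  have "smooth (\<lambda>x. F 0 (f x))"
    using smooth_compose_1D[where F = F and U = "{0<..}" and m = 0, OF F] assms by auto
  then show ?thesis by (simp add: F_def)
qed

lemma smooth_sqrt: "smooth f \<Longrightarrow> (\<And>x. f x > 0) \<Longrightarrow> smooth (\<lambda>x. sqrt (f x))"
  using smooth_powr[of f "1/2"] by (simp add: powr_half_sqrt less_imp_le)

lemma smooth_divide:
  assumes "smooth f" "smooth g" "\<And>x. g x > 0"
  shows "smooth (\<lambda>x. f x / g x)"
  using smooth_mult[OF assms(1) smooth_powr[OF assms(2,3), of "-1"]] assms(3)
  by (simp add: powr_minus divide_inverse less_imp_le abs_of_pos)

section \<open>Flat functions and smooth cut-offs\<close>

definition exp_inv :: "real \<Rightarrow> real"
  where "exp_inv t = (if t > 0 then exp (- (1 / t)) else 0)"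

text \<open>With y = 1/t the m-th derivative of exp(-1/t) is P_m(y) exp(-y). Since dy/dt = -y^2, one
  more derivative gives y^2 (P_m - P_m') exp(-y), which is the recursion.\<close>

primrec exp_inv_poly :: "nat \<Rightarrow> real poly"
  where "exp_inv_poly 0 = 1"
  | "exp_inv_poly (Suc m) = [:0, 0, 1:] * (exp_inv_poly m - pderiv (exp_inv_poly m))"

definition exp_inv_deriv :: "nat \<Rightarrow> real \<Rightarrow> real"
  where "exp_inv_deriv m t = (if t > 0 then poly (exp_inv_poly m) (1 / t) * exp (- (1 / t)) else 0)"

lemma exp_inv_deriv_0: "exp_inv_deriv 0 = exp_inv"
  by (auto simp: exp_inv_deriv_def exp_inv_def)

lemma poly_times_exp_tendsto_0: "((\<lambda>y. poly q y * exp (- y)) \<longlongrightarrow> (0::real)) at_top"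
proof -
  have "((\<lambda>y. \<Sum>i\<le>degree q. coeff q i * (y ^ i / exp y)) \<longlongrightarrow> (\<Sum>i\<le>degree q. coeff q i * 0)) at_top"
    by (intro tendsto_intros tendsto_power_div_exp_0)
  then show ?thesis
    by (simp add: poly_altdef sum_distrib_right exp_minus divide_inverse mult.assoc)
qed

lemma exp_inv_deriv_has_derivative:
  "(exp_inv_deriv m has_real_derivative exp_inv_deriv (Suc m) t) (at t)"
proof -
  let ?q = "exp_inv_poly m"
  consider "t > 0" | "t < 0" | "t = 0" by linarith
  then show ?thesis
  proof cases
    case 1
    have "((\<lambda>t. poly ?q (1 / t) * exp (- (1 / t))) has_real_derivative exp_inv_deriv (Suc m) t) (at t)"
      using 1 by (auto intro!: derivative_eq_intros DERIV_chain2[where f="poly ?q"] poly_DERIV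
          simp: exp_inv_deriv_def field_simps power2_eq_square)
    then show ?thesis
      by (rule has_field_derivative_transform_within_open[where S="{0<..}"])
        (use 1 in \<open>auto simp: exp_inv_deriv_def\<close>)
  next
    case 2
    have "((\<lambda>t. 0) has_real_derivative exp_inv_deriv (Suc m) t) (at t)"
      using 2 by (auto simp: exp_inv_deriv_def)
    then show ?thesis
      by (rule has_field_derivative_transform_within_open[where S="{..<0}"])
        (use 2 in \<open>auto simp: exp_inv_deriv_def\<close>)
  next
    case 3
    \<comment> \<open>At the origin the difference quotient is y P(y) exp(-y) with y = 1/h, hence
      the extra factor \<open>[:0, 1:]\<close>.\<close>
    have "((\<lambda>y. poly ([:0, 1:] * ?q) y * exp (- y)) \<longlongrightarrow> 0) at_top"
      by (rule poly_times_exp_tendsto_0)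
    then have "((\<lambda>y. exp_inv_deriv m (inverse y) / inverse y) \<longlongrightarrow> 0) at_top"
      by (rule Lim_transform_eventually)
        (auto simp: exp_inv_deriv_def divide_simps eventually_at_top_linorder intro!: exI[of _ 1])
    then have "((\<lambda>h. exp_inv_deriv m h / h) \<longlongrightarrow> 0) (at_right 0)"
      by (simp add: filterlim_at_right_to_top)
    moreover have "((\<lambda>h. exp_inv_deriv m h / h) \<longlongrightarrow> 0) (at_left 0)"
      by (rule tendsto_eventually) (auto simp: exp_inv_deriv_def eventually_at_filter)
    ultimately have "((\<lambda>h. exp_inv_deriv m h / h) \<longlongrightarrow> 0) (at 0)"
      by (rule filterlim_split_at_real[rotated])
    then show ?thesis
      using 3 by (simp add: has_field_derivative_iff exp_inv_deriv_def)
  qed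
qed

lemma smooth_exp_inv [smooth_intros]: "smooth f \<Longrightarrow> smooth (\<lambda>x. exp_inv (f x))"
  using smooth_compose_1D[where F = exp_inv_deriv and U = UNIV and m = 0] exp_inv_deriv_has_derivative
  by (simp add: exp_inv_deriv_0)

lemma exp_inv_derivative: "(exp_inv has_real_derivative exp_inv_deriv 1 t) (at t)"
  using exp_inv_deriv_has_derivative[of 0] by (simp add: exp_inv_deriv_0)

lemma continuous_exp_inv_deriv: "continuous_on S (exp_inv_deriv m)"
  using exp_inv_deriv_has_derivative DERIV_isCont by (metis continuous_at_imp_continuous_on)

lemma exp_inv_deriv_1: "exp_inv_deriv (Suc 0) t = (if t > 0 then exp (- (1 / t)) / t\<^sup>2 else 0)"
  by (auto simp: exp_inv_deriv_def power2_eq_square)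

lemma exp_inv_nonneg: "exp_inv t \<ge> 0" and exp_inv_le_1: "exp_inv t \<le> 1"
  and exp_inv_pos: "t > 0 \<Longrightarrow> exp_inv t > 0" and exp_inv_nonpos: "t \<le> 0 \<Longrightarrow> exp_inv t = 0"
  by (auto simp: exp_inv_def)

text \<open>Smooth transition from 0 for t \<le> 0 to 1 for t \<ge> 1. The denominator never
  vanishes because one of t and 1 - t is positive.\<close>

definition step :: "real \<Rightarrow> real"
  where "step t = exp_inv t / (exp_inv t + exp_inv (1 - t))"

definition step' :: "real \<Rightarrow> real"
  where "step' t = (exp_inv_deriv 1 t * exp_inv (1 - t) + exp_inv t * exp_inv_deriv 1 (1 - t))
    / (exp_inv t + exp_inv (1 - t))\<^sup>2"

lemma exp_inv_sum_pos: "exp_inv t + exp_inv (1 - t) > 0"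
  using exp_inv_nonneg[of t] exp_inv_nonneg[of "1 - t"] exp_inv_pos[of t] exp_inv_pos[of "1 - t"]
  by (cases "t > 0") (auto intro: add_pos_nonneg add_nonneg_pos)

lemma smooth_step [smooth_intros]: "smooth f \<Longrightarrow> smooth (\<lambda>x. step (f x))"
  unfolding step_def by (intro smooth_divide smooth_intros exp_inv_sum_pos)

lemma step_has_derivative: "(step has_real_derivative step' t) (at t)"
proof -
  have "exp_inv t + exp_inv (1 - t) \<noteq> 0" using exp_inv_sum_pos[of t] by simp
  then show ?thesis unfolding step_def[abs_def] step'_def
    by (auto intro!: derivative_eq_intros exp_inv_derivative DERIV_chain2[OF exp_inv_derivative]
        simp: power2_eq_square algebra_simps)
qed

lemma step_eq_0: "t \<le> 0 \<Longrightarrow> step t = 0" and step_eq_1: "t \<ge> 1 \<Longrightarrow> step t = 1"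
  and step_nonneg: "step t \<ge> 0" and step_le_1: "step t \<le> 1"
  using exp_inv_sum_pos[of t] exp_inv_nonneg[of t] exp_inv_nonneg[of "1 - t"]
  by (auto simp: step_def exp_inv_nonpos divide_simps)

lemma step'_nonneg: "step' t \<ge> 0"
  using exp_inv_nonneg[of t] exp_inv_nonneg[of "1 - t"]
  by (auto simp: step'_def exp_inv_deriv_1)

lemma step'_eq_0: "t \<notin> {0<..<1} \<Longrightarrow> step' t = 0"
  by (auto simp: step'_def exp_inv_deriv_1 exp_inv_nonpos)

lemma continuous_step': "continuous_on S step'"
  unfolding step'_def[abs_def] using exp_inv_sum_pos
  by (intro continuous_intros continuous_on_compose2[OF continuous_exp_inv_deriv[of UNIV 1]]
      continuous_on_compose2[OF continuous_exp_inv_deriv[of UNIV 0, unfolded exp_inv_deriv_0]])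
    (auto simp: less_imp_neq[symmetric])

lemma step'_bounded: obtains B where "B > 0" "\<And>t. step' t \<le> B"
proof -
  have "bounded (step' ` {0..1})"
    by (intro compact_imp_bounded compact_continuous_image continuous_step') auto
  then obtain B where B: "\<And>t. t \<in> {0..1} \<Longrightarrow> norm (step' t) \<le> B" "B > 0"
    unfolding bounded_pos by (metis imageI)
  have "step' t \<le> B" for t
    using B(1)[of t] step'_eq_0[of t] B(2) by (cases "t \<in> {0<..<1}") auto
  with B that show ?thesis by blast
qed

text \<open>A smooth positive part, t exp(-d/t) for t > 0. It vanishes on the whole half line t
  \<le> 0 and so produces compact supports; its slope lies in [0,1], so composing with it never
  increases the energy; and it differs from the positive part by at most \<open>d\<close>.\<close>

definition soft_pos :: "real \<Rightarrow> real \<Rightarrow> real"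
  where "soft_pos d t = t * exp_inv (t / d)"

definition soft_pos' :: "real \<Rightarrow> real \<Rightarrow> real"
  where "soft_pos' d t = exp_inv (t / d) + t * (exp_inv_deriv 1 (t / d) / d)"

lemma smooth_soft_pos [smooth_intros]: "smooth f \<Longrightarrow> smooth (\<lambda>x. soft_pos d (f x))"
  unfolding soft_pos_def by (intro smooth_intros)

lemma soft_pos_has_derivative: "d > 0 \<Longrightarrow> (soft_pos d has_real_derivative soft_pos' d t) (at t)"
  unfolding soft_pos_def[abs_def] soft_pos'_def
  by (auto intro!: derivative_eq_intros DERIV_chain2[OF exp_inv_derivative])

text \<open>For t > 0 and x = d/t the slope is (1 + x) exp(-x), at most 1 because 1 + x \<le> exp
  x.\<close>

lemma soft_pos'_bounds: "d > 0 \<Longrightarrow> 0 \<le> soft_pos' d t \<and> soft_pos' d t \<le> 1"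
proof -
  assume d: "d > 0"
  show ?thesis
  proof (cases "t > 0")
    case True
    have "soft_pos' d t = exp (- (d / t)) * (1 + d / t)"
      using d True by (simp add: soft_pos'_def exp_inv_deriv_1 exp_inv_def field_simps power2_eq_square)
    moreover have "exp (- (d / t)) * (1 + d / t) \<le> exp (- (d / t)) * exp (d / t)"
      by (intro mult_left_mono exp_ge_add_one_self) auto
    ultimately show ?thesis using d True by (auto simp: exp_minus_inverse mult_exp_exp)
  next
    case False
    then show ?thesis using d by (auto simp: soft_pos'_def exp_inv_deriv_1 exp_inv_def zero_less_divide_iff)
  qed
qed

lemma soft_pos_nonpos: "t \<le> 0 \<Longrightarrow> d > 0 \<Longrightarrow> soft_pos d t = 0"
  by (simp add: soft_pos_def exp_inv_def zero_less_divide_iff)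

lemma soft_pos_nonneg: "d > 0 \<Longrightarrow> soft_pos d t \<ge> 0"
  by (cases "t \<le> 0", simp add: soft_pos_nonpos) (simp add: soft_pos_def exp_inv_nonneg)

lemma soft_pos_ge: "d > 0 \<Longrightarrow> soft_pos d t \<ge> t - d"
proof -
  assume d: "d > 0"
  show ?thesis
  proof (cases "t > 0")
    case True
    have "1 - d / t \<le> exp (- (d / t))" using exp_ge_add_one_self[of "- (d / t)"] by simp
    then have "t * (1 - d / t) \<le> t * exp (- (d / t))" using True by (intro mult_left_mono) auto
    then show ?thesis using True d by (simp add: soft_pos_def exp_inv_def algebra_simps)
  qed (use d in \<open>simp add: soft_pos_nonpos\<close>)
qed

lemma soft_pos_le: "d > 0 \<Longrightarrow> soft_pos d t \<le> max t 0"
  using exp_inv_le_1[of "t / d"] mult_left_mono[of "exp_inv (t / d)" 1 t]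
  by (cases "t \<le> 0", simp add: soft_pos_nonpos) (simp add: soft_pos_def)

section \<open>Rules for gradients\<close>

lemma grad_compose_1D:
  assumes "f differentiable (at x)" "(h has_real_derivative h') (at (f x))"
  shows "grad (\<lambda>x. h (f x)) x = h' *\<^sub>R grad f x"
  by (rule grad_eqI)
    (use has_derivative_compose[OF has_derivative_grad[OF assms(1)], of h "\<lambda>t. h' * t"] assms(2) in
      \<open>simp add: has_field_derivative_def\<close>)

lemma grad_add: "f differentiable (at x) \<Longrightarrow> g differentiable (at x) \<Longrightarrow>
    grad (\<lambda>x. f x + g x) x = grad f x + grad g x"
  by (rule grad_eqI) (auto intro!: derivative_eq_intros has_derivative_grad simp: inner_add_left)

lemma grad_diff: "f differentiable (at x) \<Longrightarrow> g differentiable (at x) \<Longrightarrow>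
    grad (\<lambda>x. f x - g x) x = grad f x - grad g x"
  by (rule grad_eqI) (auto intro!: derivative_eq_intros has_derivative_grad simp: inner_diff_left)

lemma grad_mult: "f differentiable (at x) \<Longrightarrow> g differentiable (at x) \<Longrightarrow>
    grad (\<lambda>x. f x * g x) x = f x *\<^sub>R grad g x + g x *\<^sub>R grad f x"
  by (rule grad_eqI) (auto intro!: derivative_eq_intros has_derivative_grad simp: inner_add_left)

lemma grad_const [simp]: "grad (\<lambda>x. c) x = 0"
  by (rule grad_eqI) simp

lemma grad_norm_square: "grad (\<lambda>x. (norm (x - c))\<^sup>2) x = 2 *\<^sub>R (x - c)"
  by (rule grad_eqI) (auto intro!: derivative_eq_intros simp: power2_norm_eq_inner inner_commute algebra_simps)

lemma grad_component: "grad (\<lambda>x. x $ i) x = axis i 1"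
  by (rule grad_eqI) (auto intro!: derivative_eq_intros bounded_linear_imp_has_derivative bounded_linear_vec_nth simp: inner_axis')

lemma partial_deriv_eq_grad: "partial_deriv i f x = grad f x $ i"
  by (simp add: grad_def)

section \<open>Integration by parts and weak gradients\<close>

lemma integrable_compact_support:
  fixes f :: "real^'n::finite \<Rightarrow> 'b::{banach, second_countable_topology}"
  assumes "continuous_on UNIV f" "compact K" "\<And>x. x \<notin> K \<Longrightarrow> f x = 0"
  shows "integrable lborel f"
proof -
  have "integrable lborel (\<lambda>x. indicator K x *\<^sub>R f x)"
    using assms by (intro borel_integrable_compact) (auto intro: continuous_on_subset)
  also have "(\<lambda>x. indicator K x *\<^sub>R f x) = f"
    using assms(3) by (auto simp: fun_eq_iff indicator_def)
  finally show ?thesis .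
qed

lemma lborel_integral_translation:
  fixes f :: "real^'n::finite \<Rightarrow> real"
  assumes "f \<in> borel_measurable borel"
  shows "(LINT x|lborel. f (c + x)) = (LINT x|lborel. f x)"
proof -
  have "(LINT x|lborel. f x) = (LINT x|distr lborel borel ((+) c). f x)"
    by (simp add: lborel_distr_plus)
  also have "\<dots> = (LINT x|lborel. f (c + x))"
    using assms by (subst integral_distr) auto
  finally show ?thesis ..
qed

lemma lborel_integrable_translation:
  fixes f :: "real^'n::finite \<Rightarrow> real"
  assumes "integrable lborel f"
  shows "integrable lborel (\<lambda>x. f (c + x))"
proof -
  have "integrable (distr lborel borel ((+) c)) f"
    using assms by (simp add: lborel_distr_plus)
  then show ?thesis
    using assms by (subst (asm) integrable_distr_eq) auto
qed

text \<open>Difference quotients integrate to zero by translation invariance.\<close>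
lemma integral_directional_derivative_zero:
  fixes F :: "real^'n::finite \<Rightarrow> real"
  assumes Fcont: "continuous_on UNIV F"
    and line: "\<And>x t. ((\<lambda>t. F (t *\<^sub>R v + x)) has_real_derivative D (t *\<^sub>R v + x)) (at t)"
    and cont: "continuous_on UNIV D"
    and K: "compact K" "\<And>x. x \<notin> K \<Longrightarrow> F x = 0"
  shows "(LINT x|lborel. D x) = 0"
proof -
  \<comment> \<open>Off the closed set \<open>K\<close> the function vanishes along a whole piece of
    the line, so its derivative does too; hence \<open>D\<close> is supported in \<open>K\<close>
    and bounded.\<close>
  have zero: "D x = 0" if "x \<notin> K" for x
  proof -
    have "open ((\<lambda>t. t *\<^sub>R v + x) -` (- K))"
      using K(1) by (intro open_vimage continuous_intros) (auto intro: compact_imp_closed)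
    then have "((\<lambda>t. 0) has_real_derivative D (0 *\<^sub>R v + x)) (at 0)"
      by (rule has_field_derivative_transform_within_open[OF line]) (use that K(2) in auto)
    then show ?thesis using DERIV_unique[OF _ DERIV_const] by fastforce
  qed
  have "bounded (D ` K)"
    using cont K by (intro compact_imp_bounded compact_continuous_image) (auto intro: continuous_on_subset)
  then obtain M where "\<forall>x\<in>K. norm (D x) \<le> M" and M0: "M > 0"
    unfolding bounded_pos by blast
  then have M: "\<bar>D x\<bar> \<le> M" for x
    using zero[of x] by (cases "x \<in> K") auto
  have Fb [measurable]: "F \<in> borel_measurable borel"
    using Fcont by (rule borel_measurable_continuous_onI)
  define h :: "nat \<Rightarrow> real" where "h n = 1 / real (Suc n)" for n
  have h: "0 < h n" "h n \<le> 1" for n by (auto simp: h_def)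
  have h0: "h \<longlonglongrightarrow> 0" unfolding h_def by (rule LIMSEQ_Suc[OF lim_1_over_n])
  define g where "g n x = (F (h n *\<^sub>R v + x) - F x) / h n" for n x
  have int0: "(LINT x|lborel. g n x) = 0" for n
  proof -
    have "integrable lborel F" using Fcont K by (rule integrable_compact_support)
    then show ?thesis
      unfolding g_def using lborel_integrable_translation[of F "h n *\<^sub>R v"]
      by (simp add: lborel_integral_translation)
  qed
  obtain R where R: "K \<subseteq> ball 0 R"
    using bounded_subset_ballD[OF compact_imp_bounded[OF K(1)], of 0] by metis
  \<comment> \<open>A ball containing \<open>K\<close> enlarged by \<open>norm v\<close>, hence the
    supports of all difference quotients, as the step sizes are at most 1.\<close>
  define L where "L = cball (0::real^'n) (R + norm v)"
  have gb: "norm (g n x) \<le> M * indicator L x" for n x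
  proof (cases "x \<in> L")
    case True
    have "\<exists>z. 0 < z \<and> z < h n \<and> F (h n *\<^sub>R v + x) - F (0 *\<^sub>R v + x) = (h n - 0) * D (z *\<^sub>R v + x)"
      by (rule MVT2[OF h(1)]) (rule line)
    then obtain z where "F (h n *\<^sub>R v + x) - F x = h n * D (z *\<^sub>R v + x)" by auto
    then show ?thesis using M True h(1)[of n] by (auto simp: g_def)
  next
    case False
    have "norm (h n *\<^sub>R v) \<le> norm v" using h[of n] by (auto intro: mult_left_le_one_le)
    moreover have "R + norm v < norm x" using False by (simp add: L_def)
    moreover have "norm x \<le> norm (h n *\<^sub>R v + x) + norm (h n *\<^sub>R v)"
      by (metis add_diff_cancel_left' norm_triangle_ineq4 add.commute)
    ultimately have "x \<notin> K" "h n *\<^sub>R v + x \<notin> K" using R norm_ge_zero[of v] by (auto simp del: norm_ge_zero)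
    then show ?thesis using K(2) M0 by (simp add: g_def)
  qed
  have "(\<lambda>n. LINT x|lborel. g n x) \<longlonglongrightarrow> (LINT x|lborel. D x)"
  proof (rule integral_dominated_convergence[where w="\<lambda>x. M * indicator L x"])
    show "D \<in> borel_measurable lborel"
      using borel_measurable_continuous_onI[OF cont] by simp
    show "g n \<in> borel_measurable lborel" for n unfolding g_def by measurable
    show "integrable lborel (\<lambda>x. M * indicator L x)"
      unfolding L_def by (auto intro!: integrable_real_indicator emeasure_compact_finite)
    show "AE x in lborel. (\<lambda>n. g n x) \<longlonglongrightarrow> D x"
    proof (rule AE_I2)
      fix x
      have "((\<lambda>t. (F (t *\<^sub>R v + x) - F (0 *\<^sub>R v + x)) / (t - 0)) \<longlongrightarrow> D (0 *\<^sub>R v + x)) (at 0)"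
        using line[of x 0] by (simp only: has_field_derivative_iff)
      then have "((\<lambda>t. (F (t *\<^sub>R v + x) - F x) / t) \<longlongrightarrow> D x) (at 0)" by simp
      moreover have "filterlim h (at 0) sequentially"
        using h0 h(1) by (auto simp: filterlim_at less_imp_neq[symmetric] intro!: always_eventually)
      ultimately show "(\<lambda>n. g n x) \<longlonglongrightarrow> D x"
        unfolding g_def by (rule filterlim_compose)
    qed
    show "AE x in lborel. norm (g n x) \<le> M * indicator L x" for n using gb by simp
  qed
  then show ?thesis using int0 by (simp add: LIMSEQ_const_iff)
qed

lemma integral_partial_deriv_zero:
  fixes F :: "real^'n::finite \<Rightarrow> real"
  assumes "\<And>x. F differentiable (at x)" "continuous_on UNIV (\<lambda>x. grad F x $ i)"
    "compact K" "\<And>x. x \<notin> K \<Longrightarrow> F x = 0"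
  shows "(LINT x|lborel. grad F x $ i) = 0"
proof (rule integral_directional_derivative_zero[OF _ _ assms(2-4), where v="axis i 1"])
  show "continuous_on UNIV F"
    using assms(1) by (simp add: continuous_at_imp_continuous_on differentiable_imp_continuous_within)
  fix x :: "real^'n" and t :: real
  have "((\<lambda>t. t *\<^sub>R axis i 1 + x) has_derivative (\<lambda>s. s *\<^sub>R axis i 1)) (at t)"
    by (auto intro!: derivative_eq_intros)
  from has_derivative_compose[OF this has_derivative_grad[OF assms(1)]]
  show "((\<lambda>t. F (t *\<^sub>R axis i 1 + x)) has_real_derivative grad F (t *\<^sub>R axis i 1 + x) $ i) (at t)"
    unfolding has_field_derivative_def
    by (rule has_derivative_eq_rhs) (simp add: fun_eq_iff inner_axis)
qed

lemma test_functionsI: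
  assumes "smooth \<phi>" "compact K" "K \<subseteq> \<Omega>" "\<And>x. x \<notin> K \<Longrightarrow> \<phi> x = 0"
  shows "\<phi> \<in> test_functions \<Omega>"
proof -
  have "closure {x. \<phi> x \<noteq> 0} \<subseteq> K"
    using assms by (intro closure_minimal compact_imp_closed) auto
  moreover have "compact (closure {x. \<phi> x \<noteq> 0})"
    using compact_Int_closed[OF assms(2) closed_closure, of "{x. \<phi> x \<noteq> 0}"] calculation
    by (simp only: Int_absorb1)
  ultimately show ?thesis
    using assms unfolding test_functions_def smooth_def by auto
qed

lemma test_functionsE:
  assumes "\<phi> \<in> test_functions \<Omega>"
  obtains K where "smooth \<phi>" "compact K" "K \<subseteq> \<Omega>" "\<And>x. x \<notin> K \<Longrightarrow> \<phi> x = 0"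
proof -
  have "smooth \<phi>" "compact (closure {x. \<phi> x \<noteq> 0})" "closure {x. \<phi> x \<noteq> 0} \<subseteq> \<Omega>"
    using assms by (auto simp: test_functions_def smooth_def)
  moreover have "\<phi> x = 0" if "x \<notin> closure {x. \<phi> x \<noteq> 0}" for x
    using that closure_subset[of "{x. \<phi> x \<noteq> 0}"] by auto
  ultimately show ?thesis using that by blast
qed

lemma test_functions_smooth: "\<phi> \<in> test_functions \<Omega> \<Longrightarrow> smooth \<phi>"
  by (auto elim: test_functionsE)

lemma grad_zero_outside:
  assumes "closed K" "\<And>x. x \<notin> K \<Longrightarrow> f x = 0" "x \<notin> K"
  shows "grad f x = 0"
proof -
  have "(f has_derivative (\<lambda>h. 0)) (at x)"
    by (rule has_derivative_transform_within_open[OF has_derivative_const, of "- K"])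
      (use assms in auto)
  then show ?thesis by (intro grad_eqI) simp
qed

text \<open>Bridge from \<open>lebesgue_on \<Omega>\<close> in the definitions to Borel integrals
  over the whole space, where translations, reflections and shears act.\<close>

lemma LINT_lebesgue_on_eq:
  fixes f :: "real^'n::finite \<Rightarrow> 'b::{banach, second_countable_topology}"
  assumes "open \<Omega>" "f \<in> borel_measurable borel" "\<And>x. x \<notin> \<Omega> \<Longrightarrow> f x = 0"
  shows "(LINT x|lebesgue_on \<Omega>. f x) = (LINT x|lborel. f x)"
    and "integrable (lebesgue_on \<Omega>) f \<longleftrightarrow> integrable lborel f"
proof -
  have *: "(\<lambda>x. indicator \<Omega> x *\<^sub>R f x) = f" using assms(3) by (auto simp: fun_eq_iff indicator_def)
  show "(LINT x|lebesgue_on \<Omega>. f x) = (LINT x|lborel. f x)"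
    using assms * by (subst integral_restrict_space) (auto simp: integral_completion)
  show "integrable (lebesgue_on \<Omega>) f \<longleftrightarrow> integrable lborel f"
    using assms * by (subst integrable_restrict_space) (auto simp: integrable_completion)
qed

lemma continuous_locally_integrable:
  fixes f :: "real^'n::finite \<Rightarrow> 'b::euclidean_space"
  assumes "continuous_on UNIV f"
  shows "f locally_integrable_on \<Omega>"
  unfolding locally_integrable_on_def
proof (intro allI impI)
  fix K assume "compact K \<and> K \<subseteq> \<Omega>"
  then have "integrable lborel (\<lambda>x. indicator K x *\<^sub>R f x)"
    using assms by (intro borel_integrable_compact) (auto intro: continuous_on_subset)
  then show "f absolutely_integrable_on K"
    unfolding set_integrable_def using borel_measurable_integrable integrable_completion by blast
qed

text \<open>The product of f with a test function has compact support, so the integrals of its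
  partial derivatives vanish; the product rule splits them into the two sides.\<close>

lemma is_weak_grad_smooth:
  assumes "open \<Omega>" "smooth f"
  shows "is_weak_grad \<Omega> f (grad f)"
  unfolding is_weak_grad_def
proof (intro conjI ballI allI)
  show "f locally_integrable_on \<Omega>" "grad f locally_integrable_on \<Omega>"
    using assms by (auto intro!: continuous_locally_integrable smooth_continuous_on smooth_continuous_grad)
  fix \<phi> i assume "\<phi> \<in> test_functions \<Omega>"
  then obtain K where K: "smooth \<phi>" "compact K" "K \<subseteq> \<Omega>" "\<And>x. x \<notin> K \<Longrightarrow> \<phi> x = 0"
    by (auto elim: test_functionsE)
  have g0: "grad \<phi> x = 0" if "x \<notin> K" for x
    using grad_zero_outside[of K \<phi>] K that compact_imp_closed by blast
  have gr: "grad (\<lambda>x. f x * \<phi> x) x = f x *\<^sub>R grad \<phi> x + \<phi> x *\<^sub>R grad f x" for x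
    using assms K by (intro grad_mult smooth_differentiable)
  have c: "continuous_on UNIV f" "continuous_on UNIV \<phi>" "continuous_on UNIV (grad f)" "continuous_on UNIV (grad \<phi>)"
    using assms K by (auto intro!: smooth_continuous_on smooth_continuous_grad)
  have c1: "continuous_on UNIV (\<lambda>x. f x * grad \<phi> x $ i)" and c2: "continuous_on UNIV (\<lambda>x. grad f x $ i * \<phi> x)"
    by (intro continuous_intros c)+
  have i1: "integrable lborel (\<lambda>x. f x * grad \<phi> x $ i)" and i2: "integrable lborel (\<lambda>x. grad f x $ i * \<phi> x)"
    using K(4) g0 by (auto intro!: integrable_compact_support[OF c1 K(2)] integrable_compact_support[OF c2 K(2)])
  have "(LINT x|lborel. grad (\<lambda>x. f x * \<phi> x) x $ i) = 0"
    by (rule integral_partial_deriv_zero[OF _ _ K(2)])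
      (use assms K c in \<open>auto intro!: smooth_differentiable smooth_intros continuous_intros simp: gr\<close>)
  then have "(LINT x|lborel. f x * grad \<phi> x $ i) + (LINT x|lborel. grad f x $ i * \<phi> x) = 0"
    unfolding Bochner_Integration.integral_add[OF i1 i2, symmetric] gr by (simp add: mult.commute)
  moreover have "(LINT x|lebesgue_on \<Omega>. f x * partial_deriv i \<phi> x) = (LINT x|lborel. f x * grad \<phi> x $ i)"
    unfolding partial_deriv_eq_grad using K(3) g0 assms
    by (intro LINT_lebesgue_on_eq borel_measurable_continuous_onI c1) (metis mult_zero_right subsetD zero_index)+
  moreover have "(LINT x|lebesgue_on \<Omega>. grad f x $ i * \<phi> x) = (LINT x|lborel. grad f x $ i * \<phi> x)"
    using K assms by (intro LINT_lebesgue_on_eq borel_measurable_continuous_onI c2) auto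
  ultimately show "(LINT x|lebesgue_on \<Omega>. f x * partial_deriv i \<phi> x) = - (LINT x|lebesgue_on \<Omega>. grad f x $ i * \<phi> x)"
    by simp
qed

section \<open>Bump functions and the fundamental lemma of the calculus of variations\<close>

text \<open>As m grows, \<open>exp_inv (m * t)\<close> tends to 1 for t > 0 and stays 0 for t \<le>
  0. The bumps therefore converge boundedly to the indicator of the open box, which lets test
  functions detect boxes.\<close>

definition box_bump :: "real^'n::finite \<Rightarrow> real^'n \<Rightarrow> real \<Rightarrow> real^'n \<Rightarrow> real"
  where "box_bump a b m x = (\<Prod>i\<in>UNIV. exp_inv (m * (x $ i - a $ i)) * exp_inv (m * (b $ i - x $ i)))"

lemma box_bump_test:
  assumes "cbox a b \<subseteq> \<Omega>" "m > 0"
  shows "box_bump a b m \<in> test_functions \<Omega>"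
proof (rule test_functionsI[OF _ compact_cbox assms(1)])
  show "smooth (box_bump a b m)"
    unfolding box_bump_def by (intro smooth_prod smooth_intros)
  fix x assume "x \<notin> cbox a b"
  then obtain i where "x $ i < a $ i \<or> b $ i < x $ i" by (auto simp: mem_box_cart not_le)
  then have "exp_inv (m * (x $ i - a $ i)) * exp_inv (m * (b $ i - x $ i)) = 0"
    using assms(2) by (auto simp: exp_inv_def mult_less_0_iff zero_less_mult_iff)
  then show "box_bump a b m x = 0" unfolding box_bump_def by (intro prod_zero) auto
qed

lemma box_bump_nonneg: "box_bump a b m x \<ge> 0" and box_bump_le_1: "box_bump a b m x \<le> 1"
  unfolding box_bump_def by (auto intro!: prod_nonneg prod_le_1 mult_le_one exp_inv_le_1 simp: exp_inv_nonneg)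

lemma box_bump_pos: "x \<in> box a b \<Longrightarrow> m > 0 \<Longrightarrow> box_bump a b m x > 0"
  unfolding box_bump_def by (auto intro!: prod_pos exp_inv_pos mult_pos_pos simp: mem_box_cart)

lemma box_bump_tendsto_indicator:
  "(\<lambda>m. box_bump a b (real (Suc m)) x) \<longlonglongrightarrow> indicator (box a b) x"
proof (cases "x \<in> box a b")
  case True
  have e: "(\<lambda>m. exp_inv (real (Suc m) * t)) \<longlonglongrightarrow> 1" if "t > 0" for t
  proof -
    have "(\<lambda>m. exp (- ((1 / t) * (1 / real (Suc m))))) \<longlonglongrightarrow> exp (- ((1 / t) * 0))"
      by (intro tendsto_intros LIMSEQ_Suc[OF lim_1_over_n])
    then show ?thesis using that by (simp add: exp_inv_def zero_less_mult_iff mult.commute)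
  qed
  have "(\<lambda>m. box_bump a b (real (Suc m)) x) \<longlonglongrightarrow> (\<Prod>i\<in>(UNIV::'a set). 1 * 1)"
    unfolding box_bump_def using True by (intro tendsto_intros e) (auto simp: mem_box_cart)
  then show ?thesis using True by simp
next
  case False
  then obtain i where "x $ i \<le> a $ i \<or> b $ i \<le> x $ i" by (auto simp: mem_box_cart not_less)
  then have *: "exp_inv (m * (x $ i - a $ i)) * exp_inv (m * (b $ i - x $ i)) = 0" if "m > 0" for m
    using that by (auto simp: exp_inv_def mult_less_0_iff zero_less_mult_iff)
  have "box_bump a b (real (Suc m)) x = 0" for m
  proof -
    have "exp_inv (real (Suc m) * (x $ i - a $ i)) * exp_inv (real (Suc m) * (b $ i - x $ i)) = 0"
      by (rule *) simp
    then show ?thesis unfolding box_bump_def by (meson UNIV_I finite prod_zero)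
  qed
  then show ?thesis using False by simp
qed

text \<open>Open boxes form an intersection-stable generator of the Borel sets, so the integral of
  \<open>g\<close> over every Borel set vanishes. The complement step needs the total integral,
  which is the one over \<open>box a b\<close> because \<open>g\<close> lives there.\<close>

lemma LINT_box_zero_imp_AE_zero:
  fixes g :: "real^'n::finite \<Rightarrow> real"
  assumes g: "integrable lborel g" and zero: "\<And>c d. (LINT x|lborel. indicator (box c d) x * g x) = 0"
    and out: "\<And>x. x \<notin> box a b \<Longrightarrow> g x = 0"
  shows "AE x in lborel. g x = 0"
proof -
  have all: "(LINT x:A|lborel. g x) = 0" if "A \<in> sets borel" for A
  proof -
    have "Int_stable (range (\<lambda>(a, b). box a b :: (real^'n) set))"
      by (auto simp: Int_stable_def box_Int_box)
    moreover have "(range (\<lambda>(a, b). box a b)) \<subseteq> Pow (UNIV :: (real^'n) set)" by auto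
    moreover have "A \<in> sigma_sets UNIV (range (\<lambda>(a, b). box a b))"
      using that unfolding borel_eq_box by simp
    ultimately show ?thesis
    proof (induction rule: sigma_sets_induct_disjoint)
      case (basic A) then show ?case using zero by (auto simp: set_lebesgue_integral_def)
    next
      case empty then show ?case by (simp add: set_lebesgue_integral_def)
    next
      case (compl A)
      then have A: "A \<in> sets borel" by (simp add: borel_eq_box)
      have "(\<lambda>x. indicator (box a b) x * g x) = g" using out by (auto simp: fun_eq_iff indicator_def)
      with zero[of a b] have "(LINT x|lborel. g x) = 0" by simp
      moreover have "(LINT x|lborel. g x) = (LINT x:A|lborel. g x) + (LINT x:(UNIV - A)|lborel. g x)"
        using set_integral_Un[of A "UNIV - A" lborel g] g A
          set_integrable_subset[of lborel UNIV g A] set_integrable_subset[of lborel UNIV g "UNIV - A"]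
        by (simp add: set_lebesgue_integral_def set_integrable_def)
      ultimately show ?case using compl by simp
    next
      case (union A)
      then have A: "A i \<in> sets borel" for i by (auto simp: borel_eq_box)
      have "(LINT x:(\<Union>i. A i)|lborel. g x) = (\<Sum>i. LINT x:A i|lborel. g x)"
      proof (rule lebesgue_integral_countable_add)
        show "set_integrable lborel (\<Union>i. A i) g"
          unfolding set_integrable_def using A by (intro integrable_mult_indicator g) auto
      qed (use A union in \<open>auto simp: disjoint_family_on_def\<close>)
      then show ?case using union by simp
    qed
  qed
  show ?thesis by (rule density_unique_real[OF g]) (use all in auto)
qed

text \<open>Inside a closed box contained in \<Omega> the bumps converge to indicators of open
  sub-boxes, and dominated convergence turns the hypothesis into vanishing integrals over boxes.
  Countably many closed boxes exhaust \<Omega>.\<close>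

lemma AE_zero_if_test_integrals_zero:
  fixes H :: "real^'n::finite \<Rightarrow> real"
  assumes "open \<Omega>" and loc: "H locally_integrable_on \<Omega>"
    and zero: "\<And>\<phi>. \<phi> \<in> test_functions \<Omega> \<Longrightarrow> (LINT x|lebesgue_on \<Omega>. H x * \<phi> x) = 0"
  shows "AE x in lebesgue_on \<Omega>. H x = 0"
proof -
  have boxes: "AE x in lebesgue. x \<in> cbox a b \<longrightarrow> H x = 0" if sub: "cbox a b \<subseteq> \<Omega>" for a b
  proof -
    define f where "f x = indicator (cbox a b) x * H x" for x
    have int: "integrable lebesgue f"
    proof -
      have "compact (cbox a b) \<and> cbox a b \<subseteq> \<Omega>" using sub by simp
      with loc have "H absolutely_integrable_on cbox a b"
        unfolding locally_integrable_on_def by blast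
      then show ?thesis unfolding set_integrable_def f_def by simp
    qed
    have fb [measurable]: "f \<in> borel_measurable lebesgue"
      using int by (rule borel_measurable_integrable)
    have sub_box: "(LINT x|lebesgue. indicator (box c d) x * f x) = 0" if cd: "box c d \<subseteq> cbox a b" for c d
    proof (cases "box c d = {}")
      case False
      have cdo: "cbox c d \<subseteq> cbox a b"
        using closure_minimal[OF cd closed_cbox] closure_box[OF False] by simp
      define \<phi> where "\<phi> m = box_bump c d (real (Suc m))" for m
      have test: "\<phi> m \<in> test_functions \<Omega>" for m
        unfolding \<phi>_def using cdo sub by (intro box_bump_test) auto
      have test2: "\<phi> m \<in> test_functions (cbox a b)" for m
        unfolding \<phi>_def using cdo by (intro box_bump_test) auto
      have out: "\<phi> m x = 0" if "x \<notin> cbox a b" for m x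
        using test2[of m] that by (auto elim!: test_functionsE)
      have m [measurable]: "\<phi> m \<in> borel_measurable lebesgue" for m
        using smooth_continuous_on[OF test_functions_smooth[OF test], of UNIV m]
        by (intro measurable_completion) (simp add: borel_measurable_continuous_onI)
      have eq: "(LINT x|lebesgue. \<phi> m x * f x) = 0" for m
      proof -
        have "(\<lambda>x. \<phi> m x * f x) = (\<lambda>x. indicator \<Omega> x *\<^sub>R (H x * \<phi> m x))"
          using out[of _ m] sub by (force simp: indicator_def fun_eq_iff f_def)
        moreover have "(LINT x|lebesgue_on \<Omega>. H x * \<phi> m x) = (LINT x|lebesgue. indicator \<Omega> x *\<^sub>R (H x * \<phi> m x))"
          using \<open>open \<Omega>\<close> by (intro integral_restrict_space) simp
        ultimately show ?thesis using zero[OF test, of m] by presburger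
      qed
      have "(\<lambda>m. LINT x|lebesgue. \<phi> m x * f x) \<longlonglongrightarrow> (LINT x|lebesgue. indicator (box c d) x * f x)"
      proof (rule integral_dominated_convergence[where w="\<lambda>x. norm (f x)"])
        show "integrable lebesgue (\<lambda>x. norm (f x))" using int by simp
        show "AE x in lebesgue. (\<lambda>m. \<phi> m x * f x) \<longlonglongrightarrow> indicator (box c d) x * f x"
          unfolding \<phi>_def by (intro AE_I2 tendsto_intros box_bump_tendsto_indicator)
        show "AE x in lebesgue. norm (\<phi> m x * f x) \<le> norm (f x)" for m
          unfolding \<phi>_def using box_bump_nonneg[of c d] box_bump_le_1[of c d]
          by (intro AE_I2) (auto intro!: mult_left_le_one_le simp: abs_mult)
        show "(\<lambda>x. indicator (box c d) x * f x) \<in> borel_measurable lebesgue"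
          by (intro borel_measurable_times fb borel_measurable_indicator) simp
        show "(\<lambda>x. \<phi> m x * f x) \<in> borel_measurable lebesgue" for m
          by (intro borel_measurable_times fb m)
      qed
      then show ?thesis unfolding eq by (simp add: LIMSEQ_const_iff)
    qed simp
    have AEbox: "AE x in lebesgue. x \<notin> cbox a b - box a b"
      using negligible_frontier_interval negligible_iff_null_sets by (intro AE_not_in) blast
    \<comment> \<open>\<open>f\<close> is only Lebesgue measurable, whereas the generator argument
      concerns Borel sets; hence a Borel representative, cut off to the open box.\<close>
    obtain g0 where g0 [measurable]: "g0 \<in> borel_measurable lborel" and g0f: "AE x in lborel. f x = g0 x"
      using completion_ex_borel_measurable_real[OF fb] by blast
    define g where "g x = indicator (box a b) x * g0 x" for x
    have gm [measurable]: "g \<in> borel_measurable lborel" unfolding g_def by measurable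
    have gm' [measurable]: "g \<in> borel_measurable lebesgue" by (rule measurable_completion[OF gm])
    have gl: "AE x in lebesgue. indicator (box a b) x * f x = g x"
      using AE_completion[OF g0f] by eventually_elim (simp add: g_def)
    have "integrable lebesgue (\<lambda>x. indicator (box a b) x *\<^sub>R f x)"
      by (intro integrable_mult_indicator int) auto
    then have "integrable lebesgue g"
      using gl gm' fb by (subst (asm) integrable_cong_AE[of _ _ g]) (auto intro!: borel_measurable_times borel_measurable_indicator)
    then have gint: "integrable lborel g" by (simp add: integrable_completion)
    have "(LINT x|lborel. indicator (box c d) x * g x) = 0" for c d
    proof -
      have "(LINT x|lborel. indicator (box c d) x * g x) = (LINT x|lebesgue. indicator (box c d) x * g x)"
        by (subst integral_completion) auto
      also have "\<dots> = (LINT x|lebesgue. indicator (box c d \<inter> box a b) x * f x)"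
      proof (rule integral_cong_AE)
        show "AE x in lebesgue. indicator (box c d) x * g x = indicator (box c d \<inter> box a b) x * f x"
          using gl by eventually_elim (auto simp: indicator_def split: if_splits)
      qed (auto intro!: borel_measurable_times borel_measurable_indicator)
      also have "\<dots> = 0"
      proof -
        obtain c' d' where "box c d \<inter> box a b = box c' d'" unfolding box_Int_box by blast
        then show ?thesis using sub_box[of c' d'] box_subset_cbox[of a b] by auto
      qed
      finally show ?thesis .
    qed
    then have "AE x in lborel. g x = 0"
      by (intro LINT_box_zero_imp_AE_zero[OF gint, of a b]) (auto simp: g_def)
    then have "AE x in lebesgue. g x = 0" by (rule AE_completion)
    with gl AEbox show ?thesis
      by eventually_elim (auto simp: indicator_def f_def split: if_splits)
  qed
  obtain \<D> where D: "countable \<D>" "\<D> \<subseteq> Pow \<Omega>" "\<And>X. X \<in> \<D> \<Longrightarrow> \<exists>a b. X = cbox a b" "\<Union>\<D> = \<Omega>"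
    using open_countable_Union_open_cbox[OF \<open>open \<Omega>\<close>] by metis
  have "\<forall>X\<in>\<D>. AE x in lebesgue. x \<in> X \<longrightarrow> H x = 0"
    using D boxes by (metis PowD subsetD)
  then have "AE x in lebesgue. \<forall>X\<in>\<D>. x \<in> X \<longrightarrow> H x = 0"
    by (subst AE_ball_countable[OF D(1)])
  then have "AE x in lebesgue. x \<in> \<Omega> \<longrightarrow> H x = 0"
    by eventually_elim (use D(4) in auto)
  then show ?thesis using \<open>open \<Omega>\<close> by (subst AE_restrict_space_iff) auto
qed

lemma locally_integrable_component:
  fixes F :: "real^'n::finite \<Rightarrow> real^'m::finite"
  assumes "F locally_integrable_on \<Omega>"
  shows "(\<lambda>x. F x $ i) locally_integrable_on \<Omega>"
  unfolding locally_integrable_on_def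
proof (intro allI impI)
  fix K assume "compact K \<and> K \<subseteq> \<Omega>"
  then have "F absolutely_integrable_on K" using assms unfolding locally_integrable_on_def by simp
  then show "(\<lambda>x. F x $ i) absolutely_integrable_on K"
    unfolding set_integrable_def using integrable_bounded_linear[OF bounded_linear_vec_nth[of i]] by fastforce
qed

lemma locally_integrable_diff:
  fixes f g :: "real^'n::finite \<Rightarrow> 'b::euclidean_space"
  assumes "f locally_integrable_on \<Omega>" "g locally_integrable_on \<Omega>"
  shows "(\<lambda>x. f x - g x) locally_integrable_on \<Omega>"
  unfolding locally_integrable_on_def
proof (intro allI impI)
  fix K assume "compact K \<and> K \<subseteq> \<Omega>"
  then have "f absolutely_integrable_on K" "g absolutely_integrable_on K"
    using assms unfolding locally_integrable_on_def by simp_all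
  then show "(\<lambda>x. f x - g x) absolutely_integrable_on K" by (rule set_integral_diff(1))
qed

lemma integrable_times_test_function:
  fixes f :: "real^'n::finite \<Rightarrow> real"
  assumes "open \<Omega>" and f: "f locally_integrable_on \<Omega>" and phi: "\<phi> \<in> test_functions \<Omega>"
  shows "integrable (lebesgue_on \<Omega>) (\<lambda>x. f x * \<phi> x)"
proof -
  obtain K where K: "smooth \<phi>" "compact K" "K \<subseteq> \<Omega>" "\<And>x. x \<notin> K \<Longrightarrow> \<phi> x = 0"
    using phi by (auto elim: test_functionsE)
  have int: "integrable lebesgue (\<lambda>x. indicator K x *\<^sub>R f x)"
    using f K(2,3) unfolding locally_integrable_on_def set_integrable_def[symmetric] by simp
  have m: "\<phi> \<in> borel_measurable lebesgue"
    using smooth_continuous_on[OF K(1), of UNIV]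
    by (intro measurable_completion) (simp add: borel_measurable_continuous_onI)
  have "bounded (\<phi> ` K)"
    using K smooth_continuous_on by (intro compact_imp_bounded compact_continuous_image) auto
  then obtain B where B: "B > 0" "\<And>x. x \<in> K \<Longrightarrow> norm (\<phi> x) \<le> B"
    unfolding bounded_pos by (metis imageI)
  have "integrable lebesgue (\<lambda>x. (indicator K x *\<^sub>R f x) * \<phi> x)"
  proof (rule Bochner_Integration.integrable_bound)
    show "integrable lebesgue (\<lambda>x. B * norm (indicator K x *\<^sub>R f x))"
      using int by (intro integrable_mult_right integrable_norm)
    show "(\<lambda>x. (indicator K x *\<^sub>R f x) * \<phi> x) \<in> borel_measurable lebesgue"
      by (intro borel_measurable_times borel_measurable_integrable[OF int] m)
    show "AE x in lebesgue. norm ((indicator K x *\<^sub>R f x) * \<phi> x) \<le> norm (B * norm (indicator K x *\<^sub>R f x))"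
    proof (rule AE_I2)
      fix x
      have "\<bar>f x\<bar> * \<bar>\<phi> x\<bar> \<le> B * \<bar>f x\<bar>" if "x \<in> K"
        using B(2)[OF that] mult_left_mono[of "\<bar>\<phi> x\<bar>" B "\<bar>f x\<bar>"] by (simp add: mult.commute)
      then show "norm ((indicator K x *\<^sub>R f x) * \<phi> x) \<le> norm (B * norm (indicator K x *\<^sub>R f x))"
        using B(1) by (cases "x \<in> K") (auto simp: abs_mult)
    qed
  qed
  moreover have "(\<lambda>x. (indicator K x *\<^sub>R f x) * \<phi> x) = (\<lambda>x. indicator \<Omega> x *\<^sub>R (f x * \<phi> x))"
    using K by (force simp: indicator_def fun_eq_iff)
  ultimately show ?thesis using \<open>open \<Omega>\<close> by (subst integrable_restrict_space) auto
qed

text \<open>The fundamental lemma is applied to the components of the difference. This makes the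
  integrals in the eigenvalue independent of the choice behind \<open>weak_grad\<close>.\<close>

lemma weak_grad_unique:
  fixes u :: "real^'n::finite \<Rightarrow> real"
  assumes "open \<Omega>" and G: "is_weak_grad \<Omega> u G" "is_weak_grad \<Omega> u G'"
  shows "AE x in lebesgue_on \<Omega>. G x = G' x"
proof -
  have loc: "G locally_integrable_on \<Omega>" "G' locally_integrable_on \<Omega>"
    using G by (auto simp: is_weak_grad_def)
  have "AE x in lebesgue_on \<Omega>. G x $ i - G' x $ i = 0" for i
  proof (rule AE_zero_if_test_integrals_zero[OF \<open>open \<Omega>\<close>])
    show "(\<lambda>x. G x $ i - G' x $ i) locally_integrable_on \<Omega>"
      by (intro locally_integrable_diff locally_integrable_component loc)
    fix \<phi> :: "real^'n \<Rightarrow> real" assume phi: "\<phi> \<in> test_functions \<Omega>"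
    have "(LINT x|lebesgue_on \<Omega>. G x $ i * \<phi> x) = (LINT x|lebesgue_on \<Omega>. G' x $ i * \<phi> x)"
    proof -
      have "- (LINT x|lebesgue_on \<Omega>. G x $ i * \<phi> x) = (LINT x|lebesgue_on \<Omega>. u x * partial_deriv i \<phi> x)"
        "- (LINT x|lebesgue_on \<Omega>. G' x $ i * \<phi> x) = (LINT x|lebesgue_on \<Omega>. u x * partial_deriv i \<phi> x)"
        using G phi by (simp_all add: is_weak_grad_def)
      then show ?thesis by linarith
    qed
    then show "(LINT x|lebesgue_on \<Omega>. (G x $ i - G' x $ i) * \<phi> x) = 0"
      using integrable_times_test_function[OF \<open>open \<Omega>\<close> locally_integrable_component[OF loc(1)] phi, of i]
        integrable_times_test_function[OF \<open>open \<Omega>\<close> locally_integrable_component[OF loc(2)] phi, of i]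
      by (simp add: left_diff_distrib)
  qed
  then have "AE x in lebesgue_on \<Omega>. \<forall>i\<in>UNIV. G x $ i - G' x $ i = 0"
    by (subst AE_ball_countable) (auto simp: countable_finite)
  then show ?thesis by eventually_elim (simp add: vec_eq_iff)
qed

section \<open>The first eigenvalue via test functions\<close>

text \<open>Convexity of the power at (1 - t) (a/(1 - t)) + t (b/t). It replaces the triangle
  inequality for p-norms: when t tends to 0 the factor of a^p tends to 1, and the large factor
  t^(1-p) falls only on b^p, which is small in the applications.\<close>

lemma powr_add_le:
  fixes a b t p :: real
  assumes "a \<ge> 0" "b \<ge> 0" "0 < t" "t < 1" "p \<ge> 1"
  shows "(a + b) powr p \<le> (1 - t) powr (1 - p) * a powr p + t powr (1 - p) * b powr p"
proof -
  have ge1: "r powr (1 - p) \<ge> 1" if "0 < r" "r < 1" for r :: real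
  proof -
    have "r powr (p - 1) \<le> 1" using that assms by (intro powr_le1) auto
    moreover have "r powr (1 - p) = 1 / r powr (p - 1)"
      using that by (simp add: powr_minus_divide[symmetric])
    ultimately show ?thesis using that by simp
  qed
  consider "a = 0" | "b = 0" | "a > 0" "b > 0" using assms by linarith
  then show ?thesis
  proof cases
    case 1
    then show ?thesis using mult_right_mono[OF ge1[of t], of "b powr p"] assms by simp
  next
    case 2
    then show ?thesis using mult_right_mono[OF ge1[of "1 - t"], of "a powr p"] assms by simp
  next
    case 3
    have "((1 - t) *\<^sub>R (a / (1 - t)) + t *\<^sub>R (b / t)) powr p \<le>
        (1 - t) * (a / (1 - t)) powr p + t * (b / t) powr p"
      using convex_onD[OF powr_convex[OF \<open>p \<ge> 1\<close>], of t "a / (1 - t)" "b / t"] assms 3 by auto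
    moreover have "(1 - t) * (a / (1 - t)) powr p = (1 - t) powr (1 - p) * a powr p"
      using assms 3 by (simp add: powr_divide powr_diff)
    moreover have "t * (b / t) powr p = t powr (1 - p) * b powr p"
      using assms 3 by (simp add: powr_divide powr_diff)
    ultimately show ?thesis using assms by simp
  qed
qed

lemma norm_powr_diff_le:
  fixes x y :: "'a::real_normed_vector"
  assumes "0 < t" "t < 1" "p \<ge> 1"
  shows "norm x powr p \<le> (1 - t) powr (1 - p) * norm y powr p + t powr (1 - p) * norm (x - y) powr p"
proof -
  have "norm x powr p \<le> (norm y + norm (x - y)) powr p"
    using norm_triangle_ineq[of y "x - y"] assms by (intro powr_mono2) auto
  also have "\<dots> \<le> (1 - t) powr (1 - p) * norm y powr p + t powr (1 - p) * norm (x - y) powr p"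
    using assms by (intro powr_add_le) auto
  finally show ?thesis .
qed

lemma Lp_space_diff:
  assumes "u \<in> Lp_space p \<Omega>" "v \<in> Lp_space p \<Omega>" "p \<ge> 1"
  shows "(\<lambda>x. u x - v x) \<in> Lp_space p \<Omega>"
proof -
  have m: "u \<in> borel_measurable (lebesgue_on \<Omega>)" "v \<in> borel_measurable (lebesgue_on \<Omega>)"
    and i: "integrable (lebesgue_on \<Omega>) (\<lambda>x. norm (u x) powr p)" "integrable (lebesgue_on \<Omega>) (\<lambda>x. norm (v x) powr p)"
    using assms by (auto simp: Lp_space_def)
  have "integrable (lebesgue_on \<Omega>) (\<lambda>x. norm (u x - v x) powr p)"
  proof (rule Bochner_Integration.integrable_bound)
    show "integrable (lebesgue_on \<Omega>) (\<lambda>x. (1 - 1/2) powr (1 - p) * norm (u x) powr p + (1/2) powr (1 - p) * norm (v x) powr p)"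
      using i by (intro Bochner_Integration.integrable_add integrable_mult_right)
    show "(\<lambda>x. norm (u x - v x) powr p) \<in> borel_measurable (lebesgue_on \<Omega>)"
      using m by measurable
    show "AE x in lebesgue_on \<Omega>. norm (norm (u x - v x) powr p)
        \<le> norm ((1 - 1/2) powr (1 - p) * norm (u x) powr p + (1/2) powr (1 - p) * norm (v x) powr p)"
    proof (rule AE_I2)
      fix x
      have "norm (u x - v x) powr p \<le> (1 - 1/2) powr (1 - p) * norm (u x) powr p + (1/2) powr (1 - p) * norm (u x - v x - u x) powr p"
        using assms by (intro norm_powr_diff_le) auto
      then show "norm (norm (u x - v x) powr p)
        \<le> norm ((1 - 1/2) powr (1 - p) * norm (u x) powr p + (1/2) powr (1 - p) * norm (v x) powr p)"
        by simp
    qed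
  qed
  then show ?thesis using m by (simp add: Lp_space_def)
qed

text \<open>Completeness of Lebesgue measure: the preimages of a Borel set under f and g differ by a
  null set. Since \<open>weak_grad\<close> is an arbitrary choice, it inherits integrability from
  another representative in this way.\<close>

lemma borel_measurable_AE_lebesgue_on:
  fixes f g :: "real^'n::finite \<Rightarrow> 'b::euclidean_space"
  assumes "open \<Omega>" and f: "f \<in> borel_measurable (lebesgue_on \<Omega>)"
    and ae: "AE x in lebesgue_on \<Omega>. f x = g x"
  shows "g \<in> borel_measurable (lebesgue_on \<Omega>)"
proof (rule measurableI)
  fix A :: "'b set" assume A: "A \<in> sets borel"
  have sp: "space (lebesgue_on \<Omega>) = \<Omega>" by simp
  have "f -` A \<inter> space (lebesgue_on \<Omega>) \<in> sets (lebesgue_on \<Omega>)"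
    using f A by (rule measurable_sets)
  then have fA: "f -` A \<inter> \<Omega> \<in> sets lebesgue"
    using \<open>open \<Omega>\<close> by (simp add: sets_restrict_space_iff)
  have "AE x in lebesgue. x \<in> \<Omega> \<longrightarrow> f x = g x"
    using ae \<open>open \<Omega>\<close> by (subst (asm) AE_restrict_space_iff) auto
  then have "AE x in lebesgue. x \<in> f -` A \<inter> \<Omega> \<longleftrightarrow> x \<in> g -` A \<inter> \<Omega>"
    by eventually_elim auto
  then have "g -` A \<inter> \<Omega> \<in> sets lebesgue"
    by (rule completion.in_sets_AE) (use fA in auto)
  then show "g -` A \<inter> space (lebesgue_on \<Omega>) \<in> sets (lebesgue_on \<Omega>)"
    using \<open>open \<Omega>\<close> by (simp add: sets_restrict_space_iff)
qed simp

lemma Lp_space_AE: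
  fixes f g :: "real^'n::finite \<Rightarrow> 'b::euclidean_space"
  assumes "open \<Omega>" "f \<in> Lp_space p \<Omega>" "AE x in lebesgue_on \<Omega>. f x = g x"
  shows "g \<in> Lp_space p \<Omega>"
proof -
  have f: "f \<in> borel_measurable (lebesgue_on \<Omega>)" "integrable (lebesgue_on \<Omega>) (\<lambda>x. norm (f x) powr p)"
    using assms by (auto simp: Lp_space_def)
  have g: "g \<in> borel_measurable (lebesgue_on \<Omega>)"
    using borel_measurable_AE_lebesgue_on[OF assms(1) f(1) assms(3)] .
  have "integrable (lebesgue_on \<Omega>) (\<lambda>x. norm (g x) powr p)"
    by (rule integrable_cong_AE_imp[OF f(2)]) (use g assms(3) in \<open>measurable, auto\<close>)
  with g show ?thesis by (simp add: Lp_space_def)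
qed

lemma Lp_norm_eq_integral:
  assumes "p > 0"
  shows "Lp_norm p \<Omega> f powr p = (LINT x|lebesgue_on \<Omega>. norm (f x) powr p)"
  using assms by (simp add: Lp_norm_def powr_powr integral_nonneg)


text \<open>Integrals over the whole space; for test functions these are the integrals over \<open>\<Omega>\<close>.\<close>

definition energy :: "real \<Rightarrow> (real^'n::finite \<Rightarrow> real) \<Rightarrow> real"
  where "energy p \<phi> = (LINT x|lborel. norm (grad \<phi> x) powr p)"

definition mass :: "real \<Rightarrow> (real^'n::finite \<Rightarrow> real) \<Rightarrow> real"
  where "mass p \<phi> = (LINT x|lborel. \<bar>\<phi> x\<bar> powr p)"

lemma continuous_on_norm_powr:
  fixes f :: "'a::topological_space \<Rightarrow> 'b::real_normed_vector"
  assumes "continuous_on S f" "p > 0"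
  shows "continuous_on S (\<lambda>x. norm (f x) powr p)"
  using assms by (intro continuous_on_powr' continuous_intros) auto

lemma test_function_integrals:
  assumes "\<phi> \<in> test_functions \<Omega>" "open \<Omega>" "p > 0"
  shows "integrable lborel (\<lambda>x. norm (grad \<phi> x) powr p)" "integrable lborel (\<lambda>x. \<bar>\<phi> x\<bar> powr p)"
    "(LINT x|lebesgue_on \<Omega>. norm (grad \<phi> x) powr p) = energy p \<phi>"
    "(LINT x|lebesgue_on \<Omega>. \<bar>\<phi> x\<bar> powr p) = mass p \<phi>"
    "\<phi> \<in> Lp_space p \<Omega>" "grad \<phi> \<in> Lp_space p \<Omega>"
proof -
  obtain K where K: "smooth \<phi>" "compact K" "K \<subseteq> \<Omega>" "\<And>x. x \<notin> K \<Longrightarrow> \<phi> x = 0"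
    using assms(1) by (auto elim: test_functionsE)
  have g0: "grad \<phi> x = 0" if "x \<notin> K" for x
    using grad_zero_outside[of K \<phi>] K that compact_imp_closed by blast
  have c: "continuous_on UNIV \<phi>" "continuous_on UNIV (grad \<phi>)"
    using K by (auto intro!: smooth_continuous_on smooth_continuous_grad)
  have c1: "continuous_on UNIV (\<lambda>x. norm (grad \<phi> x) powr p)" and c2: "continuous_on UNIV (\<lambda>x. \<bar>\<phi> x\<bar> powr p)"
    using continuous_on_norm_powr[OF c(2) assms(3)] continuous_on_norm_powr[OF c(1) assms(3)] by simp_all
  show i1: "integrable lborel (\<lambda>x. norm (grad \<phi> x) powr p)"
    by (rule integrable_compact_support[OF c1 K(2)]) (simp add: g0)
  show i2: "integrable lborel (\<lambda>x. \<bar>\<phi> x\<bar> powr p)"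
    by (rule integrable_compact_support[OF c2 K(2)]) (simp add: K(4))
  have z: "norm (grad \<phi> x) powr p = 0" "\<bar>\<phi> x\<bar> powr p = 0" if "x \<notin> \<Omega>" for x
    using that K(3) g0[of x] K(4)[of x] by auto
  note L1 = LINT_lebesgue_on_eq[OF assms(2) borel_measurable_continuous_onI[OF c1] z(1)]
  note L2 = LINT_lebesgue_on_eq[OF assms(2) borel_measurable_continuous_onI[OF c2] z(2)]
  show "(LINT x|lebesgue_on \<Omega>. norm (grad \<phi> x) powr p) = energy p \<phi>"
    "(LINT x|lebesgue_on \<Omega>. \<bar>\<phi> x\<bar> powr p) = mass p \<phi>"
    using L1(1) L2(1) by (simp_all add: energy_def mass_def)
  have m: "\<phi> \<in> borel_measurable (lebesgue_on \<Omega>)" "grad \<phi> \<in> borel_measurable (lebesgue_on \<Omega>)"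
    using borel_measurable_continuous_onI[OF c(1)] borel_measurable_continuous_onI[OF c(2)]
    by (auto intro!: measurable_restrict_space1 measurable_completion)
  show "\<phi> \<in> Lp_space p \<Omega>" "grad \<phi> \<in> Lp_space p \<Omega>"
    using m L1(2) L2(2) i1 i2 by (simp_all add: Lp_space_def)
qed

lemma energy_nonneg: "energy p \<phi> \<ge> 0" and mass_nonneg: "mass p \<phi> \<ge> 0"
  unfolding energy_def mass_def by (auto intro: integral_nonneg)

lemma mass_pos:
  assumes "\<phi> \<in> test_functions \<Omega>" "open \<Omega>" "p > 0" "\<phi> z \<noteq> 0"
  shows "mass p \<phi> > 0"
proof -
  have c: "continuous_on UNIV \<phi>" using assms test_functions_smooth smooth_continuous_on by blast
  have "\<not> (AE x in lborel. \<bar>\<phi> x\<bar> powr p = 0)"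
  proof
    assume "AE x in lborel. \<bar>\<phi> x\<bar> powr p = 0"
    then have "AE x in lebesgue. x \<notin> {x. \<phi> x \<noteq> 0}" by (intro AE_completion) simp
    moreover have "open {x. \<phi> x \<noteq> 0}" using c by (intro open_Collect_neq) auto
    ultimately have "negligible {x. \<phi> x \<noteq> 0}" 
      unfolding negligible_iff_null_sets by (subst AE_iff_null_sets) auto
    with \<open>open {x. \<phi> x \<noteq> 0}\<close> assms(4) open_not_negligible show False by blast
  qed
  then have "mass p \<phi> \<noteq> 0"
    unfolding mass_def using test_function_integrals(2)[OF assms(1-3)]
    by (subst integral_nonneg_eq_0_iff_AE) auto
  then show ?thesis using mass_nonneg[of p \<phi>] by simp
qed

lemma exists_test_function:
  assumes "open \<Omega>" "\<Omega> \<noteq> {}"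
  obtains \<phi> z where "\<phi> \<in> test_functions \<Omega>" "\<phi> z \<noteq> 0"
proof -
  obtain z where "z \<in> \<Omega>" using assms by blast
  then obtain a b where ab: "z \<in> box a b" "cbox a b \<subseteq> \<Omega>"
    using open_contains_cbox[OF assms(1)] by metis
  show ?thesis
    by (rule that[of "box_bump a b 1" z]) (use box_bump_test[OF ab(2)] box_bump_pos[OF ab(1), of 1] in auto)
qed

lemma test_functions_scale: "\<phi> \<in> test_functions \<Omega> \<Longrightarrow> (\<lambda>x. c * \<phi> x) \<in> test_functions \<Omega>"
  by (elim test_functionsE, rule test_functionsI) (auto intro!: smooth_intros)

lemma grad_scale: "\<phi> differentiable (at x) \<Longrightarrow> grad (\<lambda>x. c * \<phi> x) x = c *\<^sub>R grad \<phi> x"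
  using grad_mult[of "\<lambda>x. c" x \<phi>] by simp

lemma energy_scale:
  assumes "smooth \<phi>"
  shows "energy p (\<lambda>x. c * \<phi> x) = \<bar>c\<bar> powr p * energy p \<phi>"
  unfolding energy_def by (simp add: grad_scale[OF smooth_differentiable[OF assms]] powr_mult)

lemma mass_scale: "mass p (\<lambda>x. c * \<phi> x) = \<bar>c\<bar> powr p * mass p \<phi>"
  unfolding mass_def by (simp add: abs_mult powr_mult)

lemma weak_grad_AE:
  assumes "open \<Omega>" "is_weak_grad \<Omega> u G"
  shows "AE x in lebesgue_on \<Omega>. weak_grad \<Omega> u x = G x"
  unfolding weak_grad_def by (rule weak_grad_unique[OF assms(1) someI[of "is_weak_grad \<Omega> u"]]) (fact assms)+

lemma test_functions_W1p_0:
  assumes "\<phi> \<in> test_functions \<Omega>" "open \<Omega>" "p > 0"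
  shows "\<phi> \<in> W1p_0 p \<Omega>" "(LINT x|lebesgue_on \<Omega>. norm (weak_grad \<Omega> \<phi> x) powr p) = energy p \<phi>"
proof -
  note I = test_function_integrals[OF assms]
  have wg: "is_weak_grad \<Omega> \<phi> (grad \<phi>)"
    using is_weak_grad_smooth[OF assms(2) test_functions_smooth[OF assms(1)]] .
  have ae: "AE x in lebesgue_on \<Omega>. grad \<phi> x = weak_grad \<Omega> \<phi> x"
    using weak_grad_AE[OF assms(2) wg] by eventually_elim simp
  have "weak_grad \<Omega> \<phi> \<in> Lp_space p \<Omega>"
    using Lp_space_AE[OF assms(2) I(6) ae] .
  then have "(LINT x|lebesgue_on \<Omega>. norm (weak_grad \<Omega> \<phi> x) powr p) = (LINT x|lebesgue_on \<Omega>. norm (grad \<phi> x) powr p)"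
    using I(6) ae unfolding Lp_space_def by (intro integral_cong_AE) auto
  then show "(LINT x|lebesgue_on \<Omega>. norm (weak_grad \<Omega> \<phi> x) powr p) = energy p \<phi>"
    using I(3) by simp
  \<comment> \<open>A test function approximates itself, but the distance involves
    \<open>weak_grad\<close> of the zero function, a chosen representative known to vanish only
    almost everywhere.\<close>
  have "smooth (\<lambda>x::real^'a. 0)" by (rule smooth_const)
  moreover have gz: "grad (\<lambda>x::real^'a. 0) = (\<lambda>x. 0)" by (rule ext) simp
  ultimately have wz: "is_weak_grad \<Omega> (\<lambda>x. 0) (\<lambda>x. 0)"
    using is_weak_grad_smooth[OF assms(2), of "\<lambda>x. 0"] by simp
  have "AE x in lebesgue_on \<Omega>. 0 = weak_grad \<Omega> (\<lambda>x. 0) x"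
    using weak_grad_AE[OF assms(2) wz] by eventually_elim simp
  moreover from this have "weak_grad \<Omega> (\<lambda>x. 0) \<in> Lp_space p \<Omega>"
    by (rule Lp_space_AE[OF assms(2), rotated]) (use assms in \<open>simp add: Lp_space_def\<close>)
  ultimately have "(LINT x|lebesgue_on \<Omega>. norm (weak_grad \<Omega> (\<lambda>x. 0) x) powr p) = (LINT x|lebesgue_on \<Omega>. norm (0::real^'a) powr p)"
    unfolding Lp_space_def by (intro integral_cong_AE) (auto elim: AE_mp)
  then have "W1p_norm p \<Omega> (\<lambda>x. \<phi> x - \<phi> x) = 0"
    using assms by (simp add: W1p_norm_def Lp_norm_def)
  then show "\<phi> \<in> W1p_0 p \<Omega>"
    using I(5,6) wg assms(1) unfolding W1p_0_def W1p_def by (auto intro!: bexI[of _ \<phi>])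
qed

lemma bdd_below_first_eigenvalue:
  "bdd_below {LINT x|lebesgue_on \<Omega>. norm (weak_grad \<Omega> u x) powr p | u.
      u \<in> W1p_0 p \<Omega> \<and> \<not> (AE x in lebesgue_on \<Omega>. u x = 0) \<and> Lp_norm p \<Omega> u = 1}"
  by (rule bdd_belowI[of _ 0]) (auto intro: integral_nonneg)

lemma first_eigenvalue_candidate:
  fixes \<Omega> :: "(real^'n::finite) set"
  assumes "\<phi> \<in> test_functions \<Omega>" "open \<Omega>" "p > 0" "mass p \<phi> > 0"
  shows "energy p \<phi> / mass p \<phi> \<in> {LINT x|lebesgue_on \<Omega>. norm (weak_grad \<Omega> u x) powr p | u.
      u \<in> W1p_0 p \<Omega> \<and> \<not> (AE x in lebesgue_on \<Omega>. u x = 0) \<and> Lp_norm p \<Omega> u = 1}"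
proof -
  define c where "c = mass p \<phi> powr (- (1 / p))"
  have c: "\<bar>c\<bar> powr p = 1 / mass p \<phi>"
    using assms by (simp add: c_def powr_powr)
  define u where "u x = c * \<phi> x" for x
  have u: "u \<in> test_functions \<Omega>" unfolding u_def[abs_def] using assms(1) by (rule test_functions_scale)
  have m: "mass p u = 1" unfolding u_def[abs_def] mass_scale c using assms by simp
  have e: "energy p u = energy p \<phi> / mass p \<phi>"
    unfolding u_def[abs_def] energy_scale[OF test_functions_smooth[OF assms(1)]] c by simp
  have n: "Lp_norm p \<Omega> u = 1"
    using test_function_integrals(4)[OF u assms(2,3)] m by (simp add: Lp_norm_def)
  have "\<not> (AE x in lebesgue_on \<Omega>. u x = 0)"
  proof
    assume ae: "AE x in lebesgue_on \<Omega>. u x = 0"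
    have "u \<in> borel_measurable (lebesgue_on \<Omega>)"
      using test_function_integrals(5)[OF u assms(2,3)] by (simp add: Lp_space_def)
    then have "(LINT x|lebesgue_on \<Omega>. \<bar>u x\<bar> powr p) = (LINT x|lebesgue_on \<Omega>. 0)"
      using ae by (intro integral_cong_AE) auto
    then show False using test_function_integrals(4)[OF u assms(2,3)] m by simp
  qed
  then show ?thesis
    using n e test_functions_W1p_0[OF u assms(2,3)] by (intro CollectI exI[of _ u]) simp
qed

lemma first_eigenvalue_le:
  assumes "\<phi> \<in> test_functions \<Omega>" "open \<Omega>" "p > 0" "mass p \<phi> > 0"
  shows "first_eigenvalue p \<Omega> \<le> energy p \<phi> / mass p \<phi>"
  unfolding first_eigenvalue_def
  by (intro cInf_lower bdd_below_first_eigenvalue first_eigenvalue_candidate assms)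

lemma partial_deriv_test_function:
  assumes "\<phi> \<in> test_functions \<Omega>"
  shows "partial_deriv i \<phi> \<in> test_functions \<Omega>"
proof -
  obtain K where K: "smooth \<phi>" "compact K" "K \<subseteq> \<Omega>" "\<And>x. x \<notin> K \<Longrightarrow> \<phi> x = 0"
    using assms by (auto elim: test_functionsE)
  have "grad \<phi> x = 0" if "x \<notin> K" for x
    using grad_zero_outside[of K \<phi>] K that compact_imp_closed by blast
  then show ?thesis
    by (intro test_functionsI[OF smooth_partial_deriv[OF K(1)] K(2,3)]) (simp add: partial_deriv_eq_grad)
qed

lemma is_weak_grad_diff:
  assumes "open \<Omega>" and u: "is_weak_grad \<Omega> u G" and v: "is_weak_grad \<Omega> v H"
  shows "is_weak_grad \<Omega> (\<lambda>x. u x - v x) (\<lambda>x. G x - H x)"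
  unfolding is_weak_grad_def
proof (intro conjI ballI allI)
  have loc: "u locally_integrable_on \<Omega>" "v locally_integrable_on \<Omega>" "G locally_integrable_on \<Omega>" "H locally_integrable_on \<Omega>"
    using u v by (auto simp: is_weak_grad_def)
  then show "(\<lambda>x. u x - v x) locally_integrable_on \<Omega>" "(\<lambda>x. G x - H x) locally_integrable_on \<Omega>"
    by (auto intro!: locally_integrable_diff)
  fix \<phi> i assume phi: "\<phi> \<in> test_functions \<Omega>"
  note I = integrable_times_test_function[OF \<open>open \<Omega>\<close>]
  note loc' = locally_integrable_component[OF loc(3)] locally_integrable_component[OF loc(4)]
  have "(LINT x|lebesgue_on \<Omega>. (u x - v x) * partial_deriv i \<phi> x) =
     (LINT x|lebesgue_on \<Omega>. u x * partial_deriv i \<phi> x) - (LINT x|lebesgue_on \<Omega>. v x * partial_deriv i \<phi> x)"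
    using I[OF loc(1) partial_deriv_test_function[OF phi], of i] I[OF loc(2) partial_deriv_test_function[OF phi], of i]
    by (simp add: left_diff_distrib)
  moreover have "(LINT x|lebesgue_on \<Omega>. (G x - H x) $ i * \<phi> x) =
     (LINT x|lebesgue_on \<Omega>. G x $ i * \<phi> x) - (LINT x|lebesgue_on \<Omega>. H x $ i * \<phi> x)"
    using I[OF loc'(1) phi, of i] I[OF loc'(2) phi, of i]
    by (simp add: left_diff_distrib)
  ultimately show "(LINT x|lebesgue_on \<Omega>. (u x - v x) * partial_deriv i \<phi> x) =
      - (LINT x|lebesgue_on \<Omega>. (G x - H x) $ i * \<phi> x)"
    using u v phi by (simp add: is_weak_grad_def)
qed

lemma Lp_integral_le:
  fixes f g :: "real^'n::finite \<Rightarrow> 'b::euclidean_space"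
  assumes "f \<in> Lp_space p \<Omega>" "g \<in> Lp_space p \<Omega>" "0 < t" "t < 1" "p \<ge> 1"
  shows "(LINT x|lebesgue_on \<Omega>. norm (f x) powr p) \<le>
    (1 - t) powr (1 - p) * (LINT x|lebesgue_on \<Omega>. norm (g x) powr p)
    + t powr (1 - p) * (LINT x|lebesgue_on \<Omega>. norm (f x - g x) powr p)"
proof -
  have i: "integrable (lebesgue_on \<Omega>) (\<lambda>x. norm (f x) powr p)" "integrable (lebesgue_on \<Omega>) (\<lambda>x. norm (g x) powr p)"
    "integrable (lebesgue_on \<Omega>) (\<lambda>x. norm (f x - g x) powr p)"
    using assms(1,2) Lp_space_diff[OF assms(1,2,5)] by (auto simp: Lp_space_def)
  have "(LINT x|lebesgue_on \<Omega>. norm (f x) powr p) \<le>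
    (LINT x|lebesgue_on \<Omega>. (1 - t) powr (1 - p) * norm (g x) powr p + t powr (1 - p) * norm (f x - g x) powr p)"
    using i assms by (intro integral_mono Bochner_Integration.integrable_add integrable_mult_right norm_powr_diff_le)
  also have "\<dots> = (1 - t) powr (1 - p) * (LINT x|lebesgue_on \<Omega>. norm (g x) powr p)
    + t powr (1 - p) * (LINT x|lebesgue_on \<Omega>. norm (f x - g x) powr p)"
    using i by (subst Bochner_Integration.integral_add) auto
  finally show ?thesis .
qed

text \<open>An inequality tested on smooth functions passes to the closure \<open>W1p_0\<close>.
  Approximating u by \<phi> costs, by convexity with parameter t, factors (1 - t)^(1-p) and a
  multiple of the error \<delta>; for fixed t the error tends to 0 first, then t tends to 0.
  Together with \<open>first_eigenvalue_le\<close> this turns the eigenvalue into an infimum over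
  test functions.\<close>

lemma first_eigenvalue_ge:
  fixes \<Omega> :: "(real^'n::finite) set"
  assumes "open \<Omega>" "\<Omega> \<noteq> {}" "p \<ge> 1" "\<mu> \<ge> 0"
    and test: "\<And>\<phi>. \<phi> \<in> test_functions \<Omega> \<Longrightarrow> \<mu> * mass p \<phi> \<le> energy p \<phi>"
  shows "\<mu> \<le> first_eigenvalue p \<Omega>"
  unfolding first_eigenvalue_def
proof (rule cInf_greatest)
  have p: "p > 0" using assms by simp
  obtain \<phi> z where "\<phi> \<in> test_functions \<Omega>" "\<phi> z \<noteq> 0"
    using exists_test_function[OF assms(1,2)] .
  then show "{LINT x|lebesgue_on \<Omega>. norm (weak_grad \<Omega> u x) powr p | u.
      u \<in> W1p_0 p \<Omega> \<and> \<not> (AE x in lebesgue_on \<Omega>. u x = 0) \<and> Lp_norm p \<Omega> u = 1} \<noteq> {}"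
    using first_eigenvalue_candidate[OF _ assms(1) p mass_pos[OF _ assms(1) p]] by blast
  fix v assume "v \<in> {LINT x|lebesgue_on \<Omega>. norm (weak_grad \<Omega> u x) powr p | u.
      u \<in> W1p_0 p \<Omega> \<and> \<not> (AE x in lebesgue_on \<Omega>. u x = 0) \<and> Lp_norm p \<Omega> u = 1}"
  then obtain u where v: "v = (LINT x|lebesgue_on \<Omega>. norm (weak_grad \<Omega> u x) powr p)"
    and u: "u \<in> W1p_0 p \<Omega>" "Lp_norm p \<Omega> u = 1" by blast
  define G where "G = weak_grad \<Omega> u"
  have uL: "u \<in> Lp_space p \<Omega>" using u by (simp add: W1p_0_def W1p_def)
  obtain G0 where G0: "G0 \<in> Lp_space p \<Omega>" "is_weak_grad \<Omega> u G0"
    using u by (auto simp: W1p_0_def W1p_def)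
  have wG: "is_weak_grad \<Omega> u G" unfolding G_def weak_grad_def by (rule someI[of "is_weak_grad \<Omega> u", OF G0(2)])
  have GL: "G \<in> Lp_space p \<Omega>"
    using Lp_space_AE[OF assms(1) G0(1)] weak_grad_unique[OF assms(1) G0(2) wG] by blast
  have u1: "(LINT x|lebesgue_on \<Omega>. norm (u x) powr p) = 1"
    using Lp_norm_eq_integral[OF p, of \<Omega> u] u by simp
  \<comment> \<open>Convexity is used twice: from u to \<phi>, to bound the mass of \<phi> from
    below, and from the gradient of \<phi> to \<open>G\<close>, to bound its energy from above;
    hence the squared factor in front of \<open>v\<close>.\<close>
  have main: "\<mu> \<le> (1 - t) powr (1 - p) * ((1 - t) powr (1 - p) * v) + ((1 - t) powr (1 - p) * t powr (1 - p) + \<mu> * t powr (1 - p)) * \<delta>"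
    if t: "0 < t" "t < 1" and d: "\<delta> > 0" for t \<delta>
  proof -
    obtain \<phi> where phi: "\<phi> \<in> test_functions \<Omega>" "W1p_norm p \<Omega> (\<lambda>x. u x - \<phi> x) < \<delta> powr (1 / p)"
    proof -
      have "\<delta> powr (1 / p) > 0" using d by simp
      then show ?thesis using u(1) that unfolding W1p_0_def mem_Collect_eq by metis
    qed
    have n: "0 \<le> Lp_norm p \<Omega> (\<lambda>x. u x - \<phi> x)" "0 \<le> Lp_norm p \<Omega> (weak_grad \<Omega> (\<lambda>x. u x - \<phi> x))"
      "Lp_norm p \<Omega> (\<lambda>x. u x - \<phi> x) + Lp_norm p \<Omega> (weak_grad \<Omega> (\<lambda>x. u x - \<phi> x)) < \<delta> powr (1 / p)"
      using phi(2) by (auto simp: Lp_norm_def W1p_norm_def)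
    note I = test_function_integrals[OF phi(1) assms(1) p]
    have wd: "is_weak_grad \<Omega> (\<lambda>x. u x - \<phi> x) (\<lambda>x. G x - grad \<phi> x)"
      using is_weak_grad_diff[OF assms(1) wG is_weak_grad_smooth[OF assms(1) test_functions_smooth[OF phi(1)]]] .
    have ae: "AE x in lebesgue_on \<Omega>. G x - grad \<phi> x = weak_grad \<Omega> (\<lambda>x. u x - \<phi> x) x"
      using weak_grad_AE[OF assms(1) wd] by eventually_elim simp
    have L: "(\<lambda>x. G x - grad \<phi> x) \<in> Lp_space p \<Omega>" using Lp_space_diff[OF GL I(6) assms(3)] .
    then have "weak_grad \<Omega> (\<lambda>x. u x - \<phi> x) \<in> Lp_space p \<Omega>" using Lp_space_AE[OF assms(1) _ ae] by blast
    then have "(LINT x|lebesgue_on \<Omega>. norm (G x - grad \<phi> x) powr p) =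
       (LINT x|lebesgue_on \<Omega>. norm (weak_grad \<Omega> (\<lambda>x. u x - \<phi> x) x) powr p)"
      using L ae unfolding Lp_space_def by (intro integral_cong_AE) auto
    also have "\<dots> = Lp_norm p \<Omega> (weak_grad \<Omega> (\<lambda>x. u x - \<phi> x)) powr p"
      using Lp_norm_eq_integral[OF p] by metis
    also have "\<dots> \<le> (\<delta> powr (1 / p)) powr p"
      using n p by (intro powr_mono2) auto
    also have "\<dots> = \<delta>" using d p by (simp add: powr_powr)
    finally have b1: "(LINT x|lebesgue_on \<Omega>. norm (grad \<phi> x - G x) powr p) \<le> \<delta>" by (simp add: norm_minus_commute)
    have "(LINT x|lebesgue_on \<Omega>. norm (u x - \<phi> x) powr p) = Lp_norm p \<Omega> (\<lambda>x. u x - \<phi> x) powr p"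
      using Lp_norm_eq_integral[OF p] by metis
    also have "\<dots> \<le> (\<delta> powr (1 / p)) powr p"
      using n p by (intro powr_mono2) auto
    also have "\<dots> = \<delta>" using d p by (simp add: powr_powr)
    finally have b2: "(LINT x|lebesgue_on \<Omega>. norm (u x - \<phi> x) powr p) \<le> \<delta>" .
    have "1 \<le> (1 - t) powr (1 - p) * mass p \<phi> + t powr (1 - p) * (LINT x|lebesgue_on \<Omega>. norm (u x - \<phi> x) powr p)"
      using Lp_integral_le[OF uL I(5) t assms(3)] I(4) u1 by simp
    also have "\<dots> \<le> (1 - t) powr (1 - p) * mass p \<phi> + t powr (1 - p) * \<delta>"
      using b2 by (intro add_left_mono mult_left_mono) auto
    finally have "\<mu> * 1 \<le> \<mu> * ((1 - t) powr (1 - p) * mass p \<phi> + t powr (1 - p) * \<delta>)"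
      using assms(4) by (rule mult_left_mono)
    moreover have "(1 - t) powr (1 - p) * (\<mu> * mass p \<phi>) \<le> (1 - t) powr (1 - p) * energy p \<phi>"
      using test[OF phi(1)] by (intro mult_left_mono) auto
    moreover have "(1 - t) powr (1 - p) * energy p \<phi> \<le> (1 - t) powr (1 - p) * ((1 - t) powr (1 - p) * v + t powr (1 - p) * \<delta>)"
    proof (intro mult_left_mono)
      have "energy p \<phi> \<le> (1 - t) powr (1 - p) * v + t powr (1 - p) * (LINT x|lebesgue_on \<Omega>. norm (grad \<phi> x - G x) powr p)"
        using Lp_integral_le[OF I(6) GL t assms(3)] I(3) v by (simp add: G_def)
      also have "\<dots> \<le> (1 - t) powr (1 - p) * v + t powr (1 - p) * \<delta>"
        using b1 by (intro add_left_mono mult_left_mono) auto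
      finally show "energy p \<phi> \<le> \<dots>" .
    qed auto
    ultimately show ?thesis by (simp add: algebra_simps)
  qed
  \<comment> \<open>With t fixed the error is a constant \<open>C\<close> times \<delta>, so
    \<delta> = e/C makes it equal to an arbitrary e > 0.\<close>
  have step: "\<mu> \<le> (1 - t) powr (1 - p) * ((1 - t) powr (1 - p) * v)" if t: "0 < t" "t < 1" for t
  proof (rule field_le_epsilon)
    fix e :: real assume e: "e > 0"
    define C where "C = (1 - t) powr (1 - p) * t powr (1 - p) + \<mu> * t powr (1 - p)"
    have C: "C > 0" unfolding C_def using t assms(4) by (intro add_pos_nonneg mult_pos_pos) auto
    show "\<mu> \<le> (1 - t) powr (1 - p) * ((1 - t) powr (1 - p) * v) + e"
      using main[OF t, of "e / C"] e C unfolding C_def[symmetric] by simp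
  qed
  have "((\<lambda>t. (1 - t) powr (1 - p) * ((1 - t) powr (1 - p) * v)) \<longlongrightarrow> (1 - 0) powr (1 - p) * ((1 - 0) powr (1 - p) * v)) (at_right 0)"
    by (intro tendsto_intros) auto
  moreover have "eventually (\<lambda>t. \<mu> \<le> (1 - t) powr (1 - p) * ((1 - t) powr (1 - p) * v)) (at_right (0::real))"
    using step unfolding eventually_at_right_field by (intro exI[of _ 1]) auto
  ultimately have "\<mu> \<le> (1 - 0) powr (1 - p) * ((1 - 0) powr (1 - p) * v)"
    by (rule tendsto_lowerbound) simp
  then show "\<mu> \<le> v" by simp
qed

section \<open>The limit p to 1\<close>

lemma LINT_tendsto_compact:
  fixes f :: "nat \<Rightarrow> real^'n::finite \<Rightarrow> real"
  assumes K: "compact K" and m: "\<And>n. f n \<in> borel_measurable borel"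
    and out: "\<And>n x. x \<notin> K \<Longrightarrow> f n x = 0" and B: "\<And>n x. x \<in> K \<Longrightarrow> \<bar>f n x\<bar> \<le> B"
    and lim: "\<And>x. (\<lambda>n. f n x) \<longlonglongrightarrow> g x"
  shows "(\<lambda>n. LINT x|lborel. f n x) \<longlonglongrightarrow> (LINT x|lborel. g x)"
proof (rule integral_dominated_convergence[where w="\<lambda>x. B * indicator K x"])
  show "g \<in> borel_measurable lborel"
    by (rule borel_measurable_LIMSEQ_real[OF lim]) (use m in simp)
  show "integrable lborel (\<lambda>x. B * indicator K x)"
    using K by (intro integrable_mult_right integrable_real_indicator emeasure_compact_finite)
      (auto intro: borel_compact)
  show "AE x in lborel. norm (f n x) \<le> B * indicator K x" for n
    using B out by (intro AE_I2) (auto simp: indicator_def)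
qed (use m lim in auto)

text \<open>The functional form of the Cheeger constant: the least quotient of total variation and
  L1 norm, taken over smooth competitors.\<close>

definition cheeger :: "(real^'n::finite) set \<Rightarrow> real"
  where "cheeger \<Omega> = Inf {energy 1 \<phi> / mass 1 \<phi> | \<phi>. \<phi> \<in> test_functions \<Omega> \<and> mass 1 \<phi> > 0}"

lemma cheeger_le:
  assumes "\<phi> \<in> test_functions \<Omega>"
  shows "cheeger \<Omega> * mass 1 \<phi> \<le> energy 1 \<phi>"
proof (cases "mass 1 \<phi> > 0")
  case True
  have "cheeger \<Omega> \<le> energy 1 \<phi> / mass 1 \<phi>"
    unfolding cheeger_def
    by (rule cInf_lower) (use True assms in \<open>auto intro!: bdd_belowI[of _ 0] simp: energy_nonneg\<close>)
  then show ?thesis using True by (simp add: pos_le_divide_eq)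
next
  case False
  then have "mass 1 \<phi> = 0" using mass_nonneg[of 1 \<phi>] by simp
  then show ?thesis by (simp add: energy_nonneg)
qed

lemma cheeger_ge:
  assumes "open \<Omega>" "\<Omega> \<noteq> {}"
    and "\<And>\<phi>. \<phi> \<in> test_functions \<Omega> \<Longrightarrow> c * mass 1 \<phi> \<le> energy 1 \<phi>"
  shows "c \<le> cheeger \<Omega>"
  unfolding cheeger_def
proof (rule cInf_greatest)
  obtain \<phi> z where p: "\<phi> \<in> test_functions \<Omega>" "\<phi> z \<noteq> 0"
    using exists_test_function[OF assms(1,2)] .
  have "mass 1 \<phi> > 0" using mass_pos[OF p(1) assms(1) _ p(2)] by simp
  then show "{energy 1 \<phi> / mass 1 \<phi> |\<phi>. \<phi> \<in> test_functions \<Omega> \<and> mass 1 \<phi> > 0} \<noteq> {}"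
    using p(1) by blast
qed (use assms(3) in \<open>auto simp: pos_le_divide_eq\<close>)

lemma cheeger_nonneg: "open \<Omega> \<Longrightarrow> \<Omega> \<noteq> {} \<Longrightarrow> cheeger \<Omega> \<ge> 0"
  by (rule cheeger_ge) (auto simp: energy_nonneg)

lemma cheeger_less:
  assumes "open \<Omega>" "\<Omega> \<noteq> {}" "cheeger \<Omega> < b"
  obtains \<phi> where "\<phi> \<in> test_functions \<Omega>" "mass 1 \<phi> > 0" "energy 1 \<phi> / mass 1 \<phi> < b"
proof -
  obtain \<phi> where p: "\<phi> \<in> test_functions \<Omega>" "\<not> b * mass 1 \<phi> \<le> energy 1 \<phi>"
    using cheeger_ge[OF assms(1,2), of b] assms(3) by force
  then have "mass 1 \<phi> > 0"
    using mass_nonneg[of 1 \<phi>] energy_nonneg[of 1 \<phi>] by (cases "mass 1 \<phi> = 0") auto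
  with p that show ?thesis by (simp add: pos_divide_less_eq)
qed

text \<open>Young's inequality for the product of a^(p-1) s and b/s with s = k^((p-1)/p). The free
  weight \<open>k\<close> will be the Cheeger constant over p in one application and \<alpha>/d in
  the Hardy-type inequality.\<close>

lemma Youngs_inequality_scaled:
  fixes a b k p :: real
  assumes "a \<ge> 0" "b \<ge> 0" "k > 0" "p > 1"
  shows "a powr (p - 1) * b \<le> (p - 1) / p * k * a powr p + k powr (1 - p) * b powr p / p"
proof -
  define q where "q = p / (p - 1)"
  define s where "s = k powr ((p - 1) / p)"
  have q: "q > 1" "1 / q + 1 / p = 1" "1 / q = (p - 1) / p" using assms by (auto simp: q_def field_simps)
  have s: "s > 0" using assms by (simp add: s_def)
  have "(a powr (p - 1) * s) * (b / s) \<le> (a powr (p - 1) * s) powr q / q + (b / s) powr p / p"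
    using assms s q by (intro Youngs_inequality) auto
  moreover have "(a powr (p - 1) * s) powr q = k * a powr p"
  proof -
    have "(a powr (p - 1)) powr q = a powr p" using assms by (simp add: powr_powr q_def)
    moreover have "s powr q = k" using assms by (simp add: s_def powr_powr q_def)
    ultimately show ?thesis using assms s by (simp add: powr_mult)
  qed
  moreover have "(b / s) powr p = k powr (1 - p) * b powr p"
  proof -
    have "s powr p = k powr (p - 1)" using assms by (simp add: s_def powr_powr)
    then have "(b / s) powr p = b powr p / k powr (p - 1)" using assms s by (simp add: powr_divide)
    also have "\<dots> = k powr (1 - p) * b powr p"
      using assms by (simp add: powr_diff)
    finally show ?thesis .
  qed
  moreover have "k * a powr p / q = (p - 1) / p * k * a powr p"
    using q(3) by (metis mult.assoc mult.commute times_divide_eq_right mult_1)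
  moreover have "(a powr (p - 1) * s) * (b / s) = a powr (p - 1) * b" using s by simp
  ultimately show ?thesis by simp
qed

text \<open>\<open>(\<phi>\<^sup>2 + \<epsilon>\<^sup>2)\<^sup>p\<^sup>/\<^sup>2 - \<epsilon>\<^sup>p\<close> is a smooth substitute for \<open>|\<phi>|\<^sup>p\<close> which still vanishes
  wherever \<open>\<phi>\<close> does.\<close>

lemma cheeger_mass_le:
  assumes "\<phi> \<in> test_functions \<Omega>" "p > 1"
  shows "cheeger \<Omega> * mass p \<phi> \<le> p * (LINT x|lborel. \<bar>\<phi> x\<bar> powr (p - 1) * norm (grad \<phi> x))"
proof -
  obtain K where K: "smooth \<phi>" "compact K" "K \<subseteq> \<Omega>" "\<And>x. x \<notin> K \<Longrightarrow> \<phi> x = 0"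
    using assms(1) by (auto elim: test_functionsE)
  have g0: "grad \<phi> x = 0" if "x \<notin> K" for x
    using grad_zero_outside[of K \<phi>] K that compact_imp_closed by blast
  have c: "continuous_on UNIV \<phi>" "continuous_on UNIV (grad \<phi>)"
    using K by (auto intro!: smooth_continuous_on smooth_continuous_grad)
  have "bounded (\<phi> ` K)" "bounded (grad \<phi> ` K)"
    using c K by (auto intro!: compact_imp_bounded compact_continuous_image intro: continuous_on_subset)
  then obtain B1 B2 where B: "B1 > 0" "B2 > 0" "\<And>x. x \<in> K \<Longrightarrow> norm (\<phi> x) \<le> B1" "\<And>x. x \<in> K \<Longrightarrow> norm (grad \<phi> x) \<le> B2"
    unfolding bounded_pos by (metis imageI)
  define e where "e n = 1 / real (Suc n)" for n
  have e: "0 < e n" "e n \<le> 1" for n by (auto simp: e_def)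
  have e0: "e \<longlonglongrightarrow> 0" unfolding e_def by (rule LIMSEQ_Suc[OF lim_1_over_n])
  define \<psi> where "\<psi> n x = ((\<phi> x)\<^sup>2 + (e n)\<^sup>2) powr (p / 2) - (e n)\<^sup>2 powr (p / 2)" for n x
  define \<theta> where "\<theta> n x = ((\<phi> x)\<^sup>2 + (e n)\<^sup>2) powr ((p - 1) / 2) * norm (grad \<phi> x)" for n x
  have pos: "(\<phi> x)\<^sup>2 + (e n)\<^sup>2 > 0" for n x using e(1)[of n] by (simp add: add_nonneg_pos)
  have lims: "(\<lambda>n. ((\<phi> x)\<^sup>2 + (e n)\<^sup>2) powr (r / 2)) \<longlonglongrightarrow> \<bar>\<phi> x\<bar> powr r" if "r > 0" for x r
  proof -
    have "(\<lambda>n. ((\<phi> x)\<^sup>2 + (e n)\<^sup>2) powr (r / 2)) \<longlonglongrightarrow> ((\<phi> x)\<^sup>2 + 0\<^sup>2) powr (r / 2)"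
      using that by (intro tendsto_powr' tendsto_intros e0) auto
    moreover have "((\<phi> x)\<^sup>2 + 0\<^sup>2) powr (r / 2) = \<bar>\<phi> x\<bar> powr r"
      by (metis abs_ge_zero add.right_neutral power2_abs powr_powr powr_realpow' powr_half_sqrt real_sqrt_abs
          zero_eq_power2 powr_powr times_divide_eq_left mult_1 sqrt_def powr_half_sqrt_powr zero_le_power2)
    ultimately show ?thesis by simp
  qed
  have psi_test: "\<psi> n \<in> test_functions \<Omega>" for n
    unfolding \<psi>_def by (rule test_functionsI[OF _ K(2,3)]) (use K pos in \<open>auto intro!: smooth_intros smooth_powr\<close>)
  have psi_nonneg: "\<psi> n x \<ge> 0" for n x
    unfolding \<psi>_def using assms by (auto intro!: powr_mono2)
  have sqb: "((\<phi> x)\<^sup>2 + (e n)\<^sup>2) powr r \<le> (B1\<^sup>2 + 1) powr r" if "x \<in> K" "r \<ge> 0" for n x r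
  proof -
    have "(\<phi> x)\<^sup>2 \<le> B1\<^sup>2" using B(3)[OF that(1)] abs_le_square_iff[of "\<phi> x" B1] B(1) by simp
    moreover have "(e n)\<^sup>2 \<le> 1" using e[of n] by (simp add: power_le_one)
    ultimately show ?thesis using that pos[of x n] by (intro powr_mono2) auto
  qed
  have l1: "(\<lambda>n. LINT x|lborel. \<psi> n x) \<longlonglongrightarrow> (LINT x|lborel. \<bar>\<phi> x\<bar> powr p)"
  proof (rule LINT_tendsto_compact[OF K(2), where B="(B1\<^sup>2 + 1) powr (p / 2)"])
    show "\<psi> n \<in> borel_measurable borel" for n
      using smooth_continuous_on[OF test_functions_smooth[OF psi_test]] by (intro borel_measurable_continuous_onI)
    show "\<bar>\<psi> n x\<bar> \<le> (B1\<^sup>2 + 1) powr (p / 2)" if "x \<in> K" for n x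
    proof -
      have "\<psi> n x \<le> ((\<phi> x)\<^sup>2 + (e n)\<^sup>2) powr (p / 2)" by (simp add: \<psi>_def)
      also have "\<dots> \<le> (B1\<^sup>2 + 1) powr (p / 2)" using sqb that assms by simp
      finally show ?thesis using psi_nonneg[of n x] by simp
    qed
    have "(\<lambda>n. (e n)\<^sup>2 powr (p / 2)) \<longlonglongrightarrow> 0\<^sup>2 powr (p / 2)"
      using assms by (intro tendsto_powr' tendsto_intros e0) auto
    then show "(\<lambda>n. \<psi> n x) \<longlonglongrightarrow> \<bar>\<phi> x\<bar> powr p" for x
      unfolding \<psi>_def using tendsto_diff[OF lims[of p x]] assms by fastforce
  qed (auto simp: \<psi>_def K(4))
  have l2: "(\<lambda>n. LINT x|lborel. \<theta> n x) \<longlonglongrightarrow> (LINT x|lborel. \<bar>\<phi> x\<bar> powr (p - 1) * norm (grad \<phi> x))"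
  proof (rule LINT_tendsto_compact[OF K(2), where B="(B1\<^sup>2 + 1) powr ((p - 1) / 2) * B2"])
    show "\<theta> n \<in> borel_measurable borel" for n
      unfolding \<theta>_def using borel_measurable_continuous_onI[OF c(1)] borel_measurable_continuous_onI[OF c(2)] by measurable
    show "\<bar>\<theta> n x\<bar> \<le> (B1\<^sup>2 + 1) powr ((p - 1) / 2) * B2" if "x \<in> K" for n x
      unfolding \<theta>_def abs_mult using sqb[OF that, of "(p - 1) / 2" n] B(4)[OF that] assms
      by (intro mult_mono) auto
    show "(\<lambda>n. \<theta> n x) \<longlonglongrightarrow> \<bar>\<phi> x\<bar> powr (p - 1) * norm (grad \<phi> x)" for x
      unfolding \<theta>_def using assms by (intro tendsto_intros lims) auto
  qed (auto simp: \<theta>_def g0)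
  have theta_int: "integrable lborel (\<theta> n)" for n
  proof (rule integrable_compact_support[OF _ K(2)])
    show "continuous_on UNIV (\<theta> n)"
      unfolding \<theta>_def using pos by (intro continuous_intros c) (metis less_irrefl)
  qed (auto simp: \<theta>_def g0)
  have ineq: "cheeger \<Omega> * (LINT x|lborel. \<psi> n x) \<le> p * (LINT x|lborel. \<theta> n x)" for n
  proof -
    have dh: "((\<lambda>t. (t\<^sup>2 + (e n)\<^sup>2) powr (p / 2) - (e n)\<^sup>2 powr (p / 2)) has_real_derivative
        p * t * (t\<^sup>2 + (e n)\<^sup>2) powr (p / 2 - 1)) (at t)" for t
    proof -
      have pt: "t\<^sup>2 + (e n)\<^sup>2 > 0" using e(1)[of n] by (simp add: add_nonneg_pos)
      have "((\<lambda>s. s powr (p / 2)) has_real_derivative p / 2 * (t\<^sup>2 + (e n)\<^sup>2) powr (p / 2 - 1)) (at (t\<^sup>2 + (e n)\<^sup>2))"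
        using pt by (rule has_real_derivative_powr)
      moreover have "((\<lambda>t. t\<^sup>2 + (e n)\<^sup>2) has_real_derivative 2 * t) (at t)"
        by (auto intro!: derivative_eq_intros)
      ultimately have "((\<lambda>t. (t\<^sup>2 + (e n)\<^sup>2) powr (p / 2)) has_real_derivative
          p / 2 * (t\<^sup>2 + (e n)\<^sup>2) powr (p / 2 - 1) * (2 * t)) (at t)"
        by (rule DERIV_chain2)
      then have "((\<lambda>t. (t\<^sup>2 + (e n)\<^sup>2) powr (p / 2) - (e n)\<^sup>2 powr (p / 2)) has_real_derivative
          p / 2 * (t\<^sup>2 + (e n)\<^sup>2) powr (p / 2 - 1) * (2 * t) - 0) (at t)"
        by (intro DERIV_diff DERIV_const)
      then show ?thesis by (simp add: mult.assoc mult.left_commute mult.commute)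
    qed
    have gpsi: "norm (grad (\<psi> n) x) \<le> p * \<theta> n x" for x
    proof -
      have "grad (\<psi> n) x = (p * \<phi> x * ((\<phi> x)\<^sup>2 + (e n)\<^sup>2) powr (p / 2 - 1)) *\<^sub>R grad \<phi> x"
        unfolding \<psi>_def by (rule grad_compose_1D[OF smooth_differentiable[OF K(1)] dh])
      then have "norm (grad (\<psi> n) x) = p * (\<bar>\<phi> x\<bar> * ((\<phi> x)\<^sup>2 + (e n)\<^sup>2) powr (p / 2 - 1)) * norm (grad \<phi> x)"
        using assms by (simp add: abs_mult mult.assoc)
      \<comment> \<open>The exponent p/2 - 1 may be negative. Absorbing |\<phi>| into the square
        root of \<phi>^2 + e^2 raises it to (p - 1)/2 > 0, so that the bound converges and stays
        dominated as \<open>e n\<close> tends to 0.\<close>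
      also have "\<dots> \<le> p * (((\<phi> x)\<^sup>2 + (e n)\<^sup>2) powr (1 / 2) * ((\<phi> x)\<^sup>2 + (e n)\<^sup>2) powr (p / 2 - 1)) * norm (grad \<phi> x)"
      proof -
        have "\<bar>\<phi> x\<bar> \<le> ((\<phi> x)\<^sup>2 + (e n)\<^sup>2) powr (1 / 2)"
          by (simp add: powr_half_sqrt real_le_rsqrt)
        then show ?thesis using assms by (intro mult_right_mono mult_left_mono) auto
      qed
      also have "\<dots> = p * \<theta> n x"
        by (simp add: \<theta>_def powr_add[symmetric] diff_divide_distrib algebra_simps)
      finally show ?thesis .
    qed
    have "cheeger \<Omega> * (LINT x|lborel. \<psi> n x) \<le> energy 1 (\<psi> n)"
      using cheeger_le[OF psi_test[of n]] psi_nonneg[of n] by (simp add: mass_def)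
    also have "energy 1 (\<psi> n) = (LINT x|lborel. norm (grad (\<psi> n) x))" by (simp add: energy_def)
    also have "\<dots> \<le> (LINT x|lborel. p * \<theta> n x)"
    proof (rule integral_mono_AE')
      show "integrable lborel (\<lambda>x. p * \<theta> n x)" using theta_int by simp
    qed (use gpsi assms in \<open>auto simp: \<theta>_def\<close>)
    finally show ?thesis by simp
  qed
  have "(\<lambda>n. cheeger \<Omega> * (LINT x|lborel. \<psi> n x)) \<longlonglongrightarrow> cheeger \<Omega> * mass p \<phi>"
    unfolding mass_def by (intro tendsto_intros l1)
  moreover have "(\<lambda>n. p * (LINT x|lborel. \<theta> n x)) \<longlonglongrightarrow> p * (LINT x|lborel. \<bar>\<phi> x\<bar> powr (p - 1) * norm (grad \<phi> x))"
    by (intro tendsto_intros l2)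
  ultimately show ?thesis by (rule LIMSEQ_le) (use ineq in auto)
qed

text \<open>The Cheeger inequality for |\<phi>|^p is followed by Young's with weight k = h/p. Then h
  = p k, and the term (p - 1) k \<open>mass p \<phi>\<close> leaves exactly k
  \<open>mass p \<phi>\<close> on the left; multiplying by k^(p-1) finishes.\<close>

lemma cheeger_powr_le_first_eigenvalue:
  assumes "open \<Omega>" "\<Omega> \<noteq> {}" "p > 1"
  shows "(cheeger \<Omega> / p) powr p \<le> first_eigenvalue p \<Omega>"
proof (rule first_eigenvalue_ge[OF assms(1,2)])
  fix \<phi> assume phi: "\<phi> \<in> test_functions \<Omega>"
  define h where "h = cheeger \<Omega>"
  have h0: "h \<ge> 0" unfolding h_def using assms by (intro cheeger_nonneg)
  show "(cheeger \<Omega> / p) powr p * mass p \<phi> \<le> energy p \<phi>"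
  proof (cases "h = 0")
    case True
    then show ?thesis using energy_nonneg by (simp add: h_def)
  next
    case False
    define k where "k = h / p"
    have k: "k > 0" using False h0 assms by (simp add: k_def)
    have p0: "p > 0" using assms by simp
    note I = test_function_integrals[OF phi assms(1) p0]
    have "h * mass p \<phi> \<le> p * (LINT x|lborel. \<bar>\<phi> x\<bar> powr (p - 1) * norm (grad \<phi> x))"
      unfolding h_def by (rule cheeger_mass_le[OF phi assms(3)])
    also have "\<dots> \<le> p * (LINT x|lborel. (p - 1) / p * k * \<bar>\<phi> x\<bar> powr p + k powr (1 - p) * norm (grad \<phi> x) powr p / p)"
    proof (intro mult_left_mono integral_mono_AE')
      show "integrable lborel (\<lambda>x. (p - 1) / p * k * \<bar>\<phi> x\<bar> powr p + k powr (1 - p) * norm (grad \<phi> x) powr p / p)"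
        using I(1,2) by auto
    next
      have "\<bar>\<phi> x\<bar> powr (p - 1) * norm (grad \<phi> x)
        \<le> (p - 1) / p * k * \<bar>\<phi> x\<bar> powr p + k powr (1 - p) * norm (grad \<phi> x) powr p / p" for x
        using k assms by (intro Youngs_inequality_scaled) auto
      then show "AE x in lborel. \<bar>\<phi> x\<bar> powr (p - 1) * norm (grad \<phi> x)
        \<le> (p - 1) / p * k * \<bar>\<phi> x\<bar> powr p + k powr (1 - p) * norm (grad \<phi> x) powr p / p" by simp
    qed (use k assms in auto)
    also have "\<dots> = (p - 1) * k * mass p \<phi> + k powr (1 - p) * energy p \<phi>"
      using I(1,2) p0 by (simp add: mass_def energy_def field_simps)
    finally have "k * mass p \<phi> \<le> k powr (1 - p) * energy p \<phi>"
      using p0 by (simp add: k_def field_simps)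
    then have "k powr (p - 1) * (k * mass p \<phi>) \<le> k powr (p - 1) * (k powr (1 - p) * energy p \<phi>)"
      by (intro mult_left_mono) auto
    then show ?thesis
      using k by (simp add: h_def[symmetric] k_def[symmetric] mult.assoc[symmetric] powr_add[symmetric] powr_diff)
  qed
qed (use assms in auto)

lemma energy_mass_tendsto_1:
  assumes "\<phi> \<in> test_functions \<Omega>"
  shows "((\<lambda>p. energy p \<phi>) \<longlongrightarrow> energy 1 \<phi>) (at_right 1)" "((\<lambda>p. mass p \<phi>) \<longlongrightarrow> mass 1 \<phi>) (at_right 1)"
proof -
  obtain K where K: "smooth \<phi>" "compact K" "K \<subseteq> \<Omega>" "\<And>x. x \<notin> K \<Longrightarrow> \<phi> x = 0"
    using assms(1) by (auto elim: test_functionsE)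
  have g0: "grad \<phi> x = 0" if "x \<notin> K" for x
    using grad_zero_outside[of K \<phi>] K that compact_imp_closed by blast
  have c: "continuous_on UNIV \<phi>" "continuous_on UNIV (grad \<phi>)"
    using K by (auto intro!: smooth_continuous_on smooth_continuous_grad)
  have main: "((\<lambda>p. LINT x|lborel. f x powr p) \<longlongrightarrow> (LINT x|lborel. f x powr 1)) (at_right 1)"
    if f: "continuous_on UNIV f" "\<And>x. x \<notin> K \<Longrightarrow> f x = 0" "\<And>x. f x \<ge> 0" for f :: "real^'a \<Rightarrow> real"
    unfolding tendsto_at_iff_sequentially
  proof (intro allI impI)
    fix X :: "nat \<Rightarrow> real" assume X: "\<forall>i. X i \<in> {1<..} - {1}" "X \<longlonglongrightarrow> 1"
    obtain P where P: "\<And>i. X i \<le> P"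
      using convergent_imp_Bseq[OF convergentI[OF X(2)]] unfolding Bseq_def by (auto simp: abs_le_iff)
    have "bounded (f ` K)"
      using f K by (auto intro!: compact_imp_bounded compact_continuous_image intro: continuous_on_subset)
    then obtain B where B: "B > 0" "\<And>x. x \<in> K \<Longrightarrow> norm (f x) \<le> B"
      unfolding bounded_pos by (metis imageI)
    have m [measurable]: "f \<in> borel_measurable borel" using f(1) by (rule borel_measurable_continuous_onI)
    show "((\<lambda>p. LINT x|lborel. f x powr p) \<circ> X) \<longlonglongrightarrow> (LINT x|lborel. f x powr 1)"
      unfolding o_def
    \<comment> \<open>The base \<open>1 + B\<close> is at least 1, so its powers grow with the
      exponent and the bound \<open>P\<close> of the exponents serves for the whole
      sequence.\<close>
    proof (rule LINT_tendsto_compact[OF K(2), where B="(1 + B) powr P"])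
      show "\<bar>f x powr X n\<bar> \<le> (1 + B) powr P" if "x \<in> K" for n x
      proof -
        have "f x powr X n \<le> (1 + B) powr X n"
          using B(2)[OF that] f(3)[of x] X(1)[rule_format, of n] by (intro powr_mono2) auto
        also have "\<dots> \<le> (1 + B) powr P" using P B by (intro powr_mono) auto
        finally show ?thesis by simp
      qed
      show "(\<lambda>n. f x powr X n) \<longlonglongrightarrow> f x powr 1" for x
      proof (cases "f x = 0")
        case False
        then show ?thesis by (intro tendsto_powr X(2) tendsto_const)
      qed simp
    qed (use f in auto)
  qed
  show "((\<lambda>p. energy p \<phi>) \<longlongrightarrow> energy 1 \<phi>) (at_right 1)"
    unfolding energy_def using c g0 by (intro main continuous_intros) auto
  show "((\<lambda>p. mass p \<phi>) \<longlongrightarrow> mass 1 \<phi>) (at_right 1)"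
    unfolding mass_def using c K(4) by (intro main continuous_intros) auto
qed

text \<open>Above, the quotient of a fixed almost optimal test function is continuous as p tends to
  1. Below, (h/p)^p tends to h.\<close>

lemma first_eigenvalue_tendsto_cheeger:
  assumes "open \<Omega>" "\<Omega> \<noteq> {}"
  shows "((\<lambda>p. first_eigenvalue p \<Omega>) \<longlongrightarrow> cheeger \<Omega>) (at_right 1)"
proof (rule order_tendstoI)
  fix a assume a: "a < cheeger \<Omega>"
  have p1: "eventually (\<lambda>p. p > 1) (at_right (1::real))" by (simp add: eventually_at_filter)
  show "eventually (\<lambda>p. a < first_eigenvalue p \<Omega>) (at_right 1)"
  \<comment> \<open>The limit of (h/p)^p is taken with a non-zero base; for h = 0 the nonnegativity
    of the eigenvalue suffices.\<close>
  proof (cases "cheeger \<Omega> = 0")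
    case True
    show ?thesis using p1
    proof eventually_elim
      case (elim p)
      have "0 \<le> first_eigenvalue p \<Omega>"
        by (rule first_eigenvalue_ge[OF assms]) (use elim energy_nonneg in auto)
      then show ?case using a True by simp
    qed
  next
    case False
    have "((\<lambda>p. (cheeger \<Omega> / p) powr p) \<longlongrightarrow> (cheeger \<Omega> / 1) powr 1) (at_right 1)"
      using False by (intro tendsto_intros) auto
    moreover have "a < (cheeger \<Omega> / 1) powr 1" using a cheeger_nonneg[OF assms] by simp
    ultimately have "eventually (\<lambda>p. a < (cheeger \<Omega> / p) powr p) (at_right 1)" by (rule order_tendstoD)
    with p1 show ?thesis
      by eventually_elim (use cheeger_powr_le_first_eigenvalue[OF assms] in force)
  qed
next
  fix b assume "cheeger \<Omega> < b"
  then obtain \<phi> where phi: "\<phi> \<in> test_functions \<Omega>" "mass 1 \<phi> > 0" "energy 1 \<phi> / mass 1 \<phi> < b"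
    using cheeger_less[OF assms] by blast
  have "((\<lambda>p. energy p \<phi> / mass p \<phi>) \<longlongrightarrow> energy 1 \<phi> / mass 1 \<phi>) (at_right 1)"
    using phi(2) by (intro tendsto_intros energy_mass_tendsto_1[OF phi(1)]) auto
  then have e: "eventually (\<lambda>p. energy p \<phi> / mass p \<phi> < b) (at_right 1)"
    using phi(3) by (rule order_tendstoD)
  have m: "eventually (\<lambda>p. 0 < mass p \<phi>) (at_right 1)"
    using energy_mass_tendsto_1(2)[OF phi(1)] phi(2) by (rule order_tendstoD)
  have "eventually (\<lambda>p. p > 1) (at_right (1::real))" by (simp add: eventually_at_filter)
  then show "eventually (\<lambda>p. first_eigenvalue p \<Omega> < b) (at_right 1)"
    using e m
  proof eventually_elim
    case (elim p)
    then show ?case using first_eigenvalue_le[OF phi(1) assms(1), of p] by simp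
  qed
qed

section \<open>Polarization\<close>

lemma soft_abs_smooth_grad:
  assumes "smooth f" "e > 0"
  shows "smooth (\<lambda>x. sqrt ((f x)\<^sup>2 + e\<^sup>2) - e)"
    and "grad (\<lambda>x. sqrt ((f x)\<^sup>2 + e\<^sup>2) - e) x = (f x / sqrt ((f x)\<^sup>2 + e\<^sup>2)) *\<^sub>R grad f x"
proof -
  have pos: "t\<^sup>2 + e\<^sup>2 > 0" for t :: real using assms by (simp add: add_nonneg_pos)
  show "smooth (\<lambda>x. sqrt ((f x)\<^sup>2 + e\<^sup>2) - e)"
    using assms pos by (intro smooth_intros smooth_sqrt)
  have "((\<lambda>t. sqrt (t\<^sup>2 + e\<^sup>2) - e) has_real_derivative (t / sqrt (t\<^sup>2 + e\<^sup>2))) (at t)" for t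
    using pos[of t] by (auto intro!: derivative_eq_intros simp: divide_simps)
  then show "grad (\<lambda>x. sqrt ((f x)\<^sup>2 + e\<^sup>2) - e) x = (f x / sqrt ((f x)\<^sup>2 + e\<^sup>2)) *\<^sub>R grad f x"
    by (rule grad_compose_1D[OF smooth_differentiable[OF assms(1)]])
qed

lemma soft_abs_bounds:
  fixes t e :: real
  assumes "e > 0"
  shows "0 \<le> sqrt (t\<^sup>2 + e\<^sup>2) - e" "sqrt (t\<^sup>2 + e\<^sup>2) - e \<le> \<bar>t\<bar>" "\<bar>t\<bar> - e \<le> sqrt (t\<^sup>2 + e\<^sup>2) - e"
    "\<bar>t / sqrt (t\<^sup>2 + e\<^sup>2)\<bar> \<le> 1"
proof -
  show "0 \<le> sqrt (t\<^sup>2 + e\<^sup>2) - e" using assms by (simp add: real_le_rsqrt)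
  have "sqrt (t\<^sup>2 + e\<^sup>2) \<le> sqrt (t\<^sup>2) + sqrt (e\<^sup>2)" by (rule sqrt_add_le_add_sqrt) auto
  then show "sqrt (t\<^sup>2 + e\<^sup>2) - e \<le> \<bar>t\<bar>" using assms by simp
  have a: "\<bar>t\<bar> \<le> sqrt (t\<^sup>2 + e\<^sup>2)" by (simp add: real_le_rsqrt)
  then show "\<bar>t\<bar> - e \<le> sqrt (t\<^sup>2 + e\<^sup>2) - e" by simp
  have "sqrt (t\<^sup>2 + e\<^sup>2) > 0" using assms by (simp add: add_nonneg_pos)
  with a show "\<bar>t / sqrt (t\<^sup>2 + e\<^sup>2)\<bar> \<le> 1" by (simp add: abs_divide)
qed

lemma energy_1: "energy 1 \<phi> = (LINT x|lborel. norm (grad \<phi> x))"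
  and mass_1: "mass 1 \<phi> = (LINT x|lborel. \<bar>\<phi> x\<bar>)"
  by (simp_all add: energy_def mass_def)

text \<open>The function sqrt(\<phi>^2 + e^2) - e is nonnegative, vanishes where \<phi> does and has
  no larger gradient, and its mass tends to that of \<phi>. Polarization and the calibration of the
  concentric annulus can thus be restricted to functions with a sign.\<close>

lemma cheeger_ge_nonneg:
  assumes \<Omega>: "open \<Omega>" "\<Omega> \<noteq> {}"
    and test: "\<And>\<phi>. \<phi> \<in> test_functions \<Omega> \<Longrightarrow> (\<And>x. \<phi> x \<ge> 0) \<Longrightarrow> c * mass 1 \<phi> \<le> energy 1 \<phi>"
  shows "c \<le> cheeger \<Omega>"
proof (rule cheeger_ge[OF \<Omega>])
  fix \<phi> assume phi: "\<phi> \<in> test_functions \<Omega>"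
  then obtain K where K: "smooth \<phi>" "compact K" "K \<subseteq> \<Omega>" "\<And>x. x \<notin> K \<Longrightarrow> \<phi> x = 0"
    by (auto elim: test_functionsE)
  define e where "e n = 1 / real (Suc n)" for n
  have e: "0 < e n" for n by (auto simp: e_def)
  have e0: "e \<longlonglongrightarrow> 0" unfolding e_def by (rule LIMSEQ_Suc[OF lim_1_over_n])
  define \<psi> where "\<psi> n x = sqrt ((\<phi> x)\<^sup>2 + (e n)\<^sup>2) - e n" for n x
  have "bounded (\<phi> ` K)"
    using smooth_continuous_on[OF K(1)] K by (auto intro!: compact_imp_bounded compact_continuous_image)
  then obtain B where B: "B > 0" "\<And>x. x \<in> K \<Longrightarrow> norm (\<phi> x) \<le> B"
    unfolding bounded_pos by (metis imageI)
  have psi: "\<psi> n \<in> test_functions \<Omega>" for n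
    unfolding \<psi>_def using soft_abs_smooth_grad(1)[OF K(1) e] e[of n] K(4)
    by (intro test_functionsI[OF _ K(2,3)]) auto
  have lim: "(\<lambda>n. LINT x|lborel. \<bar>\<psi> n x\<bar>) \<longlonglongrightarrow> (LINT x|lborel. \<bar>\<phi> x\<bar>)"
  proof (rule LINT_tendsto_compact[OF K(2), where B=B])
    show "(\<lambda>x. \<bar>\<psi> n x\<bar>) \<in> borel_measurable borel" for n
      using smooth_continuous_on[OF test_functions_smooth[OF psi]]
      by (intro borel_measurable_continuous_onI continuous_intros)
    show "\<bar>\<bar>\<psi> n x\<bar>\<bar> \<le> B" if "x \<in> K" for n x
      using soft_abs_bounds[OF e, of "\<phi> x" n] B(2)[OF that] by (simp add: \<psi>_def)
    have "(\<lambda>n. \<bar>\<psi> n x\<bar>) \<longlonglongrightarrow> \<bar>sqrt ((\<phi> x)\<^sup>2 + 0\<^sup>2) - 0\<bar>" for x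
      unfolding \<psi>_def by (intro tendsto_intros e0)
    then show "(\<lambda>n. \<bar>\<psi> n x\<bar>) \<longlonglongrightarrow> \<bar>\<phi> x\<bar>" for x by simp
  qed (use K(4) e in \<open>simp add: \<psi>_def less_imp_le\<close>)
  have "c * mass 1 (\<psi> n) \<le> energy 1 \<phi>" for n
  proof -
    have "c * mass 1 (\<psi> n) \<le> energy 1 (\<psi> n)"
      using psi soft_abs_bounds(1)[OF e] by (intro test) (simp_all add: \<psi>_def)
    also have "\<dots> \<le> energy 1 \<phi>"
      unfolding energy_1
    proof (rule integral_mono)
      show "norm (grad (\<psi> n) x) \<le> norm (grad \<phi> x)" for x
        unfolding \<psi>_def soft_abs_smooth_grad(2)[OF K(1) e]
        using mult_right_mono[OF soft_abs_bounds(4)[OF e, of "\<phi> x" n] norm_ge_zero] by simp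
    qed (use test_function_integrals(1)[OF _ \<Omega>(1), of _ 1] psi phi in auto)
    finally show ?thesis .
  qed
  then have "c * (LINT x|lborel. \<bar>\<phi> x\<bar>) \<le> energy 1 \<phi>"
    using tendsto_mult_left[OF lim, of c] by (intro LIMSEQ_le_const2) (auto simp: mass_1)
  then show "c * mass 1 \<phi> \<le> energy 1 \<phi>" by (simp add: mass_1)
qed

text \<open>A nonnegative function vanishing off \<open>\<Omega>\<close> that is a uniform limit of smooth functions of controlled
  energy is admissible for the Cheeger constant: subtracting twice the uniform error and taking a
  smooth positive part gives genuine test functions.\<close>

lemma cheeger_le_uniform_limit:
  fixes w :: "real^'n::finite \<Rightarrow> real"
  assumes \<Omega>: "open \<Omega>" "bounded \<Omega>"
    and w0: "\<And>x. w x \<ge> 0" "\<And>x. x \<notin> \<Omega> \<Longrightarrow> w x = 0"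
    and f: "\<And>n. smooth (f n)" "\<And>n x. \<bar>f n x - w x\<bar> \<le> k n" "\<And>n. k n > 0" "k \<longlonglongrightarrow> 0"
    and E: "\<And>n. integrable lborel (\<lambda>x. norm (grad (f n) x))"
      "\<And>n. (LINT x|lborel. norm (grad (f n) x)) \<le> M n" "M \<longlonglongrightarrow> M0"
  shows "cheeger \<Omega> * (LINT x|lborel. w x) \<le> M0"
proof -
  have "uniform_limit UNIV f w sequentially"
  proof (rule uniform_limitI)
    fix e :: real assume "e > 0"
    then have "eventually (\<lambda>n. k n < e) sequentially" using f(4) by (intro order_tendstoD)
    then show "eventually (\<lambda>n. \<forall>x\<in>UNIV. dist (f n x) (w x) < e) sequentially"
      by eventually_elim (use f(2) in \<open>auto simp: dist_real_def intro: le_less_trans\<close>)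
  qed
  then have "continuous_on UNIV w"
    by (rule uniform_limit_theorem[rotated]) (auto intro!: always_eventually smooth_continuous_on f)
  note w = this w0
  \<comment> \<open>Lowering by \<open>2 * k n\<close> confines the support to the set {k n \<le>
    w}, which is closed and contained in \<Omega>. Lowering by \<open>k n\<close> would give only {w
    > 0}, whose closure may meet the boundary.\<close>
  define \<phi> where "\<phi> n x = soft_pos (k n) (f n x - 2 * k n)" for n x
  define K where "K n = {x. k n \<le> w x}" for n
  have KO: "K n \<subseteq> \<Omega>" for n using w(3) f(3)[of n] by (force simp: K_def)
  have Kc: "compact (K n)" for n
    using bounded_subset[OF \<Omega>(2) KO] w(1) unfolding compact_eq_bounded_closed K_def
    by (auto intro!: closed_Collect_le)
  have out: "\<phi> n x = 0" if "x \<notin> K n" for n x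
    unfolding \<phi>_def using that f(2)[of n x] f(3)[of n] by (intro soft_pos_nonpos) (auto simp: K_def)
  have phi: "\<phi> n \<in> test_functions \<Omega>" for n
    by (rule test_functionsI[OF _ Kc KO out]) (auto simp: \<phi>_def[abs_def] intro!: smooth_intros f)
  \<comment> \<open>Of the loss \<open>4 * k n\<close>, two parts come from the shift, one from the
    uniform error and one from \<open>soft_pos\<close>.\<close>
  have bnd: "0 \<le> \<phi> n x" "\<phi> n x \<le> w x" "w x - 4 * k n \<le> \<phi> n x" for n x
    using soft_pos_nonneg[OF f(3)[of n], of "f n x - 2 * k n"] soft_pos_le[OF f(3)[of n], of "f n x - 2 * k n"]
      soft_pos_ge[OF f(3)[of n], of "f n x - 2 * k n"] f(2)[of n x] f(3)[of n] w(2)[of x]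
    by (auto simp: \<phi>_def)
  have cl: "compact (closure \<Omega>)" using \<Omega>(2) by (simp add: compact_closure)
  have "bounded (w ` closure \<Omega>)"
    using w(1) cl by (auto intro!: compact_imp_bounded compact_continuous_image intro: continuous_on_subset)
  then obtain B where B: "\<And>x. x \<in> closure \<Omega> \<Longrightarrow> norm (w x) \<le> B"
    unfolding bounded_iff by (metis imageI)
  have lim: "(\<lambda>n. LINT x|lborel. \<bar>\<phi> n x\<bar>) \<longlonglongrightarrow> (LINT x|lborel. w x)"
  proof (rule LINT_tendsto_compact[OF cl, where B=B])
    show "(\<lambda>x. \<bar>\<phi> n x\<bar>) \<in> borel_measurable borel" for n
      using smooth_continuous_on[OF test_functions_smooth[OF phi]]
      by (intro borel_measurable_continuous_onI continuous_intros)
    show "\<bar>\<phi> n x\<bar> = 0" if "x \<notin> closure \<Omega>" for n x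
      using that out[where x=x and n=n] KO[of n] closure_subset[of \<Omega>] by auto
    show "\<bar>\<bar>\<phi> n x\<bar>\<bar> \<le> B" if "x \<in> closure \<Omega>" for n x
      using bnd[where n=n and x=x] B[OF that] by simp
    have "(\<lambda>n. w x - 4 * k n) \<longlonglongrightarrow> w x - 4 * 0" for x by (intro tendsto_intros f)
    then have "(\<lambda>n. \<phi> n x) \<longlonglongrightarrow> w x" for x
      by (intro tendsto_sandwich[of "\<lambda>n. w x - 4 * k n" "\<lambda>n. \<phi> n x" _ "\<lambda>n. w x"]) (use bnd in auto)
    then show "(\<lambda>n. \<bar>\<phi> n x\<bar>) \<longlonglongrightarrow> w x" for x
      using bnd(1) by simp
  qed
  have "cheeger \<Omega> * (LINT x|lborel. \<bar>\<phi> n x\<bar>) \<le> M n" for n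
  proof -
    have "cheeger \<Omega> * (LINT x|lborel. \<bar>\<phi> n x\<bar>) \<le> (LINT x|lborel. norm (grad (\<phi> n) x))"
      using cheeger_le[OF phi[of n]] by (simp add: mass_1 energy_1)
    also have "\<dots> \<le> (LINT x|lborel. norm (grad (f n) x))"
    proof (rule integral_mono[OF _ E(1)])
      show "integrable lborel (\<lambda>x. norm (grad (\<phi> n) x))"
        using test_function_integrals(1)[OF phi[of n] \<Omega>(1), of 1] by simp
      fix x
      have "grad (\<phi> n) x = soft_pos' (k n) (f n x - 2 * k n) *\<^sub>R grad (f n) x"
      proof -
        have "grad (\<phi> n) x = soft_pos' (k n) (f n x - 2 * k n) *\<^sub>R grad (\<lambda>x. f n x - 2 * k n) x"
          unfolding \<phi>_def by (intro grad_compose_1D soft_pos_has_derivative f(3) smooth_differentiable smooth_intros f(1))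
        also have "grad (\<lambda>x. f n x - 2 * k n) x = grad (f n) x"
          using grad_diff[of "f n" x "\<lambda>x. 2 * k n"] smooth_differentiable[OF f(1)] by simp
        finally show ?thesis .
      qed
      then show "norm (grad (\<phi> n) x) \<le> norm (grad (f n) x)"
        using soft_pos'_bounds[OF f(3)[of n], of "f n x - 2 * k n"] by (simp add: mult_left_le_one_le)
    qed
    also have "\<dots> \<le> M n" by (rule E(2))
    finally show ?thesis .
  qed
  then show ?thesis
    using tendsto_mult_left[OF lim, of "cheeger \<Omega>"] E(3) by (intro LIMSEQ_le[of _ _ M M0]) auto
qed

section \<open>Reflections in a hyperplane and two-point rearrangement\<close>

definition reflection :: "'n::finite \<Rightarrow> real \<Rightarrow> real^'n \<Rightarrow> real^'n"
  where "reflection j c x = (\<chi> i. if i = j then 2 * c - x $ j else x $ i)"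

lemma reflection_reflection [simp]: "reflection j c (reflection j c x) = x"
  by (simp add: reflection_def vec_eq_iff)

lemma reflection_eq: "reflection j c x = x - (2 * (x $ j - c)) *\<^sub>R axis j 1"
  by (auto simp: reflection_def vec_eq_iff axis_def)

lemma continuous_reflection: "continuous_on S (reflection j c)"
  unfolding reflection_eq by (intro continuous_intros)

text \<open>In the standard basis this is an affine map with diagonal entries 1 and -1, so its
  determinant has modulus 1.\<close>

lemma distr_lborel_reflection: "distr lborel borel (reflection j c) = (lborel :: (real^'n::finite) measure)"
proof -
  define d where "d b = (if b = axis j 1 then - 1 else 1 :: real)" for b :: "real^'n"
  have "reflection j c = (\<lambda>x. (2 * c) *\<^sub>R axis j 1 + (\<Sum>b\<in>Basis. (d b * (x \<bullet> b)) *\<^sub>R b))"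
  proof
    fix x :: "real^'n"
    have ax: "(axis j 1 :: real^'n) \<in> Basis" by (auto simp: Basis_vec_def)
    have "(\<Sum>b\<in>Basis. (d b * (x \<bullet> b)) *\<^sub>R b) = (\<Sum>b\<in>Basis. (x \<bullet> b) *\<^sub>R b - (if b = axis j 1 then 2 * (x \<bullet> b) else 0) *\<^sub>R b)"
      by (intro sum.cong) (auto simp: d_def scaleR_left_diff_distrib[symmetric])
    also have "\<dots> = x - (\<Sum>b\<in>Basis. (if b = axis j 1 then 2 * (x \<bullet> b) else 0) *\<^sub>R b)"
      by (simp add: sum_subtractf euclidean_representation)
    also have "(\<Sum>b\<in>Basis. (if b = axis j 1 then 2 * (x \<bullet> b) else 0) *\<^sub>R b) = (2 * (x \<bullet> axis j 1)) *\<^sub>R axis j 1"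
    proof -
      have "(\<Sum>b\<in>Basis. (if b = axis j 1 then 2 * (x \<bullet> b) else 0) *\<^sub>R b)
          = (\<Sum>b\<in>(Basis :: (real^'n) set). if b = axis j 1 then (2 * (x \<bullet> axis j 1)) *\<^sub>R axis j 1 else 0)"
        by (intro sum.cong) auto
      then show ?thesis using ax by (simp only: sum.delta[OF finite_Basis] if_True)
    qed
    finally show "reflection j c x = (2 * c) *\<^sub>R axis j 1 + (\<Sum>b\<in>Basis. (d b * (x \<bullet> b)) *\<^sub>R b)"
      by (simp add: reflection_eq inner_axis algebra_simps)
  qed
  moreover have "(\<Prod>b\<in>Basis. \<bar>d b\<bar>) = 1" by (intro prod.neutral) (auto simp: d_def)
  ultimately show ?thesis
    using lborel_affine_euclidean[of d "(2 * c) *\<^sub>R axis j 1"] by (simp add: d_def density_1)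
qed

lemma integrable_reflection:
  fixes f :: "real^'n::finite \<Rightarrow> real"
  assumes "integrable lborel f"
  shows "integrable lborel (\<lambda>x. f (reflection j c x))"
proof -
  have "integrable (distr lborel borel (reflection j c)) f"
    using assms by (simp add: distr_lborel_reflection)
  then show ?thesis
    using assms borel_measurable_continuous_onI[OF continuous_reflection]
    by (subst (asm) integrable_distr_eq) auto
qed

lemma integral_reflection:
  fixes f :: "real^'n::finite \<Rightarrow> real"
  assumes "f \<in> borel_measurable borel"
  shows "(LINT x|lborel. f (reflection j c x)) = (LINT x|lborel. f x)"
proof -
  have "(LINT x|lborel. f x) = (LINT x|distr lborel borel (reflection j c). f x)"
    by (simp add: distr_lborel_reflection)
  also have "\<dots> = (LINT x|lborel. f (reflection j c x))"
    using assms borel_measurable_continuous_onI[OF continuous_reflection]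
    by (subst integral_distr) auto
  finally show ?thesis ..
qed

text \<open>Each point is paired with its mirror image. Polarization only redistributes values
  within such pairs, so integrals are compared through pair sums and no half space has to be split
  off.\<close>

lemma integral_eq_of_reflection_sum:
  fixes f g :: "real^'n::finite \<Rightarrow> real"
  assumes "integrable lborel f" "integrable lborel g"
    and "\<And>x. f x + f (reflection j c x) = g x + g (reflection j c x)"
  shows "(LINT x|lborel. f x) = (LINT x|lborel. g x)"
proof -
  have "2 * (LINT x|lborel. h x) = (LINT x|lborel. h x + h (reflection j c x))" if "integrable lborel h" for h :: "real^'n \<Rightarrow> real"
    using that integrable_reflection[OF that] integral_reflection[of h j c] by simp
  from this[OF assms(1)] this[OF assms(2)] show ?thesis using assms(3) by simp
qed

lemma grad_reflection:
  assumes "smooth f"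
  shows "smooth (\<lambda>x. f (reflection j c x))"
    "grad (\<lambda>x. f (reflection j c x)) x = reflection j 0 (grad f (reflection j c x))"
proof -
  have "smooth (\<lambda>x. reflection j c x $ l)" for l
    by (cases "l = j") (auto simp: reflection_def intro!: smooth_intros)
  then show "smooth (\<lambda>x. f (reflection j c x))" using assms by (rule smooth_compose_map)
  have "(reflection j c has_derivative (\<lambda>h. reflection j 0 h)) (at x)"
  proof -
    have "((\<lambda>x. x $ j) has_derivative (\<lambda>h. h $ j)) (at x)"
      by (rule bounded_linear_imp_has_derivative[OF bounded_linear_vec_nth])
    then show ?thesis unfolding reflection_eq by (auto intro!: derivative_eq_intros)
  qed
  from has_derivative_compose[OF this smooth_has_derivative[OF assms]]
  have "((\<lambda>x. f (reflection j c x)) has_derivative (\<lambda>h. grad f (reflection j c x) \<bullet> reflection j 0 h)) (at x)" .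
  moreover have "g \<bullet> reflection j 0 h = reflection j 0 g \<bullet> h" for g h :: "real^'a"
    by (simp add: reflection_eq inner_diff_left inner_diff_right inner_axis inner_axis')
  ultimately show "grad (\<lambda>x. f (reflection j c x)) x = reflection j 0 (grad f (reflection j c x))"
    by (intro grad_eqI) simp
qed

lemma norm_reflection_0 [simp]: "norm (reflection j 0 g) = norm g"
proof -
  have "(norm (reflection j 0 g))\<^sup>2 = (norm g)\<^sup>2"
    unfolding power2_norm_eq_inner inner_vec_def by (intro sum.cong) (auto simp: reflection_def)
  then show ?thesis by simp
qed

lemma test_function_Lipschitz:
  assumes "\<phi> \<in> test_functions \<Omega>"
  obtains L where "L > 0" "\<And>x. norm (grad \<phi> x) \<le> L" "\<And>x y. \<bar>\<phi> x - \<phi> y\<bar> \<le> L * norm (x - y)"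
proof -
  obtain K where K: "smooth \<phi>" "compact K" "K \<subseteq> \<Omega>" "\<And>x. x \<notin> K \<Longrightarrow> \<phi> x = 0"
    using assms by (auto elim: test_functionsE)
  have "bounded (grad \<phi> ` K)"
    using smooth_continuous_grad[OF K(1)] K by (auto intro!: compact_imp_bounded compact_continuous_image)
  then obtain L where L: "L > 0" "\<And>x. x \<in> K \<Longrightarrow> norm (grad \<phi> x) \<le> L"
    unfolding bounded_pos by (metis imageI)
  have g: "norm (grad \<phi> x) \<le> L" for x
    using L grad_zero_outside[OF compact_imp_closed[OF K(2)] K(4), where x=x] by (cases "x \<in> K") auto
  have "norm (\<phi> x - \<phi> y) \<le> L * norm (x - y)" for x y
  proof (rule differentiable_bound[where S=UNIV and f'="\<lambda>x h. grad \<phi> x \<bullet> h"])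
    show "(\<phi> has_derivative (\<lambda>h. grad \<phi> x \<bullet> h)) (at x within UNIV)" for x
      using smooth_has_derivative[OF K(1)] by simp
    show "onorm (\<lambda>h. grad \<phi> x \<bullet> h) \<le> L" for x
    proof (rule onorm_bound)
      fix h
      have "\<bar>grad \<phi> x \<bullet> h\<bar> \<le> norm (grad \<phi> x) * norm h" by (rule Cauchy_Schwarz_ineq2)
      also have "\<dots> \<le> L * norm h" using g by (intro mult_right_mono) auto
      finally show "norm (grad \<phi> x \<bullet> h) \<le> L * norm h" by simp
    qed (use L in simp)
  qed auto
  with L(1) g that show ?thesis by auto
qed

text \<open>With S = sqrt(t^2 + e^2) the left side is |t| (S - |t|) / S, at most S - |t| \<le> e.
  The factor |t| saves the estimate near 0, where \<open>sgn\<close> jumps.\<close>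

lemma soft_sgn_bounds:
  fixes t e :: real
  assumes "e > 0"
  shows "\<bar>t\<bar> * \<bar>sgn t - t / sqrt (t\<^sup>2 + e\<^sup>2)\<bar> \<le> e"
proof -
  have s: "sqrt (t\<^sup>2 + e\<^sup>2) > 0" using assms by (simp add: add_nonneg_pos)
  have s1: "sqrt (t\<^sup>2 + e\<^sup>2) \<le> \<bar>t\<bar> + e" using soft_abs_bounds(2)[OF assms, of t] by simp
  have s2: "\<bar>t\<bar> \<le> sqrt (t\<^sup>2 + e\<^sup>2)" by (simp add: real_le_rsqrt)
  have "\<bar>t\<bar> * \<bar>sgn t - t / sqrt (t\<^sup>2 + e\<^sup>2)\<bar> = \<bar>t\<bar> * ((sqrt (t\<^sup>2 + e\<^sup>2) - \<bar>t\<bar>) / sqrt (t\<^sup>2 + e\<^sup>2))"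
  proof -
    have "\<bar>sgn t - t / sqrt (t\<^sup>2 + e\<^sup>2)\<bar> = (sqrt (t\<^sup>2 + e\<^sup>2) - \<bar>t\<bar>) / sqrt (t\<^sup>2 + e\<^sup>2)" if "t \<noteq> 0"
    proof -
      have "sgn t - t / sqrt (t\<^sup>2 + e\<^sup>2) = sgn t * ((sqrt (t\<^sup>2 + e\<^sup>2) - \<bar>t\<bar>) / sqrt (t\<^sup>2 + e\<^sup>2))"
        using s that by (cases "t > 0") (simp_all add: field_simps)
      then show ?thesis using s s2 that by (simp add: abs_mult abs_sgn_eq)
    qed
    then show ?thesis by (cases "t = 0") auto
  qed
  also have "\<dots> = (\<bar>t\<bar> / sqrt (t\<^sup>2 + e\<^sup>2)) * (sqrt (t\<^sup>2 + e\<^sup>2) - \<bar>t\<bar>)" by simp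
  also have "\<dots> \<le> 1 * e" using s s1 s2 by (intro mult_mono) auto
  finally show ?thesis by simp
qed

lemma soft_sgn_derivative:
  fixes t e :: real
  assumes "e > 0"
  shows "((\<lambda>t. t / sqrt (t\<^sup>2 + e\<^sup>2)) has_real_derivative e\<^sup>2 / sqrt (t\<^sup>2 + e\<^sup>2) ^ 3) (at t)"
proof -
  define S where "S = sqrt (t\<^sup>2 + e\<^sup>2)"
  have p: "t\<^sup>2 + e\<^sup>2 > 0" using assms by (simp add: add_nonneg_pos)
  then have S: "S > 0" by (simp add: S_def)
  have S2: "S\<^sup>2 = t\<^sup>2 + e\<^sup>2" using p by (simp add: S_def)
  have d: "((\<lambda>t. sqrt (t\<^sup>2 + e\<^sup>2)) has_real_derivative t / S) (at t)"
    using p unfolding S_def by (auto intro!: derivative_eq_intros simp: divide_simps)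
  have "((\<lambda>t. t / sqrt (t\<^sup>2 + e\<^sup>2)) has_real_derivative (1 * S - t * (t / S)) / (S * S)) (at t)"
    unfolding S_def by (rule DERIV_divide[OF DERIV_ident]) (use d S in \<open>auto simp: S_def\<close>)
  moreover have "(1 * S - t * (t / S)) / (S * S) = e\<^sup>2 / S ^ 3"
    using S S2 by (simp add: divide_simps power2_eq_square power3_eq_cube)
  ultimately show ?thesis by (simp add: S_def)
qed

text \<open>The polarization \<open>P\<close> takes the larger of the values of u at x and at its
  mirror image on the side x_j < c, and the smaller one on the other side. Hypothesis
  \<open>le\<close> makes it vanish where the larger value has to, \<open>ge\<close> where the
  smaller one has to. Mass is preserved because values are only exchanged within mirror pairs; the
  work lies in smooth approximations whose energy exceeds that of u by a vanishing error.\<close>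

lemma cheeger_polarization:
  fixes \<Omega> \<Omega>' :: "(real^'n::finite) set"
  assumes \<Omega>: "open \<Omega>" "\<Omega> \<noteq> {}" and \<Omega>': "open \<Omega>'" "bounded \<Omega>'"
    and le: "\<And>x. x \<notin> \<Omega>' \<Longrightarrow> x $ j \<le> c \<Longrightarrow> x \<notin> \<Omega> \<and> reflection j c x \<notin> \<Omega>"
    and ge: "\<And>x. x \<notin> \<Omega>' \<Longrightarrow> x $ j \<ge> c \<Longrightarrow> x \<notin> \<Omega> \<or> reflection j c x \<notin> \<Omega>"
  shows "cheeger \<Omega>' \<le> cheeger \<Omega>"
proof (rule cheeger_ge_nonneg[OF \<Omega>])
  fix u assume u: "u \<in> test_functions \<Omega>" and u0: "\<And>x. u x \<ge> 0"
  obtain K where K: "smooth u" "compact K" "K \<subseteq> \<Omega>" "\<And>x. x \<notin> K \<Longrightarrow> u x = 0"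
    using u by (auto elim: test_functionsE)
  define us where "us x = u (reflection j c x)" for x
  define w where "w x = u x - us x" for x
  define t where "t x = x $ j - c" for x :: "real^'n"
  define P where "P x = (u x + us x) / 2 - sgn (t x) * \<bar>w x\<bar> / 2" for x
  obtain L where L: "L > 0" "\<And>x y. \<bar>u x - u y\<bar> \<le> L * norm (x - y)"
    using test_function_Lipschitz[OF u] by metis
  have us: "smooth us" "grad us x = reflection j 0 (grad u (reflection j c x))" for x
    unfolding us_def[abs_def] by (rule grad_reflection[OF K(1)])+
  have ws: "smooth w" unfolding w_def[abs_def] by (intro smooth_intros K us)
  have gw: "grad w x = grad u x - grad us x" for x
    unfolding w_def[abs_def] by (intro grad_diff smooth_differentiable K us)
  \<comment> \<open>u and its mirror image agree on the hyperplane, so their difference vanishes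
    linearly there; this compensates the jump of \<open>sgn (t x)\<close> in
    \<open>P\<close>.\<close>
  have wt: "\<bar>w x\<bar> \<le> 2 * L * \<bar>t x\<bar>" for x
  proof -
    have "x - reflection j c x = (2 * t x) *\<^sub>R axis j 1" by (simp add: reflection_eq t_def)
    then have "norm (x - reflection j c x) = 2 * \<bar>t x\<bar>" by (simp add: norm_axis_1)
    then show ?thesis using L(2)[of x "reflection j c x"] by (simp add: w_def us_def)
  qed
  have P_cases: "P x = (if t x < 0 then max (u x) (us x) else if t x > 0 then min (u x) (us x) else u x)" for x
    using wt[of x] by (auto simp: P_def w_def max_def min_def field_simps)
  have P0: "P x \<ge> 0" for x using u0 by (simp add: P_cases us_def le_max_iff_disj)
  have Pout: "P x = 0" if "x \<notin> \<Omega>'" for x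
  proof -
    have z: "u y = 0" if "y \<notin> \<Omega>" for y using that K(3,4) by blast
    show ?thesis
      using le[OF that] ge[OF that] z[of x] z[of "reflection j c x"] u0[of x] u0[of "reflection j c x"]
      by (auto simp: P_cases us_def t_def min_def max_def not_less split: if_splits)
  qed
  define e where "e n = 1 / real (Suc n)" for n
  have e: "0 < e n" for n by (auto simp: e_def)
  have e0: "e \<longlonglongrightarrow> 0" unfolding e_def by (rule LIMSEQ_Suc[OF lim_1_over_n])
  \<comment> \<open>\<open>\<theta> n\<close> smooths the sign of \<open>t\<close>,
    \<open>A n\<close> the modulus of \<open>w\<close>; \<open>a n\<close>, the slope of the latter,
    smooths the sign of \<open>w\<close>.\<close>
  define \<theta> where "\<theta> n x = t x / sqrt ((t x)\<^sup>2 + (e n)\<^sup>2)" for n x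
  define A where "A n x = sqrt ((w x)\<^sup>2 + (e n)\<^sup>2) - e n" for n x
  define a where "a n x = w x / sqrt ((w x)\<^sup>2 + (e n)\<^sup>2)" for n x
  define f where "f n x = (1/2) * (u x + us x) - (1/2) * (\<theta> n x * A n x)" for n x
  have pos: "s\<^sup>2 + (e n)\<^sup>2 > 0" for n and s :: real using e[of n] by (simp add: add_nonneg_pos)
  have smt: "smooth t" unfolding t_def[abs_def] by (intro smooth_intros)
  have sth: "smooth (\<theta> n)" for n
    unfolding \<theta>_def[abs_def] using pos smt by (intro smooth_divide smooth_sqrt smooth_intros) auto
  have sA: "smooth (A n)" for n unfolding A_def[abs_def] by (rule soft_abs_smooth_grad(1)[OF ws e])
  have sf: "smooth (f n)" for n unfolding f_def[abs_def] by (intro smooth_intros sth sA K us)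
  have gt: "grad t x = axis j 1" for x
    unfolding t_def[abs_def]
    by (subst grad_diff[OF smooth_differentiable[OF smooth_component] smooth_differentiable[OF smooth_const]])
      (simp add: grad_component)
  have gth: "grad (\<theta> n) x = ((e n)\<^sup>2 / sqrt ((t x)\<^sup>2 + (e n)\<^sup>2) ^ 3) *\<^sub>R axis j 1" for n x
    unfolding \<theta>_def[abs_def]
    using grad_compose_1D[OF smooth_differentiable[OF smt] soft_sgn_derivative[OF e[of n]], where x=x] by (simp add: gt)
  have gA: "grad (A n) x = a n x *\<^sub>R grad w x" for n x
    unfolding A_def[abs_def] a_def by (rule soft_abs_smooth_grad(2)[OF ws e])
  \<comment> \<open>Apart from the term with the derivative of \<open>\<theta> n\<close>, this is a
    combination of the gradients of u and of its mirror image with weights that sum to 1 and are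
    nonnegative since |\<theta> a| \<le> 1.\<close>
  have gf: "grad (f n) x = ((1 - \<theta> n x * a n x) / 2) *\<^sub>R grad u x + ((1 + \<theta> n x * a n x) / 2) *\<^sub>R grad us x
      - ((1/2) * A n x * ((e n)\<^sup>2 / sqrt ((t x)\<^sup>2 + (e n)\<^sup>2) ^ 3)) *\<^sub>R axis j 1" for n x
  proof -
    have d: "(\<lambda>x. u x + us x) differentiable (at x)" "(\<lambda>x. \<theta> n x * A n x) differentiable (at x)"
      by (intro smooth_differentiable smooth_intros K us sth sA)+
    then have d': "(\<lambda>x. (1/2) * (u x + us x)) differentiable (at x)" "(\<lambda>x. (1/2) * (\<theta> n x * A n x)) differentiable (at x)"
      by (intro smooth_differentiable smooth_intros K us sth sA)+
    have "grad (f n) x = (1/2) *\<^sub>R (grad u x + grad us x) - (1/2) *\<^sub>R (\<theta> n x *\<^sub>R grad (A n) x + A n x *\<^sub>R grad (\<theta> n) x)"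
      unfolding f_def[abs_def] grad_diff[OF d'] grad_scale[OF d(1)] grad_scale[OF d(2)]
      using grad_add[of u x us] grad_mult[of "\<theta> n" x "A n"]
        smooth_differentiable[OF K(1)] smooth_differentiable[OF us(1)] smooth_differentiable[OF sA] smooth_differentiable[OF sth]
      by simp
    moreover have "(1/2) *\<^sub>R (g + gs) - (1/2) *\<^sub>R (th *\<^sub>R (al *\<^sub>R (g - gs)) + B *\<^sub>R (D *\<^sub>R v)) =
        ((1 - th * al) / 2) *\<^sub>R g + ((1 + th * al) / 2) *\<^sub>R gs - ((1/2) * B * D) *\<^sub>R v"
      for g gs v :: "real^'n" and th al B D :: real
      by (simp add: vec_eq_iff field_simps)
    ultimately show ?thesis unfolding gA gth gw by (simp only:)
  qed
  have th1: "\<bar>\<theta> n x * a n x\<bar> \<le> 1" for n x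
    unfolding \<theta>_def a_def abs_mult by (intro mult_le_one soft_abs_bounds(4)[OF e]) auto
  define b where "b n x = (1 - \<theta> n x * a n x) / 2 * norm (grad u x) + (1 + \<theta> n x * a n x) / 2 * norm (grad us x)" for n x
  define K' where "K' = K \<union> reflection j c ` K"
  have K': "compact K'" unfolding K'_def
    using K(2) by (intro compact_Un compact_continuous_image continuous_reflection)
  have uK': "u x = 0" "us x = 0" if "x \<notin> K'" for x
  proof -
    show "u x = 0" using that K(4) by (auto simp: K'_def)
    have "reflection j c x \<notin> K" using that reflection_reflection[of j c x] unfolding K'_def by (metis UnI2 imageI)
    then show "us x = 0" using K(4) by (simp add: us_def)
  qed
  have fK': "f n x = 0" if "x \<notin> K'" for n x
    using uK'[OF that] e[of n] by (simp add: f_def A_def w_def)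
  have gK': "grad (f n) x = 0" "grad u x = 0" "grad us x = 0" if "x \<notin> K'" for n x
    using grad_zero_outside[OF compact_imp_closed[OF K'] _ that] fK' uK' by blast+
  \<comment> \<open>Bound for the term with the derivative of \<open>\<theta> n\<close>. That
    derivative is of size 1/e on the hyperplane, but \<open>A n\<close> is at most 2 L |t|, so the
    product stays below L and tends to 0 pointwise.\<close>
  define Err where "Err n x = indicator K' x * (L * \<bar>t x\<bar> * ((e n)\<^sup>2 / sqrt ((t x)\<^sup>2 + (e n)\<^sup>2) ^ 3))" for n x
  have bound: "norm (grad (f n) x) \<le> b n x + Err n x" for n x
  proof (cases "x \<in> K'")
    case True
    have "norm (grad (f n) x) \<le> norm (((1 - \<theta> n x * a n x) / 2) *\<^sub>R grad u x) + norm (((1 + \<theta> n x * a n x) / 2) *\<^sub>R grad us x)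
      + norm (((1/2) * A n x * ((e n)\<^sup>2 / sqrt ((t x)\<^sup>2 + (e n)\<^sup>2) ^ 3)) *\<^sub>R (axis j 1 :: real^'n))"
      unfolding gf by (meson add_mono norm_triangle_ineq norm_triangle_ineq4 order_refl order_trans)
    also have "norm (((1 - \<theta> n x * a n x) / 2) *\<^sub>R grad u x) + norm (((1 + \<theta> n x * a n x) / 2) *\<^sub>R grad us x) = b n x"
      using th1[of n x] by (simp add: b_def)
    also have "norm (((1/2) * A n x * ((e n)\<^sup>2 / sqrt ((t x)\<^sup>2 + (e n)\<^sup>2) ^ 3)) *\<^sub>R (axis j 1 :: real^'n))
        = (1/2 * \<bar>A n x\<bar>) * ((e n)\<^sup>2 / sqrt ((t x)\<^sup>2 + (e n)\<^sup>2) ^ 3)"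
      using pos[of "t x" n] by (simp add: norm_axis_1 abs_mult)
    also have "\<dots> \<le> (L * \<bar>t x\<bar>) * ((e n)\<^sup>2 / sqrt ((t x)\<^sup>2 + (e n)\<^sup>2) ^ 3)"
      using soft_abs_bounds(1,2)[OF e[of n], of "w x"] wt[of x] by (intro mult_right_mono) (auto simp: A_def)
    finally show ?thesis using True by (simp add: Err_def)
  next
    case False
    then show ?thesis using gK'[OF False] by (simp add: b_def Err_def)
  qed
  have f_test: "f n \<in> test_functions UNIV" for n by (rule test_functionsI[OF sf K' _ fK']) auto
  have gfi: "integrable lborel (\<lambda>x. norm (grad (f n) x))" for n
    using test_function_integrals(1)[OF f_test[of n] open_UNIV, of 1] by simp
  have gui: "integrable lborel (\<lambda>x. norm (grad u x))"
    using test_function_integrals(1)[OF u \<Omega>(1), of 1] by simp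
  have bi: "integrable lborel (b n)" for n
  proof (rule integrable_compact_support[OF _ K'])
    have "smooth (a n)"
      unfolding a_def[abs_def] using pos ws by (intro smooth_divide smooth_sqrt smooth_intros) auto
    then show "continuous_on UNIV (b n)"
      unfolding b_def by (intro continuous_intros smooth_continuous_on smooth_continuous_grad sth K us) auto
  qed (use gK' in \<open>auto simp: b_def\<close>)
  \<comment> \<open>\<open>\<theta> n\<close> and \<open>a n\<close> are odd under the reflection,
    so their product is invariant, while the two gradient norms change places: over a mirror pair
    the weights add up to 1.\<close>
  have bint: "(LINT x|lborel. b n x) = energy 1 u" for n
    unfolding energy_1
  proof (rule integral_eq_of_reflection_sum[OF bi gui, of _ j c])
    fix x
    have tr: "t (reflection j c x) = - t x" by (simp add: t_def reflection_def)
    have wr: "w (reflection j c x) = - w x" by (simp add: w_def us_def)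
    have "\<theta> n (reflection j c x) * a n (reflection j c x) = \<theta> n x * a n x"
      by (simp add: \<theta>_def a_def tr wr)
    moreover have "norm (grad us (reflection j c x)) = norm (grad u x)" "norm (grad us x) = norm (grad u (reflection j c x))"
      by (simp_all add: us)
    ultimately show "b n x + b n (reflection j c x) = norm (grad u x) + norm (grad u (reflection j c x))"
      by (simp add: b_def field_simps)
  qed
  have Err_le: "Err n x \<le> L" "Err n x \<ge> 0" for n x
  proof -
    define S where "S = sqrt ((t x)\<^sup>2 + (e n)\<^sup>2)"
    have S: "S > 0" "\<bar>t x\<bar> \<le> S" "(e n)\<^sup>2 \<le> S\<^sup>2" using pos[of "t x" n] by (simp_all add: S_def real_le_rsqrt)
    have "\<bar>t x\<bar> * (e n)\<^sup>2 \<le> S * S\<^sup>2" using S by (intro mult_mono) auto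
    then have "\<bar>t x\<bar> * ((e n)\<^sup>2 / S ^ 3) \<le> 1" using S by (simp add: divide_simps power3_eq_cube power2_eq_square)
    then have "L * (\<bar>t x\<bar> * ((e n)\<^sup>2 / S ^ 3)) \<le> L * 1" using L(1) by (intro mult_left_mono) auto
    then show "Err n x \<le> L" using L(1) by (auto simp: Err_def S_def indicator_def)
    show "Err n x \<ge> 0" using L(1) S(1) by (auto simp: Err_def S_def indicator_def)
  qed
  have Errm: "Err n \<in> borel_measurable borel" for n
  proof -
    have "continuous_on UNIV (\<lambda>x. L * \<bar>t x\<bar> * ((e n)\<^sup>2 / sqrt ((t x)\<^sup>2 + (e n)\<^sup>2) ^ 3))"
      using pos by (intro continuous_intros smooth_continuous_on smt) (metis less_irrefl real_sqrt_gt_0_iff power_not_zero)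
    then show ?thesis unfolding Err_def
      using borel_compact[OF K'] by (intro borel_measurable_times borel_measurable_indicator borel_measurable_continuous_onI)
  qed
  have Erri: "integrable lborel (Err n)" for n
  proof (rule Bochner_Integration.integrable_bound)
    show "integrable lborel (\<lambda>x. L * indicator K' x)"
      using K' by (intro integrable_mult_right integrable_real_indicator emeasure_compact_finite) (auto intro: borel_compact)
    show "AE x in lborel. norm (Err n x) \<le> norm (L * indicat_real K' x)"
    proof (rule AE_I2)
      fix x
      have "Err n x = 0" if "x \<notin> K'" using that by (simp add: Err_def)
      then show "norm (Err n x) \<le> norm (L * indicat_real K' x)"
        using Err_le[where n=n and x=x] L(1) by (cases "x \<in> K'") auto
    qed
  qed (use Errm in simp)
  have Errlim: "(\<lambda>n. LINT x|lborel. Err n x) \<longlonglongrightarrow> (LINT x|(lborel::(real^'n) measure). 0)"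
  proof (rule LINT_tendsto_compact[OF K' Errm, where B=L])
    show "\<bar>Err n x\<bar> \<le> L" for n x using Err_le[of n x] by simp
    show "(\<lambda>n. Err n x) \<longlonglongrightarrow> 0" for x
    proof (cases "t x = 0")
      case False
      have "(\<lambda>n. Err n x) \<longlonglongrightarrow> indicator K' x * (L * \<bar>t x\<bar> * (0\<^sup>2 / sqrt ((t x)\<^sup>2 + 0\<^sup>2) ^ 3))"
        unfolding Err_def using False by (intro tendsto_intros e0) auto
      then show ?thesis by simp
    qed (simp add: Err_def)
  qed (auto simp: Err_def)
  \<comment> \<open>The error in the sign is weighted by |w| \<le> 2 L |t|, the error in the modulus
    by |\<theta>| \<le> 1.\<close>
  have close: "\<bar>f n x - P x\<bar> \<le> (1 + L) * e n" for n x
  proof -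
    have "f n x - P x = (sgn (t x) * \<bar>w x\<bar> - \<theta> n x * A n x) / 2" by (simp add: f_def P_def field_simps)
    also have "\<dots> = ((sgn (t x) - \<theta> n x) * \<bar>w x\<bar> + \<theta> n x * (\<bar>w x\<bar> - A n x)) / 2" by (simp add: field_simps)
    finally have eq: "f n x - P x = ((sgn (t x) - \<theta> n x) * \<bar>w x\<bar> + \<theta> n x * (\<bar>w x\<bar> - A n x)) / 2" .
    have "\<bar>f n x - P x\<bar> \<le> (\<bar>sgn (t x) - \<theta> n x\<bar> * \<bar>w x\<bar> + \<bar>\<theta> n x\<bar> * \<bar>\<bar>w x\<bar> - A n x\<bar>) / 2"
      unfolding eq using abs_triangle_ineq[of "(sgn (t x) - \<theta> n x) * \<bar>w x\<bar>" "\<theta> n x * (\<bar>w x\<bar> - A n x)"]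
      by (simp add: abs_mult)
    moreover have "\<bar>sgn (t x) - \<theta> n x\<bar> * \<bar>w x\<bar> \<le> 2 * L * e n"
    proof -
      have "\<bar>sgn (t x) - \<theta> n x\<bar> * \<bar>w x\<bar> \<le> \<bar>sgn (t x) - \<theta> n x\<bar> * (2 * L * \<bar>t x\<bar>)"
        using wt by (intro mult_left_mono) auto
      also have "\<dots> = 2 * L * (\<bar>t x\<bar> * \<bar>sgn (t x) - \<theta> n x\<bar>)" by simp
      also have "\<dots> \<le> 2 * L * e n"
        using soft_sgn_bounds[OF e[of n], of "t x"] L(1) by (intro mult_left_mono) (auto simp: \<theta>_def)
      finally show ?thesis .
    qed
    moreover have "\<bar>\<theta> n x\<bar> * \<bar>\<bar>w x\<bar> - A n x\<bar> \<le> 1 * e n"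
      using soft_abs_bounds[OF e[of n], of "w x"] soft_abs_bounds(4)[OF e[of n], of "t x"]
      by (intro mult_mono) (auto simp: A_def \<theta>_def)
    ultimately show ?thesis using e[of n] by (simp add: field_simps)
  qed
  have "cheeger \<Omega>' * (LINT x|lborel. P x) \<le> energy 1 u + (LINT x|(lborel::(real^'n) measure). 0)"
  proof (rule cheeger_le_uniform_limit[OF \<Omega>' P0 Pout sf close])
    show "0 < (1 + L) * e n" for n using e L by simp
    have "(\<lambda>n. (1 + L) * e n) \<longlonglongrightarrow> (1 + L) * 0" by (intro tendsto_intros e0)
    then show "(\<lambda>n. (1 + L) * e n) \<longlonglongrightarrow> 0" by simp
    show "integrable lborel (\<lambda>x. norm (grad (f n) x))" for n by (rule gfi)
    show "(LINT x|lborel. norm (grad (f n) x)) \<le> energy 1 u + (LINT x|lborel. Err n x)" for n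
    proof -
      have "(LINT x|lborel. norm (grad (f n) x)) \<le> (LINT x|lborel. b n x + Err n x)"
        using gfi bi Erri bound by (intro integral_mono) auto
      then show ?thesis using bi Erri bint by simp
    qed
    show "(\<lambda>n. energy 1 u + (LINT x|lborel. Err n x)) \<longlonglongrightarrow> energy 1 u + (LINT x|(lborel::(real^'n) measure). 0)"
      by (intro tendsto_intros Errlim)
  qed
  moreover have "(LINT x|lborel. P x) = mass 1 u"
  proof -
    have ui: "integrable lborel u"
      using smooth_continuous_on[OF K(1)] K by (intro integrable_compact_support) auto
    have "P \<in> borel_measurable borel"
    proof -
      have [measurable]: "u \<in> borel_measurable borel" "us \<in> borel_measurable borel" "t \<in> borel_measurable borel"
        using K(1) us(1) smt by (auto intro!: borel_measurable_continuous_onI smooth_continuous_on)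
      show ?thesis unfolding P_def[abs_def] w_def sgn_if by measurable
    qed
    moreover have "\<bar>P x\<bar> \<le> \<bar>u x\<bar> + \<bar>us x\<bar>" for x
      using u0[of x] u0[of "reflection j c x"] by (auto simp: P_cases us_def)
    moreover have "integrable lborel (\<lambda>x. \<bar>u x\<bar> + \<bar>us x\<bar>)"
      using ui integrable_reflection[OF ui, of j c] by (simp add: us_def)
    ultimately have Pi: "integrable lborel P"
      by (intro Bochner_Integration.integrable_bound[of _ "\<lambda>x. \<bar>u x\<bar> + \<bar>us x\<bar>" P]) auto
    have "(LINT x|lborel. P x) = (LINT x|lborel. u x)"
    proof (rule integral_eq_of_reflection_sum[OF Pi ui, of j c])
      fix x
      have "t (reflection j c x) = - t x" by (simp add: t_def reflection_def)
      moreover have "w (reflection j c x) = - w x" by (simp add: w_def us_def)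
      ultimately show "P x + P (reflection j c x) = u x + u (reflection j c x)"
        by (simp add: P_def us_def sgn_minus field_simps)
    qed
    then show ?thesis using u0 by (simp add: mass_1)
  qed
  ultimately show "cheeger \<Omega>' * mass 1 u \<le> energy 1 u" by simp
qed

section \<open>Eccentric annuli and monotonicity in the position of the hole\<close>

lemma eccentric_annulus_eq:
  "R0 > 0 \<Longrightarrow> eccentric_annulus j R0 R1 s = {x. norm x < R1 \<and> R0 < norm (x - s *\<^sub>R axis j 1)}"
  by (auto simp: eccentric_annulus_def dist_norm norm_minus_commute not_le)

lemma eccentric_annulus_open: "open (eccentric_annulus j R0 R1 s)"
  and eccentric_annulus_bounded: "bounded (eccentric_annulus j R0 R1 s)"
  unfolding eccentric_annulus_def by (auto intro: bounded_subset[OF bounded_ball])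

lemma norm_sq_minus_axis: "(norm (x - s *\<^sub>R axis j 1))\<^sup>2 = (norm x)\<^sup>2 - 2 * s * x $ j + s\<^sup>2"
  unfolding power2_norm_eq_inner
  by (simp add: inner_diff_left inner_diff_right inner_axis inner_axis' power2_eq_square algebra_simps)

lemma eccentric_annulus_nonempty:
  assumes "0 < R0" "0 \<le> s" "s < R1 - R0"
  shows "eccentric_annulus j R0 R1 s \<noteq> {}"
proof -
  have "((s - R0 - R1) / 2) *\<^sub>R axis j 1 \<in> eccentric_annulus j R0 R1 s"
    using assms by (simp add: eccentric_annulus_eq scaleR_left_diff_distrib[symmetric] norm_axis_1) (auto simp: field_simps)
  then show ?thesis by blast
qed

text \<open>The mirror is halfway between the centres, so it exchanges the two holes. On the side
  x_j \<le> c a point is at least as near to the centre for s as to that for s', and its mirror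
  image is at least as far from the origin because c \<ge> 0; these facts give the condition for the
  larger value. For the smaller value, the exchange of the holes and the common outer ball
  suffice.\<close>

lemma cheeger_annulus_antimono:
  assumes "0 < R0" "0 \<le> s" "s \<le> s'" "s' < R1 - R0"
  shows "cheeger (eccentric_annulus j R0 R1 s') \<le> cheeger (eccentric_annulus j R0 R1 s)"
proof (rule cheeger_polarization[OF eccentric_annulus_open eccentric_annulus_nonempty eccentric_annulus_open eccentric_annulus_bounded,
    where j=j and c="(s + s') / 2"])
  let ?r = "reflection j ((s + s') / 2)"
  have hole: "norm (?r x - s *\<^sub>R axis j 1) = norm (x - s' *\<^sub>R axis j 1)" for x
  proof -
    have "?r x - s *\<^sub>R axis j 1 = reflection j 0 (x - s' *\<^sub>R axis j 1)"
      by (auto simp: reflection_def vec_eq_iff axis_def field_simps)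
    then show ?thesis by simp
  qed
  have out: "norm x \<le> norm (?r x)" if "x $ j \<le> (s + s') / 2" for x
  proof -
    have "(norm (?r x))\<^sup>2 = (norm x)\<^sup>2 + 2 * (s + s') * ((s + s') / 2 - x $ j)"
      unfolding reflection_eq norm_sq_minus_axis by (simp add: power2_eq_square field_simps)
    then have "(norm x)\<^sup>2 \<le> (norm (?r x))\<^sup>2" using that assms by simp
    then show ?thesis by (simp add: power2_le_iff_abs_le)
  qed
  have closer: "norm (x - s *\<^sub>R axis j 1) \<le> norm (x - s' *\<^sub>R axis j 1)" if "x $ j \<le> (s + s') / 2" for x
  proof -
    have "(norm (x - s *\<^sub>R axis j 1))\<^sup>2 = (norm (x - s' *\<^sub>R axis j 1))\<^sup>2 - 2 * (s' - s) * ((s + s') / 2 - x $ j)"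
      unfolding norm_sq_minus_axis by (simp add: power2_eq_square field_simps)
    moreover have "2 * (s' - s) * ((s + s') / 2 - x $ j) \<ge> 0" using that assms by (intro mult_nonneg_nonneg) auto
    ultimately have "(norm (x - s *\<^sub>R axis j 1))\<^sup>2 \<le> (norm (x - s' *\<^sub>R axis j 1))\<^sup>2" by simp
    then show ?thesis by (simp add: power2_le_iff_abs_le)
  qed
  fix x assume x: "x \<notin> eccentric_annulus j R0 R1 s'"
  then have x': "norm x \<ge> R1 \<or> norm (x - s' *\<^sub>R axis j 1) \<le> R0"
    using assms by (auto simp: eccentric_annulus_eq)
  show "x \<notin> eccentric_annulus j R0 R1 s \<and> ?r x \<notin> eccentric_annulus j R0 R1 s" if "x $ j \<le> (s + s') / 2"
    using x' hole[of x] out[OF that] closer[OF that] assms by (auto simp: eccentric_annulus_eq)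
  show "x \<notin> eccentric_annulus j R0 R1 s \<or> ?r x \<notin> eccentric_annulus j R0 R1 s" if "x $ j \<ge> (s + s') / 2"
    using x' hole[of x] assms by (auto simp: eccentric_annulus_eq)
qed (use assms in auto)

section \<open>Moving the hole by a shear\<close>

text \<open>The shear \<open>x \<mapsto> x + \<delta> \<eta>(x) e\<^sub>j\<close> has Jacobian \<open>1 + \<delta> \<partial>\<^sub>j \<eta>\<close>. The change of variables formula for it
  follows from \<open>\<integral> \<partial>\<^sub>j F = 0\<close>, applied to \<open>F = G \<circ> T - G\<close> with \<open>G\<close> an antiderivative of \<open>g\<close> in
  direction \<open>e\<^sub>j\<close>; the change of variables theorem of the library needs an ordered index type.\<close>

lemma shear_integral:
  fixes g \<eta> :: "real^'n::finite \<Rightarrow> real" and j :: 'n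
  defines "T \<equiv> \<lambda>\<delta> x. x + (\<delta> * \<eta> x) *\<^sub>R axis j 1"
  assumes g: "continuous_on UNIV g" "compact K" "\<And>x. x \<notin> K \<Longrightarrow> g x = 0"
    and eta: "smooth \<eta>" "compact K'" "\<And>x. x \<notin> K' \<Longrightarrow> \<eta> x = 0"
  shows "(LINT x|lborel. g (T \<delta> x) * (1 + \<delta> * grad \<eta> x $ j)) = (LINT x|lborel. g x)"
    and "integrable lborel (\<lambda>x. g (T \<delta> x) * (1 + \<delta> * grad \<eta> x $ j))"
    and "integrable lborel (\<lambda>x. g (T \<delta> x))"
proof -
  let ?e = "axis j 1 :: real^'n"
  define J where "J x = 1 + \<delta> * grad \<eta> x $ j" for x
  have Tc: "continuous_on UNIV (T \<delta>)"
    unfolding T_def by (intro continuous_intros smooth_continuous_on eta)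
  have Jc: "continuous_on UNIV J"
    unfolding J_def by (intro continuous_intros smooth_continuous_grad eta)
  have gTc: "continuous_on UNIV (\<lambda>x. g (T \<delta> x))"
    using continuous_on_compose2[OF g(1) Tc] by simp
  have Tid: "T \<delta> x = x" "J x = 1" if "x \<notin> K'" for x
    using eta(3)[OF that] grad_zero_outside[OF compact_imp_closed[OF eta(2)] eta(3) that] by (simp_all add: T_def J_def)
  have KK: "compact (K \<union> K')" using g eta by auto
  have out: "g (T \<delta> x) = 0" if "x \<notin> K \<union> K'" for x
    using that Tid[of x] g(3) by simp
  show i1: "integrable lborel (\<lambda>x. g (T \<delta> x))"
    by (rule integrable_compact_support[OF gTc KK out])
  have i2: "integrable lborel (\<lambda>x. g (T \<delta> x) * J x)"
    by (rule integrable_compact_support[OF _ KK]) (use out in \<open>auto intro!: continuous_intros gTc Jc\<close>)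
  then show "integrable lborel (\<lambda>x. g (T \<delta> x) * (1 + \<delta> * grad \<eta> x $ j))" by (simp add: J_def)
  have i3: "integrable lborel g" by (rule integrable_compact_support[OF g])
  have "bounded (K \<union> (T \<delta> ` K' \<union> K'))"
    using g(2) eta(2) by (intro compact_imp_bounded compact_Un compact_continuous_image continuous_on_subset[OF Tc]) auto
  then obtain r where r: "r > 0" "\<And>x. x \<in> K \<union> (T \<delta> ` K' \<union> K') \<Longrightarrow> norm x \<le> r"
    unfolding bounded_pos by metis
  \<comment> \<open>Since r bounds the norm on all sets involved, a shift by more than 2 r carries
    each of their points out of the support of g.\<close>
  define M where "M = 2 * r + 1"
  have M: "M > 0" using r by (simp add: M_def)
  have far: "g (y - M *\<^sub>R ?e) = 0" if "y \<in> T \<delta> ` K' \<union> K'" for y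
  proof -
    have "norm (M *\<^sub>R ?e) \<le> norm (y - M *\<^sub>R ?e) + norm y"
      using norm_triangle_ineq4[of y "y - M *\<^sub>R ?e"] by simp
    then have "norm (y - M *\<^sub>R ?e) > r" using r(2)[of y] that M by (simp add: norm_axis_1 M_def)
    then show ?thesis using g(3) r(2) by force
  qed
  \<comment> \<open>Integral of g in direction e_j over a window of length \<open>M\<close>: its
    derivative is g minus the copy of g shifted by \<open>M\<close>. As g is merely assumed
    continuous, only this directional derivative is available, which is all that
    \<open>integral_directional_derivative_zero\<close> asks for.\<close>
  define G where "G x = integral {0..M} (\<lambda>s. g (x - s *\<^sub>R ?e))" for x
  have Gc: "continuous_on UNIV G"
    unfolding G_def interval_cbox
  proof (rule integral_continuous_on_param)
    have "continuous_on (UNIV \<times> cbox 0 M) (\<lambda>z. g (fst z - snd z *\<^sub>R ?e))"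
      by (rule continuous_on_compose2[OF g(1)]) (auto intro!: continuous_intros)
    then show "continuous_on (UNIV \<times> cbox 0 M) (\<lambda>(x, s). g (x - s *\<^sub>R ?e))"
      by (simp add: split_beta)
  qed
  have Gd: "((\<lambda>s. G (x + s *\<^sub>R ?e)) has_real_derivative g (x + s *\<^sub>R ?e) - g (x + s *\<^sub>R ?e - M *\<^sub>R ?e)) (at s)" for x s
  proof -
    define h where "h t = g (x + t *\<^sub>R ?e)" for t
    have "continuous_on UNIV h"
      unfolding h_def by (intro continuous_on_compose2[OF g(1)] continuous_intros) auto
    then have hc: "isCont h t" for t by (simp add: continuous_on_eq_continuous_at)
    obtain H where H: "\<And>t. (H has_vector_derivative h t) (at t)"
      using einterval_antiderivative[of "-\<infinity>" \<infinity> h] hc by auto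
    have Hr: "(H has_real_derivative h t) (at t)" for t
      using H by (simp add: has_real_derivative_iff_has_vector_derivative)
    have GH: "G (x + t *\<^sub>R ?e) = H t - H (t - M)" for t
    proof -
      have "((\<lambda>s. h (t - s)) has_integral (- H (t - M) - (- H (t - 0)))) {0..M}"
      proof (rule fundamental_theorem_of_calculus)
        fix s assume "s \<in> {0..M}"
        have "((\<lambda>s. - H (t - s)) has_real_derivative - (h (t - s) * (- 1))) (at s)"
          by (intro DERIV_minus DERIV_chain2[OF Hr]) (auto intro!: derivative_eq_intros)
        then show "((\<lambda>s. - H (t - s)) has_vector_derivative h (t - s)) (at s within {0..M})"
          by (simp add: has_real_derivative_iff_has_vector_derivative has_vector_derivative_at_within)
      qed (use M in simp)
      moreover have "h (t - s) = g (x + t *\<^sub>R ?e - s *\<^sub>R ?e)" for s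
        by (simp add: h_def algebra_simps)
      ultimately show ?thesis unfolding G_def by (simp add: integral_unique)
    qed
    have "((\<lambda>s. H s - H (s - M)) has_real_derivative h s - h (s - M) * 1) (at s)"
      by (intro derivative_intros Hr DERIV_chain2[OF Hr]) (auto intro!: derivative_eq_intros)
    then show ?thesis unfolding GH by (simp add: h_def algebra_simps)
  qed
  have "(LINT x|lborel. g (T \<delta> x) * J x - g x) = 0"
  proof (rule integral_directional_derivative_zero[where F="\<lambda>x. G (T \<delta> x) - G x" and v="?e" and K=K'])
    show "continuous_on UNIV (\<lambda>x. G (T \<delta> x) - G x)"
      by (intro continuous_intros Gc continuous_on_compose2[OF Gc Tc]) auto
    show "continuous_on UNIV (\<lambda>x. g (T \<delta> x) * J x - g x)"
      by (intro continuous_intros gTc Jc g)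
    show "compact K'" by (fact eta)
    show "G (T \<delta> x) - G x = 0" if "x \<notin> K'" for x using Tid[OF that] by simp
    fix x :: "real^'n" and t :: real
    define y where "y = t *\<^sub>R ?e + x"
    have et: "((\<lambda>t. \<eta> (t *\<^sub>R ?e + x)) has_real_derivative grad \<eta> y $ j) (at t)"
    proof -
      have "((\<lambda>t. t *\<^sub>R ?e + x) has_derivative (\<lambda>s. s *\<^sub>R ?e)) (at t)"
        by (auto intro!: derivative_eq_intros)
      from has_derivative_compose[OF this smooth_has_derivative[OF eta(1)]] show ?thesis
        unfolding has_field_derivative_def y_def
        by (rule has_derivative_eq_rhs) (simp add: fun_eq_iff inner_axis)
    qed
    have Teq: "T \<delta> (t *\<^sub>R ?e + x) = x + (t + \<delta> * \<eta> (t *\<^sub>R ?e + x)) *\<^sub>R ?e" for t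
      by (simp add: T_def algebra_simps)
    have "((\<lambda>t. t + \<delta> * \<eta> (t *\<^sub>R ?e + x)) has_real_derivative J y) (at t)"
      unfolding J_def by (auto intro!: derivative_eq_intros et)
    from DERIV_chain2[OF Gd this, of x]
    have d1: "((\<lambda>t. G (T \<delta> (t *\<^sub>R ?e + x))) has_real_derivative (g (T \<delta> y) - g (T \<delta> y - M *\<^sub>R ?e)) * J y) (at t)"
      unfolding Teq y_def by simp
    have d2: "((\<lambda>t. G (t *\<^sub>R ?e + x)) has_real_derivative g y - g (y - M *\<^sub>R ?e)) (at t)"
      using Gd[of x t] by (simp add: y_def add.commute)
    \<comment> \<open>Inside \<open>K'\<close> both shifted copies vanish by the choice of
      \<open>M\<close>; outside, the shear is the identity and everything cancels.\<close>
    have "(g (T \<delta> y) - g (T \<delta> y - M *\<^sub>R ?e)) * J y - (g y - g (y - M *\<^sub>R ?e)) = g (T \<delta> y) * J y - g y"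
    proof (cases "y \<in> K'")
      case True
      then show ?thesis using far[of y] far[of "T \<delta> y"] by simp
    next
      case False
      then show ?thesis using Tid[OF False] by simp
    qed
    with DERIV_diff[OF d1 d2]
    show "((\<lambda>t. G (T \<delta> (t *\<^sub>R ?e + x)) - G (t *\<^sub>R ?e + x)) has_real_derivative
        g (T \<delta> (t *\<^sub>R ?e + x)) * J (t *\<^sub>R ?e + x) - g (t *\<^sub>R ?e + x)) (at t)"
      unfolding y_def[symmetric] by (simp only:)
  qed
  then show "(LINT x|lborel. g (T \<delta> x) * (1 + \<delta> * grad \<eta> x $ j)) = (LINT x|lborel. g x)"
    using i2 i3 by (simp add: J_def)
qed

text \<open>A test function on \<Omega>' is pulled back along the shear. With q = |\<delta>| L the
  Jacobian lies between 1 - q and 1 + q and the gradient grows by at most 1 + q: one factor 1 + q is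
  lost on the mass, one on the gradient, and 1 - q on the transformed energy integral.\<close>

lemma cheeger_shear:
  fixes \<Omega> \<Omega>' :: "(real^'n::finite) set" and j :: 'n and \<eta> :: "real^'n \<Rightarrow> real"
  defines "T \<equiv> \<lambda>\<delta> x. x + (\<delta> * \<eta> x) *\<^sub>R axis j 1"
  assumes \<Omega>: "open \<Omega>" "bounded \<Omega>" "\<Omega> \<noteq> {}" and \<Omega>': "open \<Omega>'" "\<Omega>' \<noteq> {}"
    and eta: "smooth \<eta>" "compact K'" "\<And>x. x \<notin> K' \<Longrightarrow> \<eta> x = 0" "\<And>x. norm (grad \<eta> x) \<le> L"
    and q: "\<bar>\<delta>\<bar> * L < 1" and maps: "\<And>x. x \<notin> \<Omega> \<Longrightarrow> T \<delta> x \<notin> \<Omega>'"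
  shows "cheeger \<Omega> * ((1 - \<bar>\<delta>\<bar> * L) / (1 + \<bar>\<delta>\<bar> * L)\<^sup>2) \<le> cheeger \<Omega>'"
proof (rule cheeger_ge[OF \<Omega>'])
  fix \<phi> assume phi: "\<phi> \<in> test_functions \<Omega>'"
  then obtain K where K: "smooth \<phi>" "compact K" "K \<subseteq> \<Omega>'" "\<And>x. x \<notin> K \<Longrightarrow> \<phi> x = 0"
    by (auto elim: test_functionsE)
  define q where "q = \<bar>\<delta>\<bar> * L"
  have q01: "0 \<le> q" "q < 1" using q order_trans[OF norm_ge_zero eta(4)] by (auto simp: q_def)
  define \<psi> where "\<psi> x = \<phi> (T \<delta> x)" for x
  have Tc: "continuous_on UNIV (T \<delta>)"
    unfolding T_def by (intro continuous_intros smooth_continuous_on eta)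
  have Ts: "smooth (\<lambda>x. T \<delta> x $ l)" for l
    unfolding T_def by (simp add: axis_def) (intro conjI impI smooth_intros eta)
  have ps: "smooth \<psi>" unfolding \<psi>_def[abs_def] by (rule smooth_compose_map[OF Ts K(1)])
  have sub: "T \<delta> -` K \<subseteq> \<Omega>" using maps K(3) by blast
  have cK: "compact (T \<delta> -` K)"
    using bounded_subset[OF \<Omega>(2) sub] closed_vimage[OF compact_imp_closed[OF K(2)] Tc]
    by (simp add: compact_eq_bounded_closed)
  have psi: "\<psi> \<in> test_functions \<Omega>"
    by (rule test_functionsI[OF ps cK sub]) (simp add: \<psi>_def K(4))
  have J: "\<bar>\<delta> * grad \<eta> x $ j\<bar> \<le> q" for x
    unfolding q_def abs_mult using component_le_norm_cart[of "grad \<eta> x" j] eta(4)[of x]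
    by (intro mult_left_mono) auto
  have int: "(1 - q) * (LINT x|lborel. g (T \<delta> x)) \<le> (LINT x|lborel. g x)"
    "(LINT x|lborel. g x) \<le> (1 + q) * (LINT x|lborel. g (T \<delta> x))"
    "integrable lborel (\<lambda>x. g (T \<delta> x))"
    if g: "continuous_on UNIV g" "\<And>x. x \<notin> K \<Longrightarrow> g x = 0" "\<And>x. g x \<ge> 0" for g
  proof -
    have S: "(LINT x|lborel. g (T \<delta> x) * (1 + \<delta> * grad \<eta> x $ j)) = (LINT x|lborel. g x)"
      "integrable lborel (\<lambda>x. g (T \<delta> x) * (1 + \<delta> * grad \<eta> x $ j))"
      "integrable lborel (\<lambda>x. g (T \<delta> x))"
      unfolding T_def using shear_integral[OF g(1) K(2) g(2) eta(1-3), of \<delta> j] by simp_all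
    show "integrable lborel (\<lambda>x. g (T \<delta> x))" by (rule S(3))
    have "(LINT x|lborel. (1 - q) * g (T \<delta> x)) \<le> (LINT x|lborel. g (T \<delta> x) * (1 + \<delta> * grad \<eta> x $ j))"
    proof (rule integral_mono[OF _ S(2)])
      show "(1 - q) * g (T \<delta> x) \<le> g (T \<delta> x) * (1 + \<delta> * grad \<eta> x $ j)" for x
        using J[of x] g(3)[of "T \<delta> x"] by (subst mult.commute, intro mult_left_mono) auto
    qed (use S(3) in simp)
    then show "(1 - q) * (LINT x|lborel. g (T \<delta> x)) \<le> (LINT x|lborel. g x)" by (simp add: S(1))
    have "(LINT x|lborel. g (T \<delta> x) * (1 + \<delta> * grad \<eta> x $ j)) \<le> (LINT x|lborel. (1 + q) * g (T \<delta> x))"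
    proof (rule integral_mono[OF S(2)])
      show "g (T \<delta> x) * (1 + \<delta> * grad \<eta> x $ j) \<le> (1 + q) * g (T \<delta> x)" for x
        using J[of x] g(3)[of "T \<delta> x"] by (subst mult.commute, intro mult_right_mono) auto
    qed (use S(3) in simp)
    then show "(LINT x|lborel. g x) \<le> (1 + q) * (LINT x|lborel. g (T \<delta> x))" by (simp add: S(1))
  qed
  have m: "mass 1 \<phi> \<le> (1 + q) * mass 1 \<psi>"
    unfolding mass_1 \<psi>_def
    by (rule int(2)[OF continuous_on_rabs[OF smooth_continuous_on[OF K(1)]]]) (simp_all add: K(4))
  have g0: "grad \<phi> x = 0" if "x \<notin> K" for x
    using grad_zero_outside[OF compact_imp_closed[OF K(2)] K(4) that] .
  have gc: "continuous_on UNIV (\<lambda>x. norm (grad \<phi> x))"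
    by (intro continuous_intros smooth_continuous_grad K)
  have E: "(1 - q) * (LINT x|lborel. norm (grad \<phi> (T \<delta> x))) \<le> energy 1 \<phi>"
    "integrable lborel (\<lambda>x. norm (grad \<phi> (T \<delta> x)))"
    unfolding energy_1 by (rule int(1)[OF gc] int(3)[OF gc]; simp add: g0)+
  have gpsi: "norm (grad \<psi> x) \<le> (1 + q) * norm (grad \<phi> (T \<delta> x))" for x
  proof -
    have "(T \<delta> has_derivative (\<lambda>h. h + (\<delta> * (grad \<eta> x \<bullet> h)) *\<^sub>R axis j 1)) (at x)"
      unfolding T_def by (auto intro!: derivative_eq_intros smooth_has_derivative[OF eta(1)])
    from has_derivative_compose[OF this smooth_has_derivative[OF K(1)]]
    have "grad \<psi> x = grad \<phi> (T \<delta> x) + (\<delta> * grad \<phi> (T \<delta> x) $ j) *\<^sub>R grad \<eta> x"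
      unfolding \<psi>_def[abs_def]
      by (intro grad_eqI) (simp add: inner_add_left inner_add_right inner_axis mult.commute mult.left_commute)
    then have "norm (grad \<psi> x) \<le> norm (grad \<phi> (T \<delta> x)) + \<bar>\<delta> * grad \<phi> (T \<delta> x) $ j\<bar> * norm (grad \<eta> x)"
      using norm_triangle_ineq[of "grad \<phi> (T \<delta> x)" "(\<delta> * grad \<phi> (T \<delta> x) $ j) *\<^sub>R grad \<eta> x"] by simp
    also have "\<bar>\<delta> * grad \<phi> (T \<delta> x) $ j\<bar> * norm (grad \<eta> x) \<le> (\<bar>\<delta>\<bar> * norm (grad \<phi> (T \<delta> x))) * L"
      unfolding abs_mult using component_le_norm_cart eta(4)
      by (intro mult_mono mult_nonneg_nonneg) auto
    finally show ?thesis by (simp add: q_def algebra_simps)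
  qed
  have "cheeger \<Omega> * mass 1 \<psi> \<le> energy 1 \<psi>" by (rule cheeger_le[OF psi])
  also have "\<dots> \<le> (LINT x|lborel. (1 + q) * norm (grad \<phi> (T \<delta> x)))"
    unfolding energy_1 using test_function_integrals(1)[OF psi \<Omega>(1), of 1] E(2) gpsi
    by (intro integral_mono) auto
  finally have 1: "cheeger \<Omega> * mass 1 \<psi> \<le> (1 + q) * (LINT x|lborel. norm (grad \<phi> (T \<delta> x)))" by simp
  have h0: "cheeger \<Omega> \<ge> 0" using cheeger_nonneg[OF \<Omega>(1,3)] .
  have "cheeger \<Omega> * (1 - q) * mass 1 \<phi> \<le> cheeger \<Omega> * (1 - q) * ((1 + q) * mass 1 \<psi>)"
    using m h0 q01 by (intro mult_left_mono) auto
  also have "\<dots> = (1 - q) * (1 + q) * (cheeger \<Omega> * mass 1 \<psi>)" by (simp add: algebra_simps)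
  also have "\<dots> \<le> (1 - q) * (1 + q) * ((1 + q) * (LINT x|lborel. norm (grad \<phi> (T \<delta> x))))"
    using 1 q01 by (intro mult_left_mono) auto
  also have "\<dots> = (1 + q)\<^sup>2 * ((1 - q) * (LINT x|lborel. norm (grad \<phi> (T \<delta> x))))"
    by (simp add: power2_eq_square algebra_simps)
  also have "\<dots> \<le> (1 + q)\<^sup>2 * energy 1 \<phi>" using E(1) by (intro mult_left_mono) auto
  finally have "cheeger \<Omega> * (1 - q) * mass 1 \<phi> \<le> (1 + q)\<^sup>2 * energy 1 \<phi>" .
  moreover have "(1 + q)\<^sup>2 > 0" using q01 by (simp add: power2_eq_square add_pos_nonneg)
  ultimately have "cheeger \<Omega> * ((1 - q) / (1 + q)\<^sup>2) * mass 1 \<phi> \<le> energy 1 \<phi>"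
    by (simp add: field_simps)
  then show "cheeger \<Omega> * ((1 - \<bar>\<delta>\<bar> * L) / (1 + \<bar>\<delta>\<bar> * L)\<^sup>2) * mass 1 \<phi> \<le> energy 1 \<phi>"
    by (simp add: q_def)
qed

text \<open>One cut-off \<eta>, equal to 1 around the hole at s0 and to 0 outside the outer ball,
  yields shears with \<delta> = s' - s that translate the hole from s to s' whenever s is close to
  s0. Used from s0 to s and back, they enclose the value at s between multiples of the value at s0
  whose factors tend to 1.\<close>

lemma continuous_on_cheeger_annulus:
  fixes j :: "'n::finite"
  assumes "0 < R0" "R0 < R1"
  shows "continuous_on {0..<R1 - R0} (\<lambda>s. cheeger (eccentric_annulus j R0 R1 s))"
  unfolding continuous_on_def
proof
  fix s0 assume s0: "s0 \<in> {0..<R1 - R0}"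
  let ?h = "\<lambda>s. cheeger (eccentric_annulus j R0 R1 s)"
  let ?e = "axis j 1 :: real^'n"
  \<comment> \<open>A quarter of the gap to the outer sphere: \<eta> falls from 1 to 0 between the
    radii R0 + \<rho> and R0 + 2 \<rho> around the centre for s0, well inside the outer
    ball.\<close>
  define \<rho> where "\<rho> = (R1 - R0 - s0) / 4"
  have rho: "\<rho> > 0" "s0 + R0 + 2 * \<rho> < R1" using s0 by (auto simp: \<rho>_def field_simps)
  define a b where "a = (R0 + 2 * \<rho>)\<^sup>2" and "b = (R0 + \<rho>)\<^sup>2"
  have ab: "b < a" unfolding a_def b_def using rho assms by (intro power_strict_mono) auto
  define \<eta> where "\<eta> x = step ((a - (norm (x - s0 *\<^sub>R ?e))\<^sup>2) / (a - b))" for x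
  have eta1: "\<eta> x = 1" if "norm (x - s0 *\<^sub>R ?e) \<le> R0 + \<rho>" for x
  proof -
    have "(norm (x - s0 *\<^sub>R ?e))\<^sup>2 \<le> b" unfolding b_def using that by (intro power_mono) auto
    then show ?thesis unfolding \<eta>_def using ab by (intro step_eq_1) (simp add: field_simps)
  qed
  define K where "K = cball (s0 *\<^sub>R ?e) (R0 + 2 * \<rho>)"
  have eta0: "\<eta> x = 0" if "x \<notin> K" for x
  proof -
    have "R0 + 2 * \<rho> \<le> norm (x - s0 *\<^sub>R ?e)" using that by (simp add: K_def dist_norm norm_minus_commute)
    then have "a \<le> (norm (x - s0 *\<^sub>R ?e))\<^sup>2" unfolding a_def using assms rho by (intro power_mono) auto
    then show ?thesis unfolding \<eta>_def using ab by (intro step_eq_0) (simp add: field_simps)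
  qed
  have es: "smooth \<eta>" unfolding \<eta>_def[abs_def] by (intro smooth_intros smooth_norm_square)
  have Kc: "compact K" by (simp add: K_def)
  have "\<eta> \<in> test_functions UNIV" by (rule test_functionsI[OF es Kc _ eta0]) auto
  then obtain L where L: "L > 0" "\<And>x. norm (grad \<eta> x) \<le> L"
    using test_function_Lipschitz by metis
  have KR: "norm x < R1" if "x \<in> K" for x
  proof -
    have "norm x \<le> norm (x - s0 *\<^sub>R ?e) + norm (s0 *\<^sub>R ?e)" using norm_triangle_ineq[of "x - s0 *\<^sub>R ?e" "s0 *\<^sub>R ?e"] by simp
    then show ?thesis using that rho s0 by (simp add: K_def dist_norm norm_minus_commute norm_axis_1)
  qed
  have key: "?h s * ((1 - \<bar>s' - s\<bar> * L) / (1 + \<bar>s' - s\<bar> * L)\<^sup>2) \<le> ?h s'"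
    if s: "s \<in> {0..<R1 - R0}" "s' \<in> {0..<R1 - R0}" "\<bar>s - s0\<bar> \<le> \<rho>" "\<bar>s' - s\<bar> * L < 1" for s s'
  proof (rule cheeger_shear[OF eccentric_annulus_open eccentric_annulus_bounded _ eccentric_annulus_open _ es Kc eta0 L(2) s(4), where j=j])
    show "eccentric_annulus j R0 R1 s \<noteq> {}" "eccentric_annulus j R0 R1 s' \<noteq> {}"
      using s(1,2) assms(1) eccentric_annulus_nonempty[of R0 s R1 j] eccentric_annulus_nonempty[of R0 s' R1 j] by simp_all
    fix x assume "x \<notin> eccentric_annulus j R0 R1 s"
    then consider "norm x \<ge> R1" | "norm (x - s *\<^sub>R ?e) \<le> R0"
      using assms by (auto simp: eccentric_annulus_eq)
    then show "x + ((s' - s) * \<eta> x) *\<^sub>R ?e \<notin> eccentric_annulus j R0 R1 s'"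
    proof cases
      case 1
      then have "\<eta> x = 0" using KR eta0 by force
      then show ?thesis using 1 assms by (simp add: eccentric_annulus_eq)
    next
      case 2
      have "norm (x - s0 *\<^sub>R ?e) \<le> norm (x - s *\<^sub>R ?e) + norm ((s - s0) *\<^sub>R ?e)"
        using norm_triangle_ineq[of "x - s *\<^sub>R ?e" "(s - s0) *\<^sub>R ?e"] by (simp add: algebra_simps)
      also have "\<dots> \<le> R0 + \<rho>" using 2 s by (simp add: norm_axis_1)
      finally have "\<eta> x = 1" by (rule eta1)
      then have "x + ((s' - s) * \<eta> x) *\<^sub>R ?e - s' *\<^sub>R ?e = x - s *\<^sub>R ?e" by (simp add: algebra_simps)
      with 2 have "norm (x + ((s' - s) * \<eta> x) *\<^sub>R ?e - s' *\<^sub>R ?e) \<le> R0" by (simp only:)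
      then show ?thesis unfolding eccentric_annulus_eq[OF assms(1)] by simp
    qed
  qed
  define F where "F s = (1 - \<bar>s - s0\<bar> * L) / (1 + \<bar>s - s0\<bar> * L)\<^sup>2" for s
  have Flim: "(F \<longlongrightarrow> F s0) (at s0 within {0..<R1 - R0})"
    unfolding F_def using L by (intro tendsto_intros) auto
  have F0: "F s0 = 1" by (simp add: F_def)
  \<comment> \<open>Keeps the hole in the region where \<eta> = 1 and the distortion |s - s0| L
    below 1/2.\<close>
  define d where "d = min \<rho> (1 / (2 * L))"
  have d: "d > 0" using rho L by (simp add: d_def)
  have ev: "eventually (\<lambda>s. s \<in> {0..<R1 - R0} \<and> \<bar>s - s0\<bar> < d) (at s0 within {0..<R1 - R0})"
    unfolding eventually_at using d by (auto simp: dist_real_def)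
  have near: "?h s0 * F s \<le> ?h s \<and> ?h s \<le> ?h s0 / F s" if s: "s \<in> {0..<R1 - R0} \<and> \<bar>s - s0\<bar> < d" for s
  proof -
    have "\<bar>s - s0\<bar> * L < 1 / (2 * L) * L" using s L by (intro mult_strict_right_mono) (auto simp: d_def)
    then have q: "\<bar>s - s0\<bar> * L < 1" using L by simp
    have Fp: "F s > 0" unfolding F_def using q L by (intro divide_pos_pos zero_less_power add_pos_nonneg) auto
    have "?h s0 * F s \<le> ?h s" unfolding F_def using key[of s0 s] s s0 q rho by simp
    moreover have "?h s * F s \<le> ?h s0" unfolding F_def
      using key[of s s0] s s0 q rho by (simp add: d_def abs_minus_commute)
    ultimately show ?thesis using Fp by (simp add: pos_le_divide_eq)
  qed
  show "(?h \<longlongrightarrow> ?h s0) (at s0 within {0..<R1 - R0})"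
  proof (rule tendsto_sandwich)
    show "eventually (\<lambda>s. ?h s0 * F s \<le> ?h s) (at s0 within {0..<R1 - R0})"
      "eventually (\<lambda>s. ?h s \<le> ?h s0 / F s) (at s0 within {0..<R1 - R0})"
      using ev by (eventually_elim, use near in blast)+
    have "((\<lambda>s. ?h s0 * F s) \<longlongrightarrow> ?h s0 * F s0) (at s0 within {0..<R1 - R0})"
      by (intro tendsto_intros Flim)
    then show "((\<lambda>s. ?h s0 * F s) \<longlongrightarrow> ?h s0) (at s0 within {0..<R1 - R0})" by (simp add: F0)
    have "((\<lambda>s. ?h s0 / F s) \<longlongrightarrow> ?h s0 / F s0) (at s0 within {0..<R1 - R0})"
      using F0 by (intro tendsto_intros Flim) auto
    then show "((\<lambda>s. ?h s0 / F s) \<longlongrightarrow> ?h s0) (at s0 within {0..<R1 - R0})" by (simp add: F0)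
  qed
qed

section \<open>Divergence theorem and the limit p to infinity\<close>

text \<open>The fields of the divergence theorem exist only on the domain, being singular at its
  boundary or at the centre of a sphere, and |\<phi>|^p is in general only continuously
  differentiable; hence one order of regularity, relative to a set.\<close>

definition C1_on :: "(real^'n::finite) set \<Rightarrow> (real^'n \<Rightarrow> real) \<Rightarrow> bool"
  where "C1_on S f \<longleftrightarrow> (\<forall>x\<in>S. f differentiable (at x)) \<and> continuous_on S (grad f)"

lemma C1_onD:
  assumes "C1_on S f"
  shows "x \<in> S \<Longrightarrow> f differentiable (at x)" "continuous_on S (grad f)" "continuous_on S f"
  using assms unfolding C1_on_def
  by (auto intro!: continuous_at_imp_continuous_on differentiable_imp_continuous_within)

lemma C1_onI:
  assumes "\<And>x. x \<in> S \<Longrightarrow> f differentiable (at x)" "continuous_on S g" "\<And>x. x \<in> S \<Longrightarrow> grad f x = g x"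
  shows "C1_on S f"
  unfolding C1_on_def using assms continuous_on_cong[of S S "grad f" g] by auto

lemma C1_on_smooth: "smooth f \<Longrightarrow> C1_on S f"
  by (auto simp: C1_on_def smooth_differentiable smooth_continuous_grad)

lemma C1_on_subset: "C1_on S f \<Longrightarrow> T \<subseteq> S \<Longrightarrow> C1_on T f"
  by (auto simp: C1_on_def intro: continuous_on_subset)

lemma C1_on_mult:
  assumes "C1_on S f" "C1_on S g"
  shows "C1_on S (\<lambda>x. f x * g x)"
proof (rule C1_onI)
  show "continuous_on S (\<lambda>x. f x *\<^sub>R grad g x + g x *\<^sub>R grad f x)"
    by (intro continuous_intros C1_onD assms)
  show "grad (\<lambda>x. f x * g x) x = f x *\<^sub>R grad g x + g x *\<^sub>R grad f x" if "x \<in> S" for x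
    by (rule grad_mult) (use C1_onD(1) assms that in auto)
  show "(\<lambda>x. f x * g x) differentiable (at x)" if "x \<in> S" for x
    using C1_onD(1)[OF assms(1) that] C1_onD(1)[OF assms(2) that] by (rule differentiable_mult)
qed

lemma C1_on_diff:
  assumes "C1_on S f" "C1_on S g"
  shows "C1_on S (\<lambda>x. f x - g x)"
proof (rule C1_onI)
  show "continuous_on S (\<lambda>x. grad f x - grad g x)"
    by (intro continuous_intros C1_onD assms)
  show "grad (\<lambda>x. f x - g x) x = grad f x - grad g x" if "x \<in> S" for x
    by (rule grad_diff) (use C1_onD(1) assms that in auto)
  show "(\<lambda>x. f x - g x) differentiable (at x)" if "x \<in> S" for x
    using C1_onD(1)[OF assms(1) that] C1_onD(1)[OF assms(2) that] by (rule differentiable_diff)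
qed

lemma C1_on_compose:
  assumes "C1_on S f" "\<And>x. x \<in> S \<Longrightarrow> (h has_real_derivative h' (f x)) (at (f x))"
    "continuous_on S (\<lambda>x. h' (f x))"
  shows "C1_on S (\<lambda>x. h (f x))"
proof (rule C1_onI)
  show "continuous_on S (\<lambda>x. h' (f x) *\<^sub>R grad f x)"
    by (intro continuous_intros C1_onD assms)
  fix x assume x: "x \<in> S"
  show "grad (\<lambda>x. h (f x)) x = h' (f x) *\<^sub>R grad f x"
    by (rule grad_compose_1D) (use C1_onD(1) assms x in auto)
  have "h differentiable (at (f x))"
    using assms(2)[OF x] by (auto simp: has_field_derivative_def differentiable_def)
  then show "(\<lambda>x. h (f x)) differentiable (at x)"
    using differentiable_chain_at[of f x h] C1_onD(1)[OF assms(1) x] by (simp add: o_def)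
qed

lemma grad_cong_open:
  assumes "open S" "x \<in> S" "\<And>y. y \<in> S \<Longrightarrow> f y = g y" "f differentiable (at x)"
  shows "grad g x = grad f x" "g differentiable (at x)"
proof -
  have "(g has_derivative (\<lambda>h. grad f x \<bullet> h)) (at x)"
    by (rule has_derivative_transform_within_open[OF has_derivative_grad[OF assms(4)] assms(1,2)]) (use assms in auto)
  then show "grad g x = grad f x" "g differentiable (at x)"
    by (auto intro: grad_eqI differentiableI)
qed

lemma C1_on_cong_open:
  assumes "C1_on S f" "open S" "\<And>y. y \<in> S \<Longrightarrow> f y = g y"
  shows "C1_on S g"
  by (rule C1_onI[of S g "grad f"]) (use grad_cong_open[OF assms(2) _ assms(3)] C1_onD[OF assms(1)] in auto)

lemma C1_on_Un: "C1_on S f \<Longrightarrow> C1_on T f \<Longrightarrow> open S \<Longrightarrow> open T \<Longrightarrow> C1_on (S \<union> T) f"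
  by (auto simp: C1_on_def intro: continuous_on_open_Un)

lemma grad_norm:
  assumes "x \<noteq> c"
  shows "(\<lambda>x. norm (x - c)) differentiable (at x)" "grad (\<lambda>x. norm (x - c)) x = (x - c) /\<^sub>R norm (x - c)"
proof -
  have n: "norm (x - c) > 0" using assms by simp
  have d: "(sqrt has_real_derivative inverse (sqrt ((norm (x - c))\<^sup>2)) / 2) (at ((norm (x - c))\<^sup>2))"
    using n by (intro DERIV_real_sqrt) simp
  have s: "smooth (\<lambda>x. (norm (x - c))\<^sup>2)" by (rule smooth_norm_square)
  have e: "(\<lambda>x. norm (x - c)) = (\<lambda>x. sqrt ((norm (x - c))\<^sup>2))" by simp
  show "grad (\<lambda>x. norm (x - c)) x = (x - c) /\<^sub>R norm (x - c)"
    unfolding e grad_compose_1D[OF smooth_differentiable[OF s] d] grad_norm_square by simp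
  show "(\<lambda>x. norm (x - c)) differentiable (at x)"
    using has_derivative_compose[OF smooth_has_derivative[OF s] d[unfolded has_field_derivative_def]]
    unfolding e by (rule differentiableI)
qed

lemma C1_on_norm: "c \<notin> S \<Longrightarrow> C1_on S (\<lambda>x. norm (x - c))"
  by (rule C1_onI[of S _ "\<lambda>x. (x - c) /\<^sub>R norm (x - c)"])
    (auto intro!: continuous_intros grad_norm)

text \<open>The integrand is continuous on \<Omega> and zero on the complement of \<open>K\<close>;
  these open sets cover the space, so the values of \<open>Z\<close> outside \<Omega> never
  matter.\<close>

lemma integral_divergence:
  fixes Z :: "'n::finite \<Rightarrow> real^'n \<Rightarrow> real"
  assumes \<Omega>: "open \<Omega>" and psi: "C1_on UNIV \<psi>" and K: "compact K" "K \<subseteq> \<Omega>" "\<And>x. x \<notin> K \<Longrightarrow> \<psi> x = 0"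
    and Z: "\<And>i. C1_on \<Omega> (Z i)"
  shows "(LINT x|lborel. \<psi> x * (\<Sum>i\<in>UNIV. grad (Z i) x $ i) + (\<Sum>i\<in>UNIV. grad \<psi> x $ i * Z i x)) = 0"
    and "integrable lborel (\<lambda>x. \<psi> x * (\<Sum>i\<in>UNIV. grad (Z i) x $ i) + (\<Sum>i\<in>UNIV. grad \<psi> x $ i * Z i x))"
proof -
  define D where "D i x = \<psi> x * grad (Z i) x $ i + grad \<psi> x $ i * Z i x" for i x
  have g0: "grad \<psi> x = 0" if "x \<notin> K" for x
    using grad_zero_outside[OF compact_imp_closed[OF K(1)] K(3) that] .
  have U: "\<Omega> \<union> - K = UNIV" using K(2) by auto
  have oK: "open (- K)" using compact_imp_closed[OF K(1)] by (rule open_Compl)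
  have main: "(LINT x|lborel. D i x) = 0 \<and> integrable lborel (D i)" for i
  proof -
    have D0: "D i x = 0" if "x \<in> - K" for x using K(3) g0 that by (simp add: D_def)
    have "continuous_on (- K) (D i)"
      using continuous_on_cong[of "- K" "- K" "D i" "\<lambda>x. 0"] D0 by simp
    moreover have "continuous_on \<Omega> (D i)"
      unfolding D_def using C1_onD(2,3)[OF Z] C1_onD(2,3)[OF psi]
      by (intro continuous_intros) (auto intro: continuous_on_subset)
    ultimately have Dc: "continuous_on UNIV (D i)"
      using continuous_on_open_Un[OF \<Omega> oK, of "D i"] by (simp add: U)
    have dif: "(\<lambda>x. \<psi> x * Z i x) differentiable (at x) \<and> grad (\<lambda>x. \<psi> x * Z i x) x $ i = D i x" for x
    proof (cases "x \<in> \<Omega>")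
      case True
      then have d: "\<psi> differentiable (at x)" "Z i differentiable (at x)"
        using C1_onD(1)[OF psi] C1_onD(1)[OF Z] by auto
      then show ?thesis unfolding grad_mult[OF d] by (simp add: D_def)
    next
      case False
      then have x: "x \<in> - K" using K(2) by auto
      have "(\<lambda>x. 0) differentiable (at x)" by simp
      from grad_cong_open[OF oK x _ this, of "\<lambda>x. \<psi> x * Z i x"] show ?thesis
        using K(3) D0[OF x] by simp
    qed
    have "(LINT x|lborel. grad (\<lambda>x. \<psi> x * Z i x) x $ i) = 0"
      by (rule integral_partial_deriv_zero[OF _ _ K(1)]) (use dif Dc K(3) in auto)
    moreover have "integrable lborel (D i)"
      by (rule integrable_compact_support[OF Dc K(1)]) (use D0 in auto)
    ultimately show ?thesis using dif by simp
  qed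
  have eq: "\<psi> x * (\<Sum>i\<in>UNIV. grad (Z i) x $ i) + (\<Sum>i\<in>UNIV. grad \<psi> x $ i * Z i x) = (\<Sum>i\<in>UNIV. D i x)" for x
    by (simp add: D_def sum.distrib sum_distrib_left)
  show "(LINT x|lborel. \<psi> x * (\<Sum>i\<in>UNIV. grad (Z i) x $ i) + (\<Sum>i\<in>UNIV. grad \<psi> x $ i * Z i x)) = 0"
    "integrable lborel (\<lambda>x. \<psi> x * (\<Sum>i\<in>UNIV. grad (Z i) x $ i) + (\<Sum>i\<in>UNIV. grad \<psi> x $ i * Z i x))"
    unfolding eq using main by auto
qed

text \<open>With n the distance to c each summand is 1/n - (x_i - c_i)^2/n^3, and the sum is N/n -
  1/n.\<close>

lemma divergence_unit_field:
  fixes c :: "real^'n::finite"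
  assumes "x \<noteq> c"
  shows "(\<lambda>x. (x $ i - c $ i) / norm (x - c)) differentiable (at x)"
    and "(\<Sum>i\<in>UNIV. grad (\<lambda>x. (x $ i - c $ i) / norm (x - c)) x $ i) = (real CARD('n) - 1) / norm (x - c)"
proof -
  define n where "n = norm (x - c)"
  have n: "n > 0" using assms by (simp add: n_def)
  have d1: "(\<lambda>x. x $ i - c $ i) differentiable (at x)" for i
    by (intro smooth_differentiable smooth_intros)
  have inv: "(inverse has_real_derivative - (inverse n ^ 2)) (at n)"
    using DERIV_inverse[of n] n by (simp add: numeral_2_eq_2)
  have d2: "(\<lambda>x. inverse (norm (x - c))) differentiable (at x)"
    using grad_norm(1)[OF assms] n by (simp add: n_def)
  have g2: "grad (\<lambda>x. inverse (norm (x - c))) x = (- (inverse n ^ 2)) *\<^sub>R ((x - c) /\<^sub>R n)"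
    using grad_compose_1D[OF grad_norm(1)[OF assms] inv[unfolded n_def]] grad_norm(2)[OF assms] by (simp add: n_def)
  have g1: "grad (\<lambda>x. x $ i - c $ i) x = axis i 1" for i
    by (subst grad_diff[OF smooth_differentiable[OF smooth_component] smooth_differentiable[OF smooth_const]])
      (simp add: grad_component)
  have g: "grad (\<lambda>x. (x $ i - c $ i) / norm (x - c)) x $ i = 1 / n - (x $ i - c $ i)^2 / n ^ 3" for i
    unfolding divide_inverse grad_mult[OF d1 d2] g1 g2 using n
    by (simp add: n_def[symmetric] field_simps power2_eq_square power3_eq_cube)
  show "(\<lambda>x. (x $ i - c $ i) / norm (x - c)) differentiable (at x)"
    unfolding divide_inverse using d1 d2 by auto
  have "(\<Sum>i\<in>UNIV. (x $ i - c $ i)^2) = n\<^sup>2"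
    unfolding n_def power2_norm_eq_inner inner_vec_def by (simp add: power2_eq_square)
  then show "(\<Sum>i\<in>UNIV. grad (\<lambda>x. (x $ i - c $ i) / norm (x - c)) x $ i) = (real CARD('n) - 1) / norm (x - c)"
    unfolding g sum_subtractf sum_divide_distrib[symmetric] using n
    by (simp add: n_def[symmetric] diff_divide_distrib power2_eq_square power3_eq_cube)
qed

lemma C1_on_unit_field: "c \<notin> S \<Longrightarrow> C1_on S (\<lambda>x. (x $ i - c $ i) / norm (x - c))"
  unfolding divide_inverse
  by (intro C1_on_mult C1_on_smooth smooth_intros C1_on_compose[where h=inverse and h'="\<lambda>t. - (inverse t ^ Suc (Suc 0))", OF C1_on_norm] DERIV_inverse)
    (auto intro!: continuous_intros)

text \<open>At the origin the difference quotient is bounded by |h|^(p-1), which tends to 0 because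
  p > 1.\<close>

lemma abs_powr_has_derivative:
  fixes t p :: real
  assumes "p > 1"
  shows "((\<lambda>t. \<bar>t\<bar> powr p) has_real_derivative p * (\<bar>t\<bar> powr (p - 1) * sgn t)) (at t)"
proof -
  consider "t > 0" | "t < 0" | "t = 0" by linarith
  then show ?thesis
  proof cases
    case 1
    have "((\<lambda>t. t powr p) has_real_derivative p * t powr (p - 1)) (at t)"
      using 1 by (rule has_real_derivative_powr)
    then have "((\<lambda>t. \<bar>t\<bar> powr p) has_real_derivative p * t powr (p - 1)) (at t)"
      by (rule has_field_derivative_transform_within_open[where S="{0<..}"]) (use 1 in auto)
    then show ?thesis using 1 by simp
  next
    case 2
    have "((\<lambda>t. (- t) powr p) has_real_derivative p * (- t) powr (p - 1) * (- 1)) (at t)"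
      using 2 by (intro DERIV_chain2[OF has_real_derivative_powr]) (auto intro!: derivative_eq_intros)
    then have "((\<lambda>t. \<bar>t\<bar> powr p) has_real_derivative p * (- t) powr (p - 1) * (- 1)) (at t)"
      by (rule has_field_derivative_transform_within_open[where S="{..<0}"]) (use 2 in auto)
    then show ?thesis using 2 by simp
  next
    case 3
    have "((\<lambda>h. \<bar>h\<bar> powr (p - 1)) \<longlongrightarrow> \<bar>0\<bar> powr (p - 1)) (at (0::real))"
      using assms by (intro tendsto_powr' tendsto_intros) auto
    then have l: "((\<lambda>h. \<bar>h\<bar> powr (p - 1)) \<longlongrightarrow> 0) (at (0::real))" by simp
    have "\<bar>\<bar>h\<bar> powr p / h\<bar> \<le> \<bar>h\<bar> powr (p - 1)" for h :: real
      by (cases "h = 0") (auto simp: powr_diff)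
    then have "((\<lambda>h. \<bar>\<bar>h\<bar> powr p / h\<bar>) \<longlongrightarrow> 0) (at (0::real))"
      by (intro tendsto_sandwich[OF _ _ tendsto_const l] always_eventually allI) simp_all
    then have "((\<lambda>h. \<bar>h\<bar> powr p / h) \<longlongrightarrow> 0) (at (0::real))"
      by (rule tendsto_rabs_zero_cancel)
    then show ?thesis using 3 assms by (simp add: has_field_derivative_iff)
  qed
qed

lemma powr_inverse_tendsto_1:
  assumes "c > (0::real)"
  shows "((\<lambda>p. c powr (1 / p)) \<longlongrightarrow> 1) at_top"
proof -
  have "((\<lambda>p::real. 1 / p) \<longlongrightarrow> 0) at_top"
    using tendsto_inverse_0_at_top[OF filterlim_ident] by (simp add: divide_inverse)
  then have "((\<lambda>p. c powr (1 / p)) \<longlongrightarrow> c powr 0) at_top"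
    using assms by (intro tendsto_powr tendsto_const) auto
  then show ?thesis using assms by simp
qed

section \<open>Upper bound for large p\<close>

text \<open>The smoothed cone r - |x - z| has slope at most 1 and height almost r. Its energy is at
  most one volume, its mass at least another volume times the p-th power of almost r, and p-th roots
  of volumes tend to 1.\<close>

lemma first_eigenvalue_root_less:
  fixes \<Omega> :: "(real^'n::finite) set"
  assumes \<Omega>: "open \<Omega>" and r: "r > 0" "ball z r \<subseteq> \<Omega>" and b: "b > 1 / r"
  shows "eventually (\<lambda>p. first_eigenvalue p \<Omega> powr (1 / p) < b) at_top"
proof -
  have "z \<in> ball z r" using r(1) by simp
  then have ne: "\<Omega> \<noteq> {}" using r(2) by (metis empty_iff subsetD)
  have b0: "b > 0" using b r by (meson divide_pos_pos less_trans zero_less_one)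
  \<comment> \<open>On the ball of radius e around z the function loses e from the shrunken radius,
    2 e from the distance and the rounded tip, and e from \<open>soft_pos\<close>. The total 4 e is
    half of the slack between r and 1/b.\<close>
  define e where "e = (r - 1 / b) / 8"
  have e: "e > 0" using b b0 r by (simp add: e_def field_simps)
  have e8: "8 * e < r" using b0 by (simp add: e_def)
  define S where "S = r - 4 * e"
  have S: "S > 1 / b" "S > 0" using e e8 b0 by (auto simp: S_def e_def field_simps)
  define \<phi> where "\<phi> x = soft_pos e ((r - e) - sqrt ((norm (x - z))\<^sup>2 + e\<^sup>2))" for x
  define K where "K = cball z (r - e)"
  have sq: "norm (x - z) \<le> sqrt ((norm (x - z))\<^sup>2 + e\<^sup>2)" "sqrt ((norm (x - z))\<^sup>2 + e\<^sup>2) \<le> norm (x - z) + e" for x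
    using soft_abs_bounds[OF e, of "norm (x - z)"] e by (auto simp: real_le_rsqrt)
  have pos: "(norm (x - z))\<^sup>2 + e\<^sup>2 > 0" for x using e by (simp add: add_nonneg_pos)
  have s1: "smooth (\<lambda>x. (r - e) - sqrt ((norm (x - z))\<^sup>2 + e\<^sup>2))"
    by (intro smooth_intros smooth_sqrt smooth_norm_square pos)
  have out: "\<phi> x = 0" if "x \<notin> K" for x
    unfolding \<phi>_def using that e
    by (intro soft_pos_nonpos) (auto simp: K_def dist_norm norm_minus_commute intro: order_trans[OF _ sq(1)])
  have phi: "\<phi> \<in> test_functions \<Omega>"
  proof (rule test_functionsI[OF _ _ _ out])
    show "smooth \<phi>" unfolding \<phi>_def[abs_def] by (intro smooth_soft_pos s1)
    show "K \<subseteq> \<Omega>" using r e by (auto simp: K_def)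
  qed (simp add: K_def)
  have Kc: "compact K" by (simp add: K_def)
  have g0: "grad \<phi> x = 0" if "x \<notin> K" for x
    using grad_zero_outside[OF compact_imp_closed[OF Kc] out that] .
  have g1: "norm (grad \<phi> x) \<le> 1" for x
  proof -
    have d: "(sqrt has_real_derivative inverse (sqrt ((norm (x - z))\<^sup>2 + e\<^sup>2)) / 2) (at ((norm (x - z))\<^sup>2 + e\<^sup>2))"
      using pos by (intro DERIV_real_sqrt)
    have dn: "(\<lambda>x. (norm (x - z))\<^sup>2 + e\<^sup>2) differentiable (at x)"
      by (intro smooth_differentiable smooth_intros smooth_norm_square)
    have gn: "grad (\<lambda>x. (norm (x - z))\<^sup>2 + e\<^sup>2) x = 2 *\<^sub>R (x - z)"
      by (subst grad_add[OF smooth_differentiable[OF smooth_norm_square] smooth_differentiable[OF smooth_const]])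
        (simp add: grad_norm_square)
    have gs: "grad (\<lambda>x. (r - e) - sqrt ((norm (x - z))\<^sup>2 + e\<^sup>2)) x = - ((x - z) /\<^sub>R sqrt ((norm (x - z))\<^sup>2 + e\<^sup>2))"
      by (subst grad_diff[OF smooth_differentiable[OF smooth_const] smooth_differentiable[OF smooth_sqrt[OF _ pos]]])
        (auto intro!: smooth_intros smooth_norm_square simp: grad_compose_1D[OF dn d] gn)
    define Q where "Q = sqrt ((norm (x - z))\<^sup>2 + e\<^sup>2)"
    have g: "grad \<phi> x = soft_pos' e ((r - e) - Q) *\<^sub>R (- ((x - z) /\<^sub>R Q))"
      unfolding \<phi>_def[abs_def] grad_compose_1D[OF smooth_differentiable[OF s1] soft_pos_has_derivative[OF e]] gs Q_def ..
    have Q: "Q > 0" "norm (x - z) \<le> Q" using pos[of x] sq(1)[of x] by (simp_all add: Q_def)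
    have "norm (grad \<phi> x) = \<bar>soft_pos' e ((r - e) - Q)\<bar> * (norm (x - z) / Q)"
      unfolding g using Q(1) by (simp add: divide_inverse abs_mult mult.commute)
    also have "\<dots> \<le> 1"
    proof (rule mult_le_one)
      show "\<bar>soft_pos' e ((r - e) - Q)\<bar> \<le> 1" using soft_pos'_bounds[OF e, of "(r - e) - Q"] by simp
    qed (use Q in auto)
    finally show ?thesis .
  qed
  define B where "B = ball z e"
  have phiB: "\<phi> x \<ge> S" if "x \<in> B" for x
  proof -
    have "norm (x - z) \<le> e" using that by (simp add: B_def dist_norm norm_minus_commute)
    then show ?thesis
      using soft_pos_ge[OF e, of "(r - e) - sqrt ((norm (x - z))\<^sup>2 + e\<^sup>2)"] sq(2)[of x] by (simp add: \<phi>_def S_def)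
  qed
  define V where "V = measure lborel K"
  define v where "v = measure lborel B"
  have v: "v > 0" unfolding v_def B_def using content_ball_pos[OF e] by simp
  have V: "V > 0" unfolding V_def K_def using content_cball_pos[of "r - e" z] e8 e by simp
  have est: "first_eigenvalue p \<Omega> powr (1 / p) \<le> (V / v) powr (1 / p) / S" if p1: "p > 1" for p
  proof -
    have p: "p > 0" using p1 by simp
    note I = test_function_integrals[OF phi \<Omega> p]
    have "energy p \<phi> \<le> (LINT x|lborel. indicator K x)"
      unfolding energy_def
    proof (rule integral_mono[OF I(1)])
      show "norm (grad \<phi> x) powr p \<le> indicator K x" for x
        using g0[of x] g1[of x] p by (auto simp: indicator_def intro!: powr_le1)
    qed (use Kc in \<open>auto intro!: integrable_real_indicator emeasure_compact_finite borel_compact\<close>)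
    also have "\<dots> = V" by (simp add: V_def)
    finally have E: "energy p \<phi> \<le> V" .
    have "S powr p * v = (LINT x|lborel. S powr p * indicator B x)" by (simp add: v_def)
    also have "\<dots> \<le> mass p \<phi>"
      unfolding mass_def
    proof (rule integral_mono[OF _ I(2)])
      show "S powr p * indicator B x \<le> \<bar>\<phi> x\<bar> powr p" for x
        using phiB[of x] S p by (auto simp: indicator_def intro!: powr_mono2)
    qed (auto simp: B_def intro!: integrable_mult_right integrable_real_indicator emeasure_bounded_finite)
    finally have Mm: "S powr p * v \<le> mass p \<phi>" .
    have Sv: "S powr p * v > 0" using S v by simp
    have "first_eigenvalue p \<Omega> \<le> energy p \<phi> / mass p \<phi>"
      using Mm Sv by (intro first_eigenvalue_le[OF phi \<Omega> p]) simp
    also have "\<dots> \<le> V / (S powr p * v)"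
      using E Mm Sv V by (intro frac_le) auto
    finally have le: "first_eigenvalue p \<Omega> \<le> V / (S powr p * v)" .
    have "0 \<le> first_eigenvalue p \<Omega>"
      by (rule first_eigenvalue_ge[OF \<Omega> ne]) (use p1 in \<open>auto simp: energy_nonneg\<close>)
    then have "first_eigenvalue p \<Omega> powr (1 / p) \<le> (V / (S powr p * v)) powr (1 / p)"
      using le p by (intro powr_mono2) auto
    also have "\<dots> = (V / v / S powr p) powr (1 / p)" by (simp add: field_simps)
    also have "\<dots> = (V / v) powr (1 / p) / (S powr p) powr (1 / p)"
      by (rule powr_divide)
    also have "(S powr p) powr (1 / p) = S" using S p by (simp add: powr_powr)
    finally show ?thesis .
  qed
  have "((\<lambda>p. (V / v) powr (1 / p) / S) \<longlongrightarrow> 1 / S) at_top"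
    by (rule tendsto_divide[OF powr_inverse_tendsto_1 tendsto_const]) (use V v S in auto)
  moreover have "1 / S < b" using S b0 by (simp add: field_simps)
  ultimately have "eventually (\<lambda>p. (V / v) powr (1 / p) / S < b) at_top" by (rule order_tendstoD)
  with eventually_gt_at_top[of 1] show ?thesis
  proof eventually_elim
    case (elim p)
    then show ?case using est[of p] by linarith
  qed
qed

text \<open>The one-dimensional inequality behind the Hardy-type weight \<open>(\<alpha> / d)\<^sup>p\<^sup>-\<^sup>1\<close>: for large \<open>p\<close> the
  curvature term \<open>C\<close> is negligible.\<close>

lemma hardy_weight_inequality:
  fixes \<alpha> p d D C a b :: real
  assumes "0 < \<alpha>" "\<alpha> < 1" "p > 1" "0 < d" "d \<le> D" "C \<ge> 0" "(p - 1) * (1 - \<alpha>) \<ge> 1 + C * D" "a \<ge> 0" "b \<ge> 0"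
  shows "\<alpha> powr (p - 1) * D powr (- p) * a powr p - b powr p \<le>
    a powr p * ((p - 1) * \<alpha> powr (p - 1) * d powr (- p) - C * (\<alpha> powr (p - 1) * d powr (1 - p)))
    - p * a powr (p - 1) * b * (\<alpha> powr (p - 1) * d powr (1 - p))"
proof -
  \<comment> \<open>With this weight Young's inequality consumes the fraction \<alpha> of the main
    term; the fraction 1 - \<alpha> is left to pay for the curvature term and for the constant on
    the left.\<close>
  define k where "k = \<alpha> / d"
  have k: "k > 0" using assms by (simp add: k_def)
  define \<zeta> where "\<zeta> = \<alpha> powr (p - 1) * d powr (1 - p)"
  have zk: "\<zeta> = k powr (p - 1)" unfolding \<zeta>_def k_def using assms by (simp add: powr_divide powr_diff)
  have z0: "\<zeta> > 0" using k by (simp add: zk)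
  have zk1: "\<zeta> * k powr (1 - p) = 1" using k by (simp add: zk powr_add[symmetric])
  have zk2: "\<zeta> * k = \<alpha> * \<alpha> powr (p - 1) * d powr (- p)"
    unfolding \<zeta>_def k_def using assms by (simp add: powr_diff powr_minus_divide)
  have zd: "\<zeta> = d * (\<alpha> powr (p - 1) * d powr (- p))"
    unfolding \<zeta>_def using assms by (simp add: powr_diff powr_minus_divide)
  have "a powr (p - 1) * b \<le> (p - 1) / p * k * a powr p + k powr (1 - p) * b powr p / p"
    using assms k by (intro Youngs_inequality_scaled) auto
  then have "(p * \<zeta>) * (a powr (p - 1) * b) \<le> (p * \<zeta>) * ((p - 1) / p * k * a powr p + k powr (1 - p) * b powr p / p)"
    using assms z0 by (intro mult_left_mono) auto
  also have "\<dots> = (p - 1) * (\<zeta> * k) * a powr p + (\<zeta> * k powr (1 - p)) * b powr p"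
    using assms by (simp add: field_simps)
  finally have Y: "p * a powr (p - 1) * b * \<zeta> \<le> (p - 1) * (\<zeta> * k) * a powr p + b powr p"
    by (simp add: zk1 mult.assoc mult.left_commute mult.commute)
  define E where "E = \<alpha> powr (p - 1) * d powr (- p)"
  have E: "E > 0" using assms by (simp add: E_def)
  have "\<alpha> powr (p - 1) * D powr (- p) \<le> E * 1"
    unfolding E_def using assms by (auto intro!: mult_left_mono powr_mono2')
  also have "\<dots> \<le> E * ((p - 1) * (1 - \<alpha>) - C * d)"
  proof (rule mult_left_mono)
    have "C * d \<le> C * D" using assms by (intro mult_left_mono) auto
    then show "1 \<le> (p - 1) * (1 - \<alpha>) - C * d" using assms by linarith
  qed (use E in simp)
  finally have "\<alpha> powr (p - 1) * D powr (- p) * a powr p \<le> E * ((p - 1) * (1 - \<alpha>) - C * d) * a powr p"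
    by (intro mult_right_mono) auto
  also have "\<dots> = a powr p * ((p - 1) * E - C * (d * E)) - (p - 1) * (\<alpha> * E) * a powr p"
    by (simp add: algebra_simps)
  also have "d * E = \<zeta>" by (simp add: zd E_def)
  also have "\<alpha> * E = \<zeta> * k" by (simp add: zk2 E_def mult.assoc)
  finally show ?thesis using Y by (simp add: E_def \<zeta>_def[symmetric] mult.assoc)
qed

section \<open>Lower bound for large p\<close>

text \<open>\<open>dA\<close> and \<open>dB\<close> are the distances to the outer sphere and to the
  hole. The field \<open>Z\<close> is \<zeta>(d) times the unit field pointing towards the nearer of
  the two, blended by \<open>cut\<close>; testing its divergence with |\<phi>|^p reduces the claim
  to \<open>hardy_weight_inequality\<close> at each point. As dA + dB \<le> R1 - R0 + s, the smaller
  distance is at most half of this, and \<epsilon> covers the blending zone. The outer sphere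
  contributes a nonnegative curvature term, the hole one bounded by (N - 1)/R0.\<close>

lemma first_eigenvalue_annulus_ge:
  fixes j :: "'n::finite"
  assumes R: "0 < R0" "0 \<le> s" "s < R1 - R0" and \<alpha>: "0 < \<alpha>" "\<alpha> < 1" and \<epsilon>: "\<epsilon> > 0" and p: "p > 1"
    and large: "(p - 1) * (1 - \<alpha>) \<ge> 1 + (real CARD('n) - 1) / R0 * ((R1 - R0 + s) / 2 + \<epsilon>)"
  shows "\<alpha> powr (p - 1) * ((R1 - R0 + s) / 2 + \<epsilon>) powr (- p) \<le> first_eigenvalue p (eccentric_annulus j R0 R1 s)"
proof -
  define \<Omega> where "\<Omega> = eccentric_annulus j R0 R1 s"
  define D where "D = (R1 - R0 + s) / 2 + \<epsilon>"
  define C where "C = (real CARD('n) - 1) / R0"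
  define \<mu> where "\<mu> = \<alpha> powr (p - 1) * D powr (- p)"
  have C0: "C \<ge> 0" unfolding C_def using R by (intro divide_nonneg_pos) (auto simp: Suc_le_eq)
  define c where "c = s *\<^sub>R (axis j 1 :: real^'n)"
  have \<Omega>: "open \<Omega>" "\<Omega> \<noteq> {}" unfolding \<Omega>_def by (rule eccentric_annulus_open, rule eccentric_annulus_nonempty[OF R])
  have in\<Omega>: "x \<in> \<Omega> \<longleftrightarrow> norm x < R1 \<and> R0 < norm (x - c)" for x
    unfolding \<Omega>_def c_def using R by (simp add: eccentric_annulus_eq)
  define \<zeta> where "\<zeta> t = \<alpha> powr (p - 1) * t powr (1 - p)" for t
  define \<zeta>' where "\<zeta>' t = - ((p - 1) * \<alpha> powr (p - 1) * t powr (- p))" for t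
  have z0: "\<zeta> t \<ge> 0" for t by (simp add: \<zeta>_def)
  have zd: "(\<zeta> has_real_derivative \<zeta>' t) (at t)" if "t > 0" for t
  proof -
    have "(\<zeta> has_real_derivative \<alpha> powr (p - 1) * ((1 - p) * t powr (1 - p - 1))) (at t)"
      unfolding \<zeta>_def[abs_def] using that by (intro DERIV_cmult has_real_derivative_powr)
    then show ?thesis by (simp add: \<zeta>'_def algebra_simps)
  qed
  define dA where "dA x = R1 - norm (x - 0)" for x :: "real^'n"
  define dB where "dB x = norm (x - c) - R0" for x
  have dpos: "dA x > 0" "dB x > 0" if "x \<in> \<Omega>" for x using that by (auto simp: in\<Omega> dA_def dB_def)
  define f where "f x = dB x - dA x" for x
  \<comment> \<open>\<open>cut\<close> is 0 where the hole is at least as near and 1 once the outer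
    sphere is nearer by \<epsilon>.\<close>
  define cut where "cut x = step (f x / \<epsilon>)" for x
  define A where "A x = cut x * \<zeta> (dA x)" for x
  define B where "B x = (1 - cut x) * \<zeta> (dB x)" for x
  define X where "X i x = (x $ i - (0::real^'n) $ i) / norm (x - 0)" for i and x :: "real^'n"
  define Y where "Y i x = (x $ i - c $ i) / norm (x - c)" for i and x :: "real^'n"
  define Z where "Z i x = A x * X i x - B x * Y i x" for i x
  have chi: "0 \<le> cut x" "cut x \<le> 1" for x by (simp_all add: cut_def step_nonneg step_le_1)
  have c\<Omega>: "c \<notin> \<Omega>" using R by (simp add: in\<Omega>)
  \<comment> \<open>The field \<open>X\<close> is singular at the origin, which lies in \<Omega>
    when s > R0. There \<open>f\<close> is negative, so \<open>cut\<close> vanishes nearby: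
    regularity is proved off the origin and on the open set \<open>U\<close>, and these two cover
    \<Omega>.\<close>
  define \<Omega>0 where "\<Omega>0 = \<Omega> - {0}"
  have \<Omega>0: "open \<Omega>0" "0 \<notin> \<Omega>0" "c \<notin> \<Omega>0" "\<Omega>0 \<subseteq> \<Omega>"
    unfolding \<Omega>0_def using \<Omega> c\<Omega> by auto
  have cA: "C1_on \<Omega>0 dA" unfolding dA_def by (intro C1_on_diff C1_on_smooth smooth_const C1_on_norm \<Omega>0)
  have cB: "C1_on \<Omega> dB" unfolding dB_def by (intro C1_on_diff C1_on_smooth smooth_const C1_on_norm c\<Omega>)
  have cf: "C1_on \<Omega>0 f" unfolding f_def by (intro C1_on_diff cA C1_on_subset[OF cB] \<Omega>0)
  have fc: "continuous_on UNIV f" unfolding f_def dA_def dB_def by (intro continuous_intros)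
  have zc: "continuous_on S (\<lambda>x. \<zeta>' (d x))" if "continuous_on S d" "\<And>x. x \<in> S \<Longrightarrow> d x > 0" for S and d :: "real^'n \<Rightarrow> real"
    unfolding \<zeta>'_def using that(2) by (intro continuous_intros that(1)) force
  have czA: "C1_on \<Omega>0 (\<lambda>x. \<zeta> (dA x))"
    by (rule C1_on_compose[OF cA zd zc]) (use dpos \<Omega>0 C1_onD(3)[OF cA] in auto)
  have czB: "C1_on \<Omega> (\<lambda>x. \<zeta> (dB x))"
    by (rule C1_on_compose[OF cB zd zc]) (use dpos C1_onD(3)[OF cB] in auto)
  have step_scaled: "((\<lambda>t. step (t / \<epsilon>)) has_real_derivative step' (t / \<epsilon>) / \<epsilon>) (at t)" for t
    using DERIV_chain2[OF step_has_derivative, of "\<lambda>t. t / \<epsilon>" "1 / \<epsilon>" t UNIV] by (simp add: DERIV_cdivide[OF DERIV_ident])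
  have cchi: "C1_on \<Omega>0 cut"
    unfolding cut_def
    by (rule C1_on_compose[OF cf, where h="\<lambda>t. step (t / \<epsilon>)", OF step_scaled])
      (use \<epsilon> C1_onD(3)[OF cf] in \<open>auto intro!: continuous_intros continuous_on_compose2[OF continuous_step'[of UNIV]]\<close>)
  have cX: "C1_on \<Omega>0 (X i)" for i unfolding X_def by (intro C1_on_unit_field \<Omega>0)
  have cY: "C1_on \<Omega> (Y i)" for i unfolding Y_def by (intro C1_on_unit_field c\<Omega>)
  have cA': "C1_on \<Omega>0 A" unfolding A_def by (intro C1_on_mult cchi czA)
  have cB': "C1_on \<Omega>0 B" unfolding B_def
    by (intro C1_on_mult C1_on_diff C1_on_smooth smooth_const cchi C1_on_subset[OF czB] \<Omega>0)
  define U where "U = \<Omega> \<inter> {x. f x < 0}"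
  have U: "open U" "U \<subseteq> \<Omega>" unfolding U_def using \<Omega>(1) fc by (auto intro!: open_Int open_Collect_less)
  have ZU: "Z i x = - (\<zeta> (dB x) * Y i x)" if "x \<in> U" for i x
  proof -
    have "cut x = 0" unfolding cut_def using that \<epsilon> by (intro step_eq_0) (simp add: U_def divide_le_0_iff)
    then show ?thesis by (simp add: Z_def A_def B_def)
  qed
  have cU: "C1_on U (\<lambda>x. - 1 * (\<zeta> (dB x) * Y i x))" for i
    by (intro C1_on_mult C1_on_smooth smooth_const C1_on_subset[OF czB] C1_on_subset[OF cY] U)
  have cover: "\<Omega> = \<Omega>0 \<union> U"
  proof -
    have "f 0 < 0" using R by (simp add: f_def dA_def dB_def c_def norm_axis_1)
    then show ?thesis using U by (auto simp: \<Omega>0_def U_def)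
  qed
  have cZ: "C1_on \<Omega> (Z i)" for i
    unfolding cover
  proof (rule C1_on_Un[OF _ _ \<Omega>0(1) U(1)])
    show "C1_on \<Omega>0 (Z i)" unfolding Z_def
      by (intro C1_on_diff C1_on_mult cA' cB' cX C1_on_subset[OF cY] \<Omega>0)
    show "C1_on U (Z i)" by (rule C1_on_cong_open[OF cU[of i] U(1)]) (simp add: ZU)
  qed
  define ux where "ux x = x /\<^sub>R norm x" for x :: "real^'n"
  define uy where "uy x = (x - c) /\<^sub>R norm (x - c)" for x
  have Xu: "X i x = ux x $ i" and Yu: "Y i x = uy x $ i" for i x
    by (simp_all add: X_def Y_def ux_def uy_def divide_inverse mult.commute)
  have uxy: "norm (ux x) \<le> 1" "norm (uy x) \<le> 1" for x
    by (cases "x = 0"; cases "x = c"; simp add: ux_def uy_def)+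
  have uxx: "ux x \<bullet> ux x = 1" if "x \<noteq> 0" for x
    using that by (simp add: ux_def dot_square_norm power2_eq_square)
  have uyy: "uy x \<bullet> uy x = 1" if "x \<noteq> c" for x
    using that by (simp add: uy_def dot_square_norm power2_eq_square)
  have gdB: "grad dB x = uy x" if "x \<noteq> c" for x
    unfolding dB_def uy_def using grad_norm[OF that]
    by (subst grad_diff) (auto simp: divide_inverse)
  have gdA: "grad dA x = - ux x" if "x \<noteq> 0" for x
    unfolding dA_def ux_def using grad_norm[of x 0] that
    by (subst grad_diff) auto
  have gzB: "grad (\<lambda>x. \<zeta> (dB x)) x = \<zeta>' (dB x) *\<^sub>R uy x" if "x \<in> \<Omega>" for x
  proof -
    have "x \<noteq> c" using that c\<Omega> by metis
    then show ?thesis using grad_compose_1D[OF C1_onD(1)[OF cB that] zd[OF dpos(2)[OF that]]] gdB by simp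
  qed
  have gzA: "grad (\<lambda>x. \<zeta> (dA x)) x = - \<zeta>' (dA x) *\<^sub>R ux x" if "x \<in> \<Omega>0" for x
  proof -
    have "x \<noteq> 0" "x \<in> \<Omega>" using that \<Omega>0(2,4) by (metis, blast)
    then show ?thesis using grad_compose_1D[OF C1_onD(1)[OF cA that] zd[OF dpos(1)]] gdA by simp
  qed
  have div: "(\<Sum>i\<in>UNIV. grad (Z i) x $ i) \<ge> cut x * (- \<zeta>' (dA x)) + (1 - cut x) * (- \<zeta>' (dB x) - C * \<zeta> (dB x))"
    if x: "x \<in> \<Omega>" for x
  proof -
    have xc: "x \<noteq> c" using x c\<Omega> by auto
    have nB: "0 \<le> (real CARD('n) - 1) / norm (x - c)" "(real CARD('n) - 1) / norm (x - c) \<le> C"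
      unfolding C_def using x R by (auto simp: in\<Omega> Suc_le_eq intro!: divide_left_mono divide_nonneg_nonneg mult_pos_pos)
    have divY: "(\<Sum>i\<in>UNIV. grad (Y i) x $ i) = (real CARD('n) - 1) / norm (x - c)"
      unfolding Y_def by (rule divergence_unit_field(2)[OF xc])
    show ?thesis
    proof (cases "x \<in> U")
      case True
      have chi0: "cut x = 0" unfolding cut_def using True \<epsilon> by (intro step_eq_0) (simp add: U_def divide_le_0_iff)
      have "grad (Z i) x = - (\<zeta> (dB x) *\<^sub>R grad (Y i) x + Y i x *\<^sub>R (\<zeta>' (dB x) *\<^sub>R uy x))" for i
      proof -
        have d: "(\<lambda>x. \<zeta> (dB x)) differentiable (at x)" "Y i differentiable (at x)"
          using C1_onD(1)[OF czB x] C1_onD(1)[OF cY x] by auto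
        have "grad (Z i) x = grad (\<lambda>x. - 1 * (\<zeta> (dB x) * Y i x)) x"
          by (rule grad_cong_open(1)[OF U(1) True]) (use C1_onD(1)[OF cU True] ZU in auto)
        also have "\<dots> = - 1 *\<^sub>R grad (\<lambda>x. \<zeta> (dB x) * Y i x) x"
          by (rule grad_scale) (use d in auto)
        also have "grad (\<lambda>x. \<zeta> (dB x) * Y i x) x = \<zeta> (dB x) *\<^sub>R grad (Y i) x + Y i x *\<^sub>R (\<zeta>' (dB x) *\<^sub>R uy x)"
          unfolding grad_mult[OF d] gzB[OF x] ..
        finally show ?thesis by simp
      qed
      then have "(\<Sum>i\<in>UNIV. grad (Z i) x $ i) = (\<Sum>i\<in>UNIV. - (\<zeta> (dB x) * grad (Y i) x $ i) - \<zeta>' (dB x) * (uy x $ i * uy x $ i))"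
        by (intro sum.cong) (auto simp: Yu)
      also have "\<dots> = - (\<zeta> (dB x) * (\<Sum>i\<in>UNIV. grad (Y i) x $ i)) - \<zeta>' (dB x) * (uy x \<bullet> uy x)"
        by (simp add: sum_subtractf sum_negf sum_distrib_left inner_vec_def)
      finally have "(\<Sum>i\<in>UNIV. grad (Z i) x $ i) = - (\<zeta> (dB x) * ((real CARD('n) - 1) / norm (x - c))) - \<zeta>' (dB x)"
        unfolding divY uyy[OF xc] by simp
      then show ?thesis using mult_left_mono[OF nB(2) z0[of "dB x"]] by (simp add: chi0 mult.commute)
    next
      case False
      then have x0: "x \<in> \<Omega>0" using x cover by auto
      then have xn0: "x \<noteq> 0" using \<Omega>0 by auto
      define h where "h = step' (f x / \<epsilon>) / \<epsilon>"
      have h: "h \<ge> 0" unfolding h_def using \<epsilon> step'_nonneg by simp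
      have gf: "grad f x = ux x + uy x"
        unfolding f_def using grad_diff[OF C1_onD(1)[OF cB x] C1_onD(1)[OF cA x0]] gdA[OF xn0] gdB[OF xc] by simp
      have gchi: "grad cut x = h *\<^sub>R (ux x + uy x)"
        unfolding cut_def using grad_compose_1D[OF C1_onD(1)[OF cf x0] step_scaled] gf by (simp add: h_def)
      have gA: "grad A x = cut x *\<^sub>R (- \<zeta>' (dA x) *\<^sub>R ux x) + \<zeta> (dA x) *\<^sub>R (h *\<^sub>R (ux x + uy x))"
        unfolding A_def using grad_mult[OF C1_onD(1)[OF cchi x0] C1_onD(1)[OF czA x0]] gchi gzA[OF x0] by simp
      have g1chi: "grad (\<lambda>x. 1 - cut x) x = - (h *\<^sub>R (ux x + uy x))" "(\<lambda>x. 1 - cut x) differentiable (at x)"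
        using grad_diff[of "\<lambda>x. 1" x cut] C1_onD(1)[OF cchi x0] gchi by auto
      have gB: "grad B x = (1 - cut x) *\<^sub>R (\<zeta>' (dB x) *\<^sub>R uy x) - \<zeta> (dB x) *\<^sub>R (h *\<^sub>R (ux x + uy x))"
        unfolding B_def using grad_mult[OF g1chi(2) C1_onD(1)[OF czB x]] g1chi(1) gzB[OF x] by simp
      have divX: "(\<Sum>i\<in>UNIV. grad (X i) x $ i) = (real CARD('n) - 1) / norm x"
        unfolding X_def using divergence_unit_field(2)[OF xn0] by simp
      have gZ: "grad (Z i) x $ i = A x * grad (X i) x $ i + ux x $ i * grad A x $ i
          - (B x * grad (Y i) x $ i + uy x $ i * grad B x $ i)" for i
      proof -
        have d: "A differentiable (at x)" "B differentiable (at x)" "X i differentiable (at x)" "Y i differentiable (at x)"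
          using C1_onD(1)[OF cA' x0] C1_onD(1)[OF cB' x0] C1_onD(1)[OF cX x0] C1_onD(1)[OF cY x] by auto
        have "grad (Z i) x = (A x *\<^sub>R grad (X i) x + X i x *\<^sub>R grad A x) - (B x *\<^sub>R grad (Y i) x + Y i x *\<^sub>R grad B x)"
          unfolding Z_def[abs_def] grad_mult[OF d(1,3), symmetric] grad_mult[OF d(2,4), symmetric]
          by (rule grad_diff) (use d in auto)
        then show ?thesis by (simp add: Xu Yu)
      qed
      have "(\<Sum>i\<in>UNIV. grad (Z i) x $ i) = A x * (\<Sum>i\<in>UNIV. grad (X i) x $ i) + ux x \<bullet> grad A x
          - (B x * (\<Sum>i\<in>UNIV. grad (Y i) x $ i) + uy x \<bullet> grad B x)"
        unfolding gZ by (simp add: sum_subtractf sum.distrib sum_distrib_left inner_vec_def)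
      also have "ux x \<bullet> grad A x = - (cut x * \<zeta>' (dA x)) + \<zeta> (dA x) * (h * (1 + ux x \<bullet> uy x))"
        unfolding gA using uxx[OF xn0] by (simp add: inner_add_right inner_diff_right)
      also have "uy x \<bullet> grad B x = (1 - cut x) * \<zeta>' (dB x) - \<zeta> (dB x) * (h * (1 + ux x \<bullet> uy x))"
        unfolding gB using uyy[OF xc] by (simp add: inner_add_right inner_diff_right inner_commute add.commute)
      finally have eq: "(\<Sum>i\<in>UNIV. grad (Z i) x $ i) = A x * ((real CARD('n) - 1) / norm x) - cut x * \<zeta>' (dA x)
          + \<zeta> (dA x) * (h * (1 + ux x \<bullet> uy x)) - B x * ((real CARD('n) - 1) / norm (x - c))
          - (1 - cut x) * \<zeta>' (dB x) + \<zeta> (dB x) * (h * (1 + ux x \<bullet> uy x))"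
        unfolding divX divY by simp
      \<comment> \<open>The gradient of \<open>cut\<close>, paired with the two unit fields,
        produces the factor 1 + ux . uy, nonnegative by Cauchy-Schwarz: blending only adds to the
        divergence.\<close>
      have "\<bar>ux x \<bullet> uy x\<bar> \<le> norm (ux x) * norm (uy x)" by (rule Cauchy_Schwarz_ineq2)
      also have "\<dots> \<le> 1" using uxy[of x] by (intro mult_le_one) auto
      finally have n: "h * (1 + ux x \<bullet> uy x) \<ge> 0" using h by (intro mult_nonneg_nonneg) auto
      have t1: "\<zeta> (dA x) * (h * (1 + ux x \<bullet> uy x)) \<ge> 0" "\<zeta> (dB x) * (h * (1 + ux x \<bullet> uy x)) \<ge> 0"
        using n z0 by auto
      have t2: "A x * ((real CARD('n) - 1) / norm x) \<ge> 0"
        unfolding A_def using chi z0 by (intro mult_nonneg_nonneg divide_nonneg_nonneg) (auto simp: Suc_le_eq)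
      have t3: "B x * ((real CARD('n) - 1) / norm (x - c)) \<le> (1 - cut x) * (C * \<zeta> (dB x))"
      proof -
        have "B x * ((real CARD('n) - 1) / norm (x - c)) \<le> B x * C"
          unfolding B_def using nB chi z0 by (intro mult_left_mono) auto
        then show ?thesis by (simp add: B_def mult_ac)
      qed
      show ?thesis unfolding eq using t1 t2 t3 by (simp add: algebra_simps)
    qed
  qed
  have "\<mu> \<le> first_eigenvalue p \<Omega>"
  proof (rule first_eigenvalue_ge[OF \<Omega>])
    show "p \<ge> 1" using p by simp
    show "\<mu> \<ge> 0" by (simp add: \<mu>_def)
    fix \<phi> assume phi: "\<phi> \<in> test_functions \<Omega>"
    obtain K where K: "smooth \<phi>" "compact K" "K \<subseteq> \<Omega>" "\<And>x. x \<notin> K \<Longrightarrow> \<phi> x = 0"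
      using phi by (auto elim: test_functionsE)
    have g0: "grad \<phi> x = 0" if "x \<notin> K" for x
      using grad_zero_outside[OF compact_imp_closed[OF K(2)] K(4) that] .
    have p0: "p > 0" using p by simp
    note I = test_function_integrals[OF phi \<Omega>(1) p0]
    \<comment> \<open>Continuously differentiable because p > 1; the pairing of its gradient with
      \<open>Z\<close> becomes the mixed term of the Hardy-type inequality.\<close>
    define \<psi> where "\<psi> x = \<bar>\<phi> x\<bar> powr p" for x
    have cpsi: "C1_on UNIV \<psi>"
      unfolding \<psi>_def
    proof (rule C1_on_compose[OF C1_on_smooth[OF K(1)] abs_powr_has_derivative[OF p]])
      have "continuous_on UNIV (\<lambda>t::real. \<bar>t\<bar> powr (p - 1) * sgn t)"
        unfolding continuous_on_eq_continuous_at[OF open_UNIV]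
      proof
        fix t :: real
        consider "t > 0" | "t < 0" | "t = 0" by linarith
        then show "isCont (\<lambda>t. \<bar>t\<bar> powr (p - 1) * sgn t) t"
        proof cases
          case 3
          have "((\<lambda>h. \<bar>h\<bar> powr (p - 1)) \<longlongrightarrow> \<bar>0\<bar> powr (p - 1)) (at (0::real))"
            using p by (intro tendsto_powr' tendsto_intros) auto
          then have l: "((\<lambda>h. \<bar>h\<bar> powr (p - 1)) \<longlongrightarrow> 0) (at (0::real))" by simp
          have "((\<lambda>h. \<bar>\<bar>h\<bar> powr (p - 1) * sgn h\<bar>) \<longlongrightarrow> 0) (at (0::real))"
            by (rule tendsto_sandwich[OF _ _ tendsto_const l]) (auto simp: abs_mult abs_sgn_eq)
          then have "((\<lambda>h. \<bar>h\<bar> powr (p - 1) * sgn h) \<longlongrightarrow> 0) (at (0::real))"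
            by (rule tendsto_rabs_zero_cancel)
          then show ?thesis using 3 by (simp add: isCont_def)
        qed (auto intro!: continuous_intros)
      qed
      from continuous_on_compose2[OF this smooth_continuous_on[OF K(1)]]
      have "continuous_on UNIV (\<lambda>x. \<bar>\<phi> x\<bar> powr (p - 1) * sgn (\<phi> x))" by simp
      then show "continuous_on UNIV (\<lambda>x. p * (\<bar>\<phi> x\<bar> powr (p - 1) * sgn (\<phi> x)))"
        by (rule continuous_on_mult_left)
    qed
    have gpsi: "grad \<psi> x = (p * (\<bar>\<phi> x\<bar> powr (p - 1) * sgn (\<phi> x))) *\<^sub>R grad \<phi> x" for x
      unfolding \<psi>_def by (rule grad_compose_1D[OF smooth_differentiable[OF K(1)] abs_powr_has_derivative[OF p]])
    note ID = integral_divergence[OF \<Omega>(1) cpsi K(2,3) _ cZ]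
    define F where "F x = \<psi> x * (\<Sum>i\<in>UNIV. grad (Z i) x $ i) + (\<Sum>i\<in>UNIV. grad \<psi> x $ i * Z i x)" for x
    have F: "(LINT x|lborel. F x) = 0" "integrable lborel F"
      unfolding F_def using ID K(4) p by (auto simp: \<psi>_def)
    have pointwise: "\<mu> * \<bar>\<phi> x\<bar> powr p - norm (grad \<phi> x) powr p \<le> F x" for x
    proof (cases "x \<in> K")
      case False
      then show ?thesis using K(4) g0 p by (simp add: F_def \<psi>_def gpsi)
    next
      case True
      then have x: "x \<in> \<Omega>" using K by auto
      define a where "a = \<bar>\<phi> x\<bar>"
      define b where "b = norm (grad \<phi> x)"
      have ab: "a \<ge> 0" "b \<ge> 0" by (simp_all add: a_def b_def)
      define Q where "Q = p * (a powr (p - 1) * b)"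
      have "(\<Sum>i\<in>UNIV. grad \<psi> x $ i * Z i x) = A x * (grad \<psi> x \<bullet> ux x) - B x * (grad \<psi> x \<bullet> uy x)"
        by (simp add: Z_def Xu Yu inner_vec_def sum_distrib_left sum_subtractf[symmetric] algebra_simps)
      moreover have gb: "\<bar>grad \<psi> x \<bullet> v\<bar> \<le> Q" if "norm v \<le> 1" for v
      proof -
        have "norm (grad \<psi> x) \<le> Q"
          unfolding gpsi Q_def a_def b_def using p
          by (simp add: abs_mult abs_sgn_eq)
        then have "norm (grad \<psi> x) * norm v \<le> Q * 1" using that by (intro mult_mono) (auto intro: order_trans[OF norm_ge_zero])
        with Cauchy_Schwarz_ineq2[of "grad \<psi> x" v] show ?thesis by simp
      qed
      moreover have AB: "A x \<ge> 0" "B x \<ge> 0" using chi z0 by (simp_all add: A_def B_def)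
      moreover have "A x * (grad \<psi> x \<bullet> ux x) \<ge> A x * (- Q)" "B x * (grad \<psi> x \<bullet> uy x) \<le> B x * Q"
        using gb[OF uxy(1)[of x]] gb[OF uxy(2)[of x]] AB
          mult_left_mono[of "- Q" "grad \<psi> x \<bullet> ux x" "A x"] mult_left_mono[of "grad \<psi> x \<bullet> uy x" Q "B x"] by simp_all
      ultimately have g: "(\<Sum>i\<in>UNIV. grad \<psi> x $ i * Z i x) \<ge> - (cut x * (Q * \<zeta> (dA x))) - (1 - cut x) * (Q * \<zeta> (dB x))"
        by (simp add: A_def B_def algebra_simps)
      have psi_eq: "\<psi> x = a powr p" by (simp add: \<psi>_def a_def)
      have "\<psi> x * (cut x * (- \<zeta>' (dA x)) + (1 - cut x) * (- \<zeta>' (dB x) - C * \<zeta> (dB x))) \<le> \<psi> x * (\<Sum>i\<in>UNIV. grad (Z i) x $ i)"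
        using div[OF x] by (intro mult_left_mono) (auto simp: psi_eq)
      then have low: "cut x * (a powr p * (- \<zeta>' (dA x)) - Q * \<zeta> (dA x))
          + (1 - cut x) * (a powr p * (- \<zeta>' (dB x) - C * \<zeta> (dB x)) - Q * \<zeta> (dB x)) \<le> F x"
        unfolding F_def using g by (simp add: psi_eq algebra_simps)
      \<comment> \<open>Where \<open>cut\<close> is positive this bounds \<open>dA\<close> by half
        of the right side; where \<open>cut\<close> is below 1 it bounds \<open>dB\<close> by half
        of it plus \<epsilon>/2. Both are at most \<open>D\<close>.\<close>
      have sum_d: "dA x + dB x \<le> R1 - R0 + s"
        using norm_triangle_ineq4[of x c] R by (simp add: dA_def dB_def c_def norm_axis_1)
      have tA: "cut x * (\<mu> * a powr p - b powr p) \<le> cut x * (a powr p * (- \<zeta>' (dA x)) - Q * \<zeta> (dA x))"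
      proof (cases "cut x = 0")
        case False
        then have "f x > 0" using step_eq_0[of "f x / \<epsilon>"] \<epsilon> by (force simp: cut_def divide_le_0_iff not_less)
        then have dAD: "dA x \<le> D" using sum_d \<epsilon> by (simp add: f_def D_def field_simps)
        have "\<mu> * a powr p - b powr p \<le> a powr p * (- \<zeta>' (dA x) - C * \<zeta> (dA x)) - Q * \<zeta> (dA x)"
          using hardy_weight_inequality[OF \<alpha> p dpos(1)[OF x] dAD C0 _ ab] large
          by (simp add: \<mu>_def \<zeta>_def \<zeta>'_def Q_def C_def D_def mult.assoc)
        also have "\<dots> \<le> a powr p * (- \<zeta>' (dA x)) - Q * \<zeta> (dA x)"
          using C0 z0[of "dA x"] by (intro diff_right_mono mult_left_mono) auto
        finally show ?thesis using chi by (intro mult_left_mono) auto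
      qed simp
      have tB: "(1 - cut x) * (\<mu> * a powr p - b powr p) \<le> (1 - cut x) * (a powr p * (- \<zeta>' (dB x) - C * \<zeta> (dB x)) - Q * \<zeta> (dB x))"
      proof (cases "cut x = 1")
        case False
        then have "f x / \<epsilon> < 1" using step_eq_1[of "f x / \<epsilon>"] by (force simp: cut_def not_less)
        then have "f x < \<epsilon>" using \<epsilon> by (simp add: field_simps)
        then have dBD: "dB x \<le> D" using sum_d \<epsilon> by (simp add: f_def D_def field_simps)
        have "\<mu> * a powr p - b powr p \<le> a powr p * (- \<zeta>' (dB x) - C * \<zeta> (dB x)) - Q * \<zeta> (dB x)"
          using hardy_weight_inequality[OF \<alpha> p dpos(2)[OF x] dBD C0 _ ab] large
          by (simp add: \<mu>_def \<zeta>_def \<zeta>'_def Q_def C_def D_def mult.assoc)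
        then show ?thesis using chi by (intro mult_left_mono) auto
      qed simp
      have "\<mu> * a powr p - b powr p = cut x * (\<mu> * a powr p - b powr p) + (1 - cut x) * (\<mu> * a powr p - b powr p)"
        by (simp add: algebra_simps)
      also have "\<dots> \<le> F x" using tA tB low by linarith
      finally show ?thesis by (simp add: a_def b_def)
    qed
    have "(LINT x|lborel. \<mu> * \<bar>\<phi> x\<bar> powr p - norm (grad \<phi> x) powr p) \<le> (LINT x|lborel. F x)"
      using I(1,2) F(2) pointwise by (intro integral_mono) auto
    then show "\<mu> * mass p \<phi> \<le> energy p \<phi>"
      using I(1,2) F(1) by (simp add: mass_def energy_def)
  qed
  then show ?thesis by (simp add: \<mu>_def D_def \<Omega>_def)
qed

section \<open>The concentric annulus and the cusp\<close>

text \<open>The divergence of x - c is N. For a cut-off that is radial about c the left side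
  controls the total variation, so areas of spheres enter as N times a volume over a radius.\<close>

lemma integral_grad_radial:
  fixes \<psi> :: "real^'n::finite \<Rightarrow> real"
  assumes "smooth \<psi>" "compact K" "\<And>x. x \<notin> K \<Longrightarrow> \<psi> x = 0"
  shows "(LINT x|lborel. grad \<psi> x \<bullet> (x - c)) = - (real CARD('n) * (LINT x|lborel. \<psi> x))"
    and "integrable lborel (\<lambda>x. grad \<psi> x \<bullet> (x - c))"
proof -
  have g1: "grad (\<lambda>x. x $ i - c $ i) x = axis i 1" for i x
    by (subst grad_diff[OF smooth_differentiable[OF smooth_component] smooth_differentiable[OF smooth_const]])
      (simp add: grad_component)
  have g0: "grad \<psi> x = 0" if "x \<notin> K" for x
    using grad_zero_outside[OF compact_imp_closed[OF assms(2)] assms(3) that] .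
  have i1: "integrable lborel \<psi>"
    by (rule integrable_compact_support[OF smooth_continuous_on[OF assms(1)] assms(2,3)])
  show i2: "integrable lborel (\<lambda>x. grad \<psi> x \<bullet> (x - c))"
    by (rule integrable_compact_support[OF _ assms(2)])
      (auto intro!: continuous_intros smooth_continuous_grad assms(1) simp: g0)
  have "(LINT x|lborel. \<psi> x * (\<Sum>i\<in>UNIV. grad (\<lambda>x. x $ i - c $ i) x $ i) + (\<Sum>i\<in>UNIV. grad \<psi> x $ i * (x $ i - c $ i))) = 0"
    by (rule integral_divergence(1)[OF open_UNIV C1_on_smooth[OF assms(1)] assms(2) _ assms(3)])
      (auto intro!: C1_on_smooth smooth_intros)
  moreover have "\<psi> x * (\<Sum>i\<in>UNIV. grad (\<lambda>x. x $ i - c $ i) x $ i) + (\<Sum>i\<in>UNIV. grad \<psi> x $ i * (x $ i - c $ i))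
      = real CARD('n) * \<psi> x + grad \<psi> x \<bullet> (x - c)" for x
    unfolding g1 by (simp add: inner_vec_def)
  ultimately show "(LINT x|lborel. grad \<psi> x \<bullet> (x - c)) = - (real CARD('n) * (LINT x|lborel. \<psi> x))"
    using i1 i2 by simp
qed

lemma integral_by_parts_component:
  fixes \<psi> \<eta> :: "real^'n::finite \<Rightarrow> real"
  assumes "smooth \<psi>" "smooth \<eta>" "compact K" "\<And>x. x \<notin> K \<Longrightarrow> \<psi> x = 0"
  shows "(LINT x|lborel. grad \<psi> x $ j * \<eta> x) = - (LINT x|lborel. \<psi> x * grad \<eta> x $ j)"
    and "integrable lborel (\<lambda>x. grad \<psi> x $ j * \<eta> x)" "integrable lborel (\<lambda>x. \<psi> x * grad \<eta> x $ j)"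
proof -
  have g0: "grad \<psi> x = 0" if "x \<notin> K" for x
    using grad_zero_outside[OF compact_imp_closed[OF assms(3)] assms(4) that] .
  have c: "continuous_on UNIV \<psi>" "continuous_on UNIV \<eta>" "continuous_on UNIV (grad \<psi>)" "continuous_on UNIV (grad \<eta>)"
    using assms by (auto intro!: smooth_continuous_on smooth_continuous_grad)
  show i1: "integrable lborel (\<lambda>x. grad \<psi> x $ j * \<eta> x)" and i2: "integrable lborel (\<lambda>x. \<psi> x * grad \<eta> x $ j)"
    by (rule integrable_compact_support[OF _ assms(3)]; auto intro!: continuous_intros c simp: g0 assms(4))+
  have g: "grad (\<lambda>x. \<psi> x * \<eta> x) x $ j = \<psi> x * grad \<eta> x $ j + grad \<psi> x $ j * \<eta> x" for x
    using grad_mult[OF smooth_differentiable[OF assms(1)] smooth_differentiable[OF assms(2)], of x] by (simp add: mult.commute)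
  have "(LINT x|lborel. grad (\<lambda>x. \<psi> x * \<eta> x) x $ j) = 0"
    by (rule integral_partial_deriv_zero[OF _ _ assms(3)])
      (auto intro!: smooth_differentiable smooth_intros assms(1,2) continuous_intros c simp: g assms(4))
  then show "(LINT x|lborel. grad \<psi> x $ j * \<eta> x) = - (LINT x|lborel. \<psi> x * grad \<eta> x $ j)"
    unfolding g using i1 i2 by simp
qed

text \<open>The concentric annulus is its own Cheeger set: the field \<open>(a - b |x|\<^sup>-\<^sup>N) x\<close> has constant
  divergence, is bounded by 1, and is the outer unit normal on both spheres.\<close>

lemma cheeger_annulus_0_ge:
  fixes j :: "'n::finite"
  assumes "0 < R0" "R0 < R1"
  shows "real CARD('n) * ((R1 ^ (CARD('n) - 1) + R0 ^ (CARD('n) - 1)) / (R1 ^ CARD('n) - R0 ^ CARD('n)))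
    \<le> cheeger (eccentric_annulus j R0 R1 0)"
proof -
  define N where "N = CARD('n)"
  have N: "N > 0" by (simp add: N_def)
  \<comment> \<open>Chosen so that a r - b r^(1-N), the radial component of the calibrating field,
    is -1 at R0 and 1 at R1; the two expressions for \<open>b\<close> are these two
    conditions.\<close>
  define a where "a = (R1 ^ (N - 1) + R0 ^ (N - 1)) / (R1 ^ N - R0 ^ N)"
  define b where "b = a * R0 ^ N + R0 ^ (N - 1)"
  have RN: "R0 ^ N < R1 ^ N" using assms N by (intro power_strict_mono) auto
  have a0: "a > 0" unfolding a_def using RN assms by (intro divide_pos_pos add_pos_pos) auto
  have b0: "b > 0" unfolding b_def using a0 assms by (intro add_pos_pos mult_pos_pos) auto
  have "a * (R1 ^ N - R0 ^ N) = R1 ^ (N - 1) + R0 ^ (N - 1)" unfolding a_def using RN by simp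
  then have b1: "b = a * R1 ^ N - R1 ^ (N - 1)" by (simp add: b_def algebra_simps)
  have pw: "r ^ N = r * r ^ (N - 1)" for r :: real using N by (cases N) auto
  define \<Omega> where "\<Omega> = eccentric_annulus j R0 R1 0"
  have in\<Omega>: "x \<in> \<Omega> \<longleftrightarrow> norm x < R1 \<and> R0 < norm x" for x
    unfolding \<Omega>_def using assms by (simp add: eccentric_annulus_eq)
  have \<Omega>: "open \<Omega>" "\<Omega> \<noteq> {}" unfolding \<Omega>_def using eccentric_annulus_nonempty[OF assms(1), of 0 R1 j] assms(2) by (simp_all add: eccentric_annulus_open)
  define h where "h r = a - b * inverse r ^ N" for r :: real
  have hd: "(h has_real_derivative b * real N * inverse r ^ (N + 1)) (at r)" if "r > 0" for r
  proof -
    have "(h has_real_derivative - (b * (real N * (- (inverse r ^ Suc (Suc 0)) * inverse r ^ (N - 1))))) (at r)"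
      unfolding h_def[abs_def] using that by (auto intro!: derivative_eq_intros DERIV_power[OF DERIV_inverse])
    moreover have "inverse r ^ Suc (Suc 0) * inverse r ^ (N - 1) = inverse r ^ (N + 1)"
      unfolding power_add[symmetric] using N by simp
    ultimately show ?thesis using that by (simp add: mult.assoc)
  qed
  have nz: "0 \<notin> \<Omega>" using assms by (simp add: in\<Omega>)
  have ch: "C1_on \<Omega> (\<lambda>x. h (norm (x - 0)))"
    by (rule C1_on_compose[OF C1_on_norm[OF nz] hd])
      (use assms nz in \<open>auto intro!: continuous_intros simp: in\<Omega>\<close>)
  define Z where "Z i x = h (norm (x - 0)) * x $ i" for i and x :: "real^'n"
  have cZ: "C1_on \<Omega> (Z i)" for i unfolding Z_def by (intro C1_on_mult ch C1_on_smooth smooth_intros)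
  have div: "(\<Sum>i\<in>UNIV. grad (Z i) x $ i) = real N * a" if x: "x \<in> \<Omega>" for x
  proof -
    define r where "r = norm x"
    have r: "r > 0" using x assms(1) unfolding in\<Omega> r_def by linarith
    have "grad (\<lambda>x. h (norm (x - 0))) x = (b * real N * inverse r ^ (N + 1)) *\<^sub>R ((x - 0) /\<^sub>R norm (x - 0))"
      using grad_compose_1D[OF grad_norm(1) hd, of x 0] grad_norm(2)[of x 0] r by (simp add: r_def)
    then have gh: "grad (\<lambda>x. h (norm (x - 0))) x = (b * real N * inverse r ^ (N + 1) * inverse r) *\<^sub>R x"
      by (simp add: r_def)
    have "grad (Z i) x $ i = h r + (b * real N * inverse r ^ (N + 1) * inverse r) * (x $ i)\<^sup>2" for i
      unfolding Z_def grad_mult[OF C1_onD(1)[OF ch x] smooth_differentiable[OF smooth_component]] gh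
      by (simp add: grad_component r_def power2_eq_square)
    then have "(\<Sum>i\<in>UNIV. grad (Z i) x $ i) = real N * h r + (b * real N * inverse r ^ (N + 1) * inverse r) * (\<Sum>i\<in>UNIV. (x $ i)\<^sup>2)"
      by (simp add: sum.distrib sum_distrib_left N_def)
    also have "(\<Sum>i\<in>UNIV. (x $ i)\<^sup>2) = r\<^sup>2"
      unfolding r_def power2_norm_eq_inner inner_vec_def by (simp add: power2_eq_square)
    also have "real N * h r + (b * real N * inverse r ^ (N + 1) * inverse r) * r\<^sup>2 = real N * a"
      using r by (simp add: h_def power2_eq_square field_simps)
    finally show ?thesis .
  qed
  have bnd: "norm (h (norm x) *\<^sub>R x) \<le> 1" if x: "x \<in> \<Omega>" for x
  proof -
    define r where "r = norm x"
    have r: "R0 < r" "r < R1" "r > 0" using x assms(1) unfolding in\<Omega> r_def by linarith+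
    have hr: "h r * r * r ^ (N - 1) = a * r ^ N - b"
      using r pw[of r] by (simp add: h_def field_simps power_inverse)
    have "R0 ^ N \<le> r ^ N" "R0 ^ (N - 1) \<le> r ^ (N - 1)" using r assms by (auto intro!: power_mono)
    then have "b \<le> a * r ^ N + r ^ (N - 1)" unfolding b_def using a0 by (intro add_mono mult_left_mono) auto
    then have "- 1 * r ^ (N - 1) \<le> h r * r * r ^ (N - 1)" unfolding hr by simp
    then have l: "- 1 \<le> h r * r" using r mult_le_cancel_right_pos[of "r ^ (N - 1)" "-1" "h r * r"] by simp
    \<comment> \<open>Neither a r nor -b r^(1-N) decreases in r, so the value 1 at R1 is an upper
      bound.\<close>
    have u: "h r * r \<le> 1"
    proof -
      have "a * r \<le> a * R1" using a0 r by simp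
      moreover have "b * inverse r ^ N * r \<ge> b * inverse R1 ^ N * R1"
      proof -
        have e: "inverse t ^ N * t = inverse (t ^ (N - 1))" if "t > 0" for t :: real
          using that pw[of t] by (simp add: power_inverse field_simps)
        have "r ^ (N - 1) \<le> R1 ^ (N - 1)" using r by (intro power_mono) auto
        then have "inverse (R1 ^ (N - 1)) \<le> inverse (r ^ (N - 1))" using r by (intro le_imp_inverse_le) auto
        then show ?thesis using b0 r e[of r] e[of R1] assms by (simp add: mult.assoc)
      qed
      moreover have "a * R1 - b * inverse R1 ^ N * R1 = 1"
        unfolding b1 using assms pw[of R1] by (simp add: field_simps power_inverse)
      ultimately show ?thesis by (simp add: h_def left_diff_distrib)
    qed
    have "norm (h (norm x) *\<^sub>R x) = \<bar>h r * r\<bar>" using r by (simp add: r_def abs_mult)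
    with l u show ?thesis by simp
  qed
  have "real N * a \<le> cheeger \<Omega>"
  proof (rule cheeger_ge_nonneg[OF \<Omega>])
    fix \<phi> assume phi: "\<phi> \<in> test_functions \<Omega>" and pos: "\<And>x. \<phi> x \<ge> 0"
    obtain K where K: "smooth \<phi>" "compact K" "K \<subseteq> \<Omega>" "\<And>x. x \<notin> K \<Longrightarrow> \<phi> x = 0"
      using phi by (auto elim: test_functionsE)
    define I where "I x = \<phi> x * (\<Sum>i\<in>UNIV. grad (Z i) x $ i) + (\<Sum>i\<in>UNIV. grad \<phi> x $ i * Z i x)" for x
    have I: "(LINT x|lborel. I x) = 0" "integrable lborel I"
      unfolding I_def by (rule integral_divergence[OF \<Omega>(1) C1_on_smooth[OF K(1)] K(2,3,4) cZ]; assumption)+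
    have i1: "integrable lborel \<phi>"
      by (rule integrable_compact_support[OF smooth_continuous_on[OF K(1)] K(2,4)])
    have i2: "integrable lborel (\<lambda>x. norm (grad \<phi> x))"
      using test_function_integrals(1)[OF phi \<Omega>(1), of 1] by simp
    have "real N * a * \<phi> x - norm (grad \<phi> x) \<le> I x" for x
    proof (cases "x \<in> \<Omega>")
      case True
      have "(\<Sum>i\<in>UNIV. grad \<phi> x $ i * Z i x) = grad \<phi> x \<bullet> (h (norm x) *\<^sub>R x)"
        by (simp add: Z_def inner_vec_def)
      moreover have "\<bar>grad \<phi> x \<bullet> (h (norm x) *\<^sub>R x)\<bar> \<le> norm (grad \<phi> x) * 1"
        by (rule order_trans[OF Cauchy_Schwarz_ineq2 mult_left_mono[OF bnd[OF True]]]) simp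
      ultimately show ?thesis unfolding I_def div[OF True] by (simp add: algebra_simps)
    next
      case False
      then have "x \<notin> K" using K(3) by auto
      then show ?thesis
        using K(4) grad_zero_outside[OF compact_imp_closed[OF K(2)] K(4)] by (simp add: I_def)
    qed
    then have "(LINT x|lborel. real N * a * \<phi> x - norm (grad \<phi> x)) \<le> (LINT x|lborel. I x)"
      using i1 i2 I by (intro integral_mono) auto
    then show "real N * a * mass 1 \<phi> \<le> energy 1 \<phi>"
      using i1 i2 I(1) pos by (simp add: mass_1 energy_1)
  qed
  then show ?thesis by (simp add: \<Omega>_def a_def N_def)
qed

section \<open>Cutting off the cusp\<close>

text \<open>A uniform slope on the middle half of the transition quantifies the perimeter gained by
  removing the cylinder.\<close>

lemma step'_pos_on: obtains m where "m > 0" "\<And>t. t \<in> {1/4..3/4} \<Longrightarrow> m \<le> step' t"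
proof -
  have "\<exists>x\<in>{1/4..3/4::real}. \<forall>y\<in>{1/4..3/4}. step' x \<le> step' y"
    by (rule continuous_attains_inf) (auto intro!: continuous_step')
  then obtain x where x: "x \<in> {1/4..3/4}" "\<And>y. y \<in> {1/4..3/4} \<Longrightarrow> step' x \<le> step' y" by blast
  have "step' x > 0"
    unfolding step'_def using x exp_inv_pos[of x] exp_inv_pos[of "1 - x"]
    by (intro divide_pos_pos add_pos_pos mult_pos_pos zero_less_power exp_inv_sum_pos) (auto simp: exp_inv_deriv_1)
  with x that show ?thesis by blast
qed

lemma measure_axis_box:
  fixes j :: "'n::finite"
  assumes "l \<le> u" "0 \<le> e"
  shows "measure lborel (cbox (\<chi> i. if i = j then l else - e) (\<chi> i. if i = j then u else e))
    = (u - l) * (2 * e) ^ (CARD('n) - 1)"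
proof -
  have ne: "cbox (\<chi> i. if i = j then l else - e) (\<chi> i. if i = j then u else e) \<noteq> ({} :: (real^'n) set)"
    using assms by (auto simp: interval_ne_empty_cart)
  have "measure lborel (cbox (\<chi> i. if i = j then l else - e) (\<chi> i. if i = j then u else e))
      = (\<Prod>i\<in>UNIV. (if i = j then u - l else 2 * e))"
    unfolding content_cbox_cart[OF ne] by (intro prod.cong) auto
  also have "\<dots> = (u - l) * (\<Prod>i\<in>UNIV - {j}. 2 * e)"
    by (subst prod.remove[of _ j]) auto
  finally show ?thesis by (simp add: card_Diff_singleton)
qed

text \<open>When the hole touches the outer sphere, cutting off a cylinder of radius \<open>\<epsilon>\<close> around the point
  of tangency saves perimeter of order \<open>\<epsilon>\<^sup>N\<^sup>-\<^sup>1\<close> and costs perimeter and volume of higher order only.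
  The outer cut-off is \<open>F\<close>, the inner one \<open>G\<close>; the cylinder is removed by \<open>1 - \<kappa> \<rho>\<close>.\<close>

lemma cusp_test_function:
  fixes j :: "'n::finite"
  assumes R: "0 < R0" "R0 < R1"
  obtains m c1 \<epsilon>0 where "m > 0" "c1 > 0" "\<epsilon>0 > 0"
    and "\<And>\<epsilon> \<delta>. 0 < \<epsilon> \<Longrightarrow> \<epsilon> < \<epsilon>0 \<Longrightarrow> 0 < \<delta> \<Longrightarrow> \<delta> < R0 / 4 \<Longrightarrow>
      \<exists>\<phi>. (\<forall>s. \<bar>R1 - R0 - s\<bar> < \<delta> \<longrightarrow> \<phi> \<in> test_functions (eccentric_annulus j R0 R1 s)) \<and>
        energy 1 \<phi> \<le> real CARD('n) * measure lborel (cball (0::real^'n) R1) / (R1 - 2 * \<delta>)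
          + real CARD('n) * measure lborel (cball (0::real^'n) (R0 + 2 * \<delta>)) / R0
          - m * \<epsilon> ^ (CARD('n) - 1) + c1 * \<epsilon> ^ CARD('n) \<and>
        mass 1 \<phi> \<ge> measure lborel (cball (0::real^'n) (R1 - 2 * \<delta>))
          - measure lborel (cball (0::real^'n) (R0 + 2 * \<delta>)) - c1 * \<epsilon> ^ CARD('n)"
proof -
  define N where "N = CARD('n)"
  have N: "N > 0" by (simp add: N_def)
  let ?e = "axis j 1 :: real^'n"
  \<comment> \<open>Centre of the hole in the limiting, tangent position. The test function is built
    for this position once; its support keeps distance \<delta> from both spheres, so it is
    admissible for every s within \<delta> of R1 - R0.\<close>
  define c where "c = (R1 - R0) *\<^sub>R ?e"
  obtain BB where BB: "BB > 0" "\<And>t. step' t \<le> BB" using step'_bounded by metis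
  obtain m0 where m0: "m0 > 0" "\<And>t. t \<in> {1/4..3/4} \<Longrightarrow> m0 \<le> step' t" using step'_pos_on by metis
  \<comment> \<open>The gradients of \<kappa> and \<rho> are bounded by (8/3) BB/\<epsilon> and 2
    BB/R0; as \<epsilon> < 1, that of the factor \<open>H\<close> is at most C/\<epsilon>.\<close>
  define C where "C = 8 / 3 * BB + 2 * BB / R0"
  have C0: "C > 0" unfolding C_def using BB R by (intro add_pos_pos divide_pos_pos mult_pos_pos) auto
  \<comment> \<open>The lower bound 2 m0/R0 for the axial derivative of \<rho> on the box
    \<open>Q\<close>, times the volume (R0/4) (\<epsilon>/N)^(N-1) of \<open>Q\<close>, without the
    power of \<epsilon>.\<close>
  define m where "m = m0 / 2 * (1 / real N) ^ (N - 1)"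
  define c1 where "c1 = (C + 1) * (2 ^ (N - 1) / R0)"
  define \<epsilon>0 where "\<epsilon>0 = min 1 (R0 / 8)"
  have m: "m > 0" unfolding m_def using m0 N by (intro mult_pos_pos zero_less_power divide_pos_pos) auto
  have c1: "c1 > 0" unfolding c1_def using C0 R by (intro mult_pos_pos divide_pos_pos zero_less_power add_pos_pos) auto
  have e0: "\<epsilon>0 > 0" unfolding \<epsilon>0_def using R by simp
  have "\<exists>\<phi>. (\<forall>s. \<bar>R1 - R0 - s\<bar> < \<delta> \<longrightarrow> \<phi> \<in> test_functions (eccentric_annulus j R0 R1 s)) \<and>
        energy 1 \<phi> \<le> real N * measure lborel (cball (0::real^'n) R1) / (R1 - 2 * \<delta>)
          + real N * measure lborel (cball (0::real^'n) (R0 + 2 * \<delta>)) / R0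
          - m * \<epsilon> ^ (N - 1) + c1 * \<epsilon> ^ N \<and>
        mass 1 \<phi> \<ge> measure lborel (cball (0::real^'n) (R1 - 2 * \<delta>))
          - measure lborel (cball (0::real^'n) (R0 + 2 * \<delta>)) - c1 * \<epsilon> ^ N"
    if eps: "0 < \<epsilon>" "\<epsilon> < \<epsilon>0" and del: "0 < \<delta>" "\<delta> < R0 / 4" for \<epsilon> \<delta>
  proof -
    have eps1: "\<epsilon> < 1" "\<epsilon> < R0 / 8" using eps by (auto simp: \<epsilon>0_def)
    define w where "w x = (norm (x - 0))\<^sup>2 - (x $ j)\<^sup>2" for x :: "real^'n"
    define A where "A = (R1 - 2 * \<delta>)\<^sup>2"
    define D where "D = (R1 - \<delta>)\<^sup>2 - A"
    have Rd: "R1 - 2 * \<delta> > 0" using R del by simp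
    have D: "D > 0" unfolding D_def A_def using power_strict_mono[of "R1 - 2 * \<delta>" "R1 - \<delta>" 2] Rd del by simp
    define A' where "A' = (R0 + \<delta>)\<^sup>2"
    define D' where "D' = (R0 + 2 * \<delta>)\<^sup>2 - A'"
    have D': "D' > 0" unfolding D'_def A'_def using power_strict_mono[of "R0 + \<delta>" "R0 + 2 * \<delta>" 2] R del by simp
    define qF where "qF x = ((norm (x - 0))\<^sup>2 - A) / D" for x :: "real^'n"
    define qG where "qG x = ((norm (x - c))\<^sup>2 - A') / D'" for x
    \<comment> \<open>\<open>w\<close> is the squared distance to the axis, so \<kappa> is 1 up to
      distance \<epsilon>/2 and 0 beyond \<epsilon>. Along the axis \<rho> rises from 0 to 1 between
      the level of the hole's centre and half a radius further out.\<close>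
    define qk where "qk x = (\<epsilon>\<^sup>2 - w x) / (3 / 4 * \<epsilon>\<^sup>2)" for x
    define qr where "qr x = (x $ j - (R1 - R0)) / (R0 / 2)" for x :: "real^'n"
    define F where "F x = 1 - step (qF x)" for x
    define G where "G x = step (qG x)" for x
    define \<kappa> where "\<kappa> x = step (qk x)" for x
    define \<rho> where "\<rho> x = step (qr x)" for x
    have sw: "smooth w" unfolding w_def[abs_def] by (intro smooth_intros smooth_norm_square)
    have sq: "smooth qF" "smooth qG" "smooth qk" "smooth qr"
      unfolding qF_def[abs_def] qG_def[abs_def] qk_def[abs_def] qr_def[abs_def]
      by (intro smooth_intros smooth_norm_square sw)+
    have sm: "smooth F" "smooth G" "smooth \<kappa>" "smooth \<rho>"
      unfolding F_def[abs_def] G_def[abs_def] \<kappa>_def[abs_def] \<rho>_def[abs_def]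
      by (intro smooth_intros sq)+
    have dif: "F differentiable (at x)" "G differentiable (at x)" "\<kappa> differentiable (at x)" "\<rho> differentiable (at x)" for x
      using sm smooth_differentiable by auto
    have b01: "0 \<le> F x" "F x \<le> 1" "0 \<le> G x" "G x \<le> 1" "0 \<le> \<kappa> x" "\<kappa> x \<le> 1" "0 \<le> \<rho> x" "\<rho> x \<le> 1" for x
      unfolding F_def G_def \<kappa>_def \<rho>_def using step_nonneg step_le_1 by (auto simp: add_increasing)
    have lin: "grad (\<lambda>x. (g x - a) / b) x = (1 / b) *\<^sub>R grad g x" "grad (\<lambda>x. (a - g x) / b) x = - ((1 / b) *\<^sub>R grad g x)"
      if "smooth g" for g :: "real^'n \<Rightarrow> real" and a b x
    proof -
      have dg: "g differentiable (at x)" using that by (rule smooth_differentiable)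
      have "(\<lambda>x. (g x - a) / b) = (\<lambda>x. (1 / b) * (g x - a))" "(\<lambda>x. (a - g x) / b) = (\<lambda>x. (1 / b) * (a - g x))" by auto
      moreover have "grad (\<lambda>x. g x - a) x = grad g x" "grad (\<lambda>x. a - g x) x = - grad g x"
        using grad_diff[OF dg, of "\<lambda>x. a"] grad_diff[of "\<lambda>x. a" x g] dg by auto
      ultimately show "grad (\<lambda>x. (g x - a) / b) x = (1 / b) *\<^sub>R grad g x" "grad (\<lambda>x. (a - g x) / b) x = - ((1 / b) *\<^sub>R grad g x)"
        using grad_scale[of "\<lambda>x. g x - a" x "1 / b"] grad_scale[of "\<lambda>x. a - g x" x "1 / b"] dg by auto
    qed
    have gF: "grad F x = - ((2 * step' (qF x) / D) *\<^sub>R x)" for x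
    proof -
      have "grad F x = - grad (\<lambda>x. step (qF x)) x"
        unfolding F_def[abs_def]
        using grad_diff[of "\<lambda>x. 1" x "\<lambda>x. step (qF x)"] smooth_differentiable[OF smooth_step[OF sq(1)]] by simp
      also have "\<dots> = - (step' (qF x) *\<^sub>R ((1 / D) *\<^sub>R (2 *\<^sub>R (x - 0))))"
        unfolding grad_compose_1D[OF smooth_differentiable[OF sq(1)] step_has_derivative]
        unfolding qF_def[abs_def] lin(1)[OF smooth_norm_square] grad_norm_square ..
      finally show ?thesis by simp
    qed
    have gG: "grad G x = (2 * step' (qG x) / D') *\<^sub>R (x - c)" for x
    proof -
      have "grad G x = step' (qG x) *\<^sub>R ((1 / D') *\<^sub>R (2 *\<^sub>R (x - c)))"
        unfolding G_def[abs_def] grad_compose_1D[OF smooth_differentiable[OF sq(2)] step_has_derivative]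
        unfolding qG_def[abs_def] lin(1)[OF smooth_norm_square] grad_norm_square ..
      then show ?thesis by simp
    qed
    have gw: "grad w x = 2 *\<^sub>R (x - (x $ j) *\<^sub>R ?e)" for x
    proof -
      have "grad (\<lambda>x. (x $ j)\<^sup>2) x = (2 * x $ j) *\<^sub>R ?e"
        using grad_compose_1D[OF smooth_differentiable[OF smooth_component] DERIV_power[OF DERIV_ident], of j 2 x]
        by (simp add: grad_component)
      then show ?thesis
        unfolding w_def[abs_def]
        by (subst grad_diff[OF smooth_differentiable[OF smooth_norm_square] smooth_differentiable[OF smooth_power[OF smooth_component]]])
          (simp add: grad_norm_square[of 0, simplified] algebra_simps)
    qed
    have gk: "grad \<kappa> x = - ((8 / 3 * step' (qk x) / \<epsilon>\<^sup>2) *\<^sub>R (x - (x $ j) *\<^sub>R ?e))" for x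
    proof -
      have "grad \<kappa> x = step' (qk x) *\<^sub>R (- ((1 / (3 / 4 * \<epsilon>\<^sup>2)) *\<^sub>R (2 *\<^sub>R (x - (x $ j) *\<^sub>R ?e))))"
        unfolding \<kappa>_def[abs_def] grad_compose_1D[OF smooth_differentiable[OF sq(3)] step_has_derivative]
        unfolding qk_def[abs_def] lin(2)[OF sw] gw ..
      then show ?thesis by simp
    qed
    have gr: "grad \<rho> x = (2 * step' (qr x) / R0) *\<^sub>R ?e" for x
    proof -
      have "grad \<rho> x = step' (qr x) *\<^sub>R ((1 / (R0 / 2)) *\<^sub>R ?e)"
        unfolding \<rho>_def[abs_def] grad_compose_1D[OF smooth_differentiable[OF sq(4)] step_has_derivative]
        unfolding qr_def[abs_def] lin(1)[OF smooth_component] grad_component ..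
      then show ?thesis by simp
    qed
    have w_norm: "(norm (x - (x $ j) *\<^sub>R ?e))\<^sup>2 = w x" for x
      unfolding norm_sq_minus_axis w_def by (simp add: power2_eq_square)
    have w0: "w x \<ge> 0" for x using w_norm[of x] by (metis zero_le_power2)
    have w_comp: "(x $ i)\<^sup>2 \<le> w x" if "i \<noteq> j" for i x
    proof -
      have "\<bar>(x - (x $ j) *\<^sub>R ?e) $ i\<bar> \<le> norm (x - (x $ j) *\<^sub>R ?e)" by (rule component_le_norm_cart)
      then have "\<bar>x $ i\<bar>\<^sup>2 \<le> (norm (x - (x $ j) *\<^sub>R ?e))\<^sup>2" using that by (intro power_mono) (auto simp: axis_def)
      then show ?thesis by (simp add: w_norm)
    qed
    have w_sum: "w x = (\<Sum>i\<in>UNIV - {j}. (x $ i)\<^sup>2)" for x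
      unfolding w_def power2_norm_eq_inner inner_vec_def
      by (subst sum.remove[of _ j]) (auto simp: power2_eq_square)
    have norm_w: "(norm x)\<^sup>2 = w x + (x $ j)\<^sup>2" for x by (simp add: w_def)
    have norm_c: "(norm (x - c))\<^sup>2 = w x + (x $ j - (R1 - R0))\<^sup>2" for x
      unfolding c_def norm_sq_minus_axis w_def by (simp add: power2_eq_square algebra_simps)
    have F0: "F x = 0" if "norm x \<ge> R1 - \<delta>" for x
    proof -
      have "(R1 - \<delta>)\<^sup>2 \<le> (norm x)\<^sup>2" using that Rd del by (intro power_mono) auto
      then have "qF x \<ge> 1" unfolding qF_def using D by (simp add: D_def field_simps)
      then show ?thesis by (simp add: F_def step_eq_1)
    qed
    have F1: "F x = 1" if "norm x \<le> R1 - 2 * \<delta>" for x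
    proof -
      have "(norm x)\<^sup>2 \<le> A" unfolding A_def using that by (intro power_mono) auto
      then have "qF x \<le> 0" unfolding qF_def using D by (simp add: divide_le_0_iff)
      then show ?thesis by (simp add: F_def step_eq_0)
    qed
    have G0: "G x = 0" if "norm (x - c) \<le> R0 + \<delta>" for x
    proof -
      have "(norm (x - c))\<^sup>2 \<le> A'" unfolding A'_def using that by (intro power_mono) auto
      then have "qG x \<le> 0" unfolding qG_def using D' by (simp add: divide_le_0_iff)
      then show ?thesis by (simp add: G_def step_eq_0)
    qed
    have G1: "G x = 1" if "norm (x - c) \<ge> R0 + 2 * \<delta>" for x
    proof -
      have "(R0 + 2 * \<delta>)\<^sup>2 \<le> (norm (x - c))\<^sup>2" using that R del by (intro power_mono) auto
      then have "qG x \<ge> 1" unfolding qG_def using D' by (simp add: D'_def field_simps)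
      then show ?thesis by (simp add: G_def step_eq_1)
    qed
    have k_dead: "\<kappa> x = 0 \<and> grad \<kappa> x = 0" if "w x \<ge> \<epsilon>\<^sup>2" for x
    proof -
      have "qk x \<le> 0" unfolding qk_def using that eps(1) by (simp add: divide_le_0_iff)
      then show ?thesis unfolding gk by (simp add: \<kappa>_def step_eq_0 step'_eq_0)
    qed
    have r_dead: "\<rho> x = 0 \<and> grad \<rho> x = 0" if "x $ j \<le> R1 - R0" for x
    proof -
      have "qr x \<le> 0" unfolding qr_def using that R by (simp add: divide_le_0_iff)
      then show ?thesis unfolding gr by (simp add: \<rho>_def step_eq_0 step'_eq_0)
    qed
    have k1: "\<kappa> x = 1" if "w x \<le> \<epsilon>\<^sup>2 / 4" for x
    proof -
      have "qk x \<ge> 1" unfolding qk_def using that eps(1) by (simp add: field_simps)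
      then show ?thesis by (simp add: \<kappa>_def step_eq_1)
    qed
    define H where "H x = 1 - \<kappa> x * \<rho> x" for x
    have sH: "smooth H" unfolding H_def[abs_def] by (intro smooth_intros sm)
    have H01: "0 \<le> H x" "H x \<le> 1" for x
      unfolding H_def using b01[of x] by (auto intro!: mult_le_one)
    have gkr: "grad (\<lambda>x. \<kappa> x * \<rho> x) x = \<kappa> x *\<^sub>R grad \<rho> x + \<rho> x *\<^sub>R grad \<kappa> x" for x
      by (rule grad_mult[OF dif(3,4)])
    have gH: "grad H x = - (\<kappa> x *\<^sub>R grad \<rho> x + \<rho> x *\<^sub>R grad \<kappa> x)" for x
      unfolding H_def[abs_def]
      using grad_diff[of "\<lambda>x. 1" x "\<lambda>x. \<kappa> x * \<rho> x"] dif[of x] gkr[of x] by auto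
    have ngk: "norm (grad \<kappa> x) \<le> 8 / 3 * BB / \<epsilon>" for x
    proof (cases "w x \<ge> \<epsilon>\<^sup>2")
      case False
      then have "(norm (x - (x $ j) *\<^sub>R ?e))\<^sup>2 \<le> \<epsilon>\<^sup>2" by (simp add: w_norm)
      then have n: "norm (x - (x $ j) *\<^sub>R ?e) \<le> \<epsilon>" using eps(1) by (simp add: power2_le_iff_abs_le)
      have "norm (grad \<kappa> x) = (8 / 3 * step' (qk x) / \<epsilon>\<^sup>2) * norm (x - (x $ j) *\<^sub>R ?e)"
        unfolding gk using step'_nonneg[of "qk x"] by simp
      also have "\<dots> \<le> (8 / 3 * BB / \<epsilon>\<^sup>2) * \<epsilon>"
        using n BB step'_nonneg[of "qk x"] by (intro mult_mono divide_right_mono) auto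
      finally show ?thesis using eps(1) by (simp add: power2_eq_square)
    qed (use k_dead[of x] BB eps(1) in auto)
    have ngr: "norm (grad \<rho> x) \<le> 2 * BB / R0" for x
      unfolding gr using step'_nonneg[of "qr x"] BB(2)[of "qr x"] R by (simp add: norm_axis_1 divide_right_mono)
    have ngH: "norm (grad H x) \<le> C / \<epsilon>" for x
    proof -
      have "norm (grad H x) \<le> norm (\<kappa> x *\<^sub>R grad \<rho> x) + norm (\<rho> x *\<^sub>R grad \<kappa> x)"
        unfolding gH norm_minus_cancel by (rule norm_triangle_ineq)
      also have "\<dots> \<le> 1 * (2 * BB / R0) + 1 * (8 / 3 * BB / \<epsilon>)"
        unfolding norm_scaleR using b01[of x] ngk ngr by (intro add_mono mult_mono) auto
      also have "2 * BB / R0 \<le> 2 * BB / R0 / \<epsilon>"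
        using eps1 eps(1) BB R by (simp add: divide_simps)
      finally show ?thesis by (simp add: C_def add_divide_distrib)
    qed
    \<comment> \<open>The part of the cusp that the cylinder meets. A point outside the hole at
      height \<tau> below the level R1 satisfies \<tau> R0 < w < \<epsilon>^2, so a box of height
      \<epsilon>^2/R0 and width 2 \<epsilon> contains it.\<close>
    define S where "S = cbox (\<chi> i. if i = j then R1 - \<epsilon>\<^sup>2 / R0 else - \<epsilon>) ((\<chi> i. if i = j then R1 else \<epsilon>) :: real^'n)"
    have inS: "x \<in> S" if x: "norm x < R1" "R0 < norm (x - c)" "R1 - R0 < x $ j" "w x < \<epsilon>\<^sup>2" for x :: "real^'n"
    proof -
      have xj: "x $ j < R1" using x(1) component_le_norm_cart[of x j] by simp
      define \<tau> where "\<tau> = R1 - x $ j"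
      have t: "0 < \<tau>" "\<tau> < R0" using xj x(3) by (auto simp: \<tau>_def)
      have "R0\<^sup>2 < w x + (R0 - \<tau>)\<^sup>2"
      proof -
        have "R0\<^sup>2 < (norm (x - c))\<^sup>2" using x(2) R by (intro power_strict_mono) auto
        also have "\<dots> = w x + (R0 - \<tau>)\<^sup>2" unfolding norm_c \<tau>_def by (simp add: algebra_simps)
        finally show ?thesis .
      qed
      then have "\<tau> * (2 * R0 - \<tau>) < w x" by (simp add: power2_eq_square algebra_simps)
      moreover have "\<tau> * R0 \<le> \<tau> * (2 * R0 - \<tau>)" using t by (intro mult_left_mono) auto
      ultimately have "\<tau> * R0 < \<epsilon>\<^sup>2" using x(4) by linarith
      then have "\<tau> \<le> \<epsilon>\<^sup>2 / R0" using R by (simp add: field_simps)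
      moreover have "- \<epsilon> \<le> x $ i \<and> x $ i \<le> \<epsilon>" if "i \<noteq> j" for i
      proof -
        have "\<bar>x $ i\<bar> \<le> \<epsilon>"
          using w_comp[OF that, of x] x(4) eps(1) abs_le_square_iff[of "x $ i" \<epsilon>] by simp
        then show ?thesis by linarith
      qed
      ultimately show ?thesis using xj unfolding S_def mem_box_cart by (auto simp: \<tau>_def)
    qed
    have volS: "measure lborel S = (2 ^ (N - 1) / R0) * \<epsilon> ^ (N + 1)"
    proof -
      have "measure lborel S = (R1 - (R1 - \<epsilon>\<^sup>2 / R0)) * (2 * \<epsilon>) ^ (CARD('n) - 1)"
        unfolding S_def using R eps by (intro measure_axis_box) auto
      also have "\<dots> = (2 ^ (N - 1) / R0) * (\<epsilon>\<^sup>2 * \<epsilon> ^ (N - 1))" by (simp add: N_def power_mult_distrib)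
      also have "\<epsilon>\<^sup>2 * \<epsilon> ^ (N - 1) = \<epsilon> ^ (N + 1)" unfolding power_add[symmetric] using N by simp
      finally show ?thesis .
    qed
    define \<phi> where "\<phi> x = (F x * G x) * H x" for x
    define K where "K = cball 0 (R1 - \<delta>) \<inter> {x. R0 + \<delta> \<le> norm (x - c)}"
    have Kc: "compact K" unfolding K_def by (intro compact_Int_closed compact_cball closed_Collect_le continuous_intros)
    have out: "\<phi> x = 0" if "x \<notin> K" for x
      using that F0[of x] G0[of x] by (auto simp: K_def \<phi>_def not_le)
    have sphi: "smooth \<phi>" unfolding \<phi>_def[abs_def] by (intro smooth_intros sm sH)
    have test: "\<phi> \<in> test_functions (eccentric_annulus j R0 R1 s)" if s: "\<bar>R1 - R0 - s\<bar> < \<delta>" for s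
    proof (rule test_functionsI[OF sphi Kc _ out])
      show "K \<subseteq> eccentric_annulus j R0 R1 s"
      proof
        fix x assume x: "x \<in> K"
        have "norm (x - c) \<le> norm (x - s *\<^sub>R ?e) + norm ((s - (R1 - R0)) *\<^sub>R ?e)"
          using norm_triangle_ineq[of "x - s *\<^sub>R ?e" "(s - (R1 - R0)) *\<^sub>R ?e"] by (simp add: c_def algebra_simps)
        then have "norm (x - c) < norm (x - s *\<^sub>R ?e) + \<delta>" using s by (simp add: norm_axis_1 abs_minus_commute)
        then show "x \<in> eccentric_annulus j R0 R1 s"
          using x del by (simp add: K_def eccentric_annulus_eq[OF R(1)])
      qed
    qed
    have phi0: "\<phi> \<in> test_functions UNIV" by (rule test_functionsI[OF sphi Kc _ out]) auto
    \<comment> \<open>\<open>H\<close> varies only in the cylinder beyond the level of the hole's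
      centre, and there the product of \<open>F\<close> and \<open>G\<close> lives in
      \<open>S\<close>. A gradient of size C/\<epsilon> on a set of volume \<epsilon>^(N+1) costs
      \<epsilon>^N.\<close>
    have FGH: "(F x * G x) * norm (grad H x) \<le> C / \<epsilon> * indicator S x" for x
    proof (cases "x \<in> S")
      case True
      have "(F x * G x) * norm (grad H x) \<le> 1 * (C / \<epsilon>)"
        using b01[of x] ngH[of x] by (intro mult_mono mult_le_one) auto
      then show ?thesis using True by simp
    next
      case False
      have "(F x * G x) * norm (grad H x) = 0"
      proof (rule ccontr)
        assume nz: "(F x * G x) * norm (grad H x) \<noteq> 0"
        then have "\<not> R1 - \<delta> \<le> norm x" "\<not> norm (x - c) \<le> R0 + \<delta>" using F0[of x] G0[of x] by auto
        then have "norm x < R1" "R0 < norm (x - c)" using del by linarith+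
        moreover have "\<not> x $ j \<le> R1 - R0" "\<not> \<epsilon>\<^sup>2 \<le> w x"
          using nz r_dead[of x] k_dead[of x] unfolding gH by auto
        then have "R1 - R0 < x $ j" "w x < \<epsilon>\<^sup>2" by linarith+
        ultimately show False using inS False by blast
      qed
      then show ?thesis using False by (metis indicator_simps(2) mult_zero_right order_refl)
    qed
    \<comment> \<open>The gradient of \<open>F\<close> is antiparallel to x and lives where |x|
      \<ge> R1 - 2 \<delta>, so the radial identity bounds its total variation by N times a volume
      over R1 - 2 \<delta>.\<close>
    have nF: "norm (grad F x) * (R1 - 2 * \<delta>) \<le> - (grad F x \<bullet> (x - 0))" "- (grad F x $ j) \<le> norm (grad F x)" for x
    proof -
      show "norm (grad F x) * (R1 - 2 * \<delta>) \<le> - (grad F x \<bullet> (x - 0))"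
      proof (cases "norm x \<ge> R1 - 2 * \<delta>")
        case True
        have "norm (grad F x) * (R1 - 2 * \<delta>) = (2 * step' (qF x) / D) * (norm x * (R1 - 2 * \<delta>))"
          unfolding gF using step'_nonneg[of "qF x"] D by simp
        also have "\<dots> \<le> (2 * step' (qF x) / D) * (norm x * norm x)"
          using True step'_nonneg[of "qF x"] D by (intro mult_left_mono) auto
        also have "\<dots> = - (grad F x \<bullet> (x - 0))"
          unfolding gF by (simp add: dot_square_norm power2_eq_square)
        finally show ?thesis .
      next
        case False
        then have "(norm x)\<^sup>2 \<le> A" unfolding A_def by (intro power_mono) auto
        then have "qF x \<le> 0" unfolding qF_def using D by (simp add: divide_le_0_iff)
        then show ?thesis unfolding gF by (simp add: step'_eq_0)
      qed
      show "- (grad F x $ j) \<le> norm (grad F x)" using component_le_norm_cart[of "grad F x" j] by simp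
    qed
    \<comment> \<open>Unlike \<open>G\<close>, its complement has compact support, as the radial
      identity requires.\<close>
    define G' where "G' x = 1 - G x" for x
    have sG': "smooth G'" unfolding G'_def[abs_def] by (intro smooth_intros sm)
    have gG': "grad G' x = - grad G x" for x
      unfolding G'_def[abs_def] using grad_diff[of "\<lambda>x. 1" x G] dif(2)[of x] by auto
    have nG: "norm (grad G x) * R0 \<le> - (grad G' x \<bullet> (x - c))" for x
    proof (cases "norm (x - c) \<ge> R0")
      case True
      have "norm (grad G x) * R0 = (2 * step' (qG x) / D') * (norm (x - c) * R0)"
        unfolding gG using step'_nonneg[of "qG x"] D' by simp
      also have "\<dots> \<le> (2 * step' (qG x) / D') * (norm (x - c) * norm (x - c))"
        using True step'_nonneg[of "qG x"] D' by (intro mult_left_mono) auto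
      also have "\<dots> = - (grad G' x \<bullet> (x - c))"
        unfolding gG' gG by (simp add: dot_square_norm power2_eq_square)
      finally show ?thesis .
    next
      case False
      then have "(norm (x - c))\<^sup>2 \<le> A'" unfolding A'_def using del by (intro power_mono) auto
      then have "qG x \<le> 0" unfolding qG_def using D' by (simp add: divide_le_0_iff)
      then show ?thesis unfolding gG' gG by (simp add: step'_eq_0)
    qed
    define V1 where "V1 = measure lborel (cball (0::real^'n) R1)"
    define V0 where "V0 = measure lborel (cball (0::real^'n) (R0 + 2 * \<delta>))"
    have V0c: "measure lborel (cball c (R0 + 2 * \<delta>)) = V0"
      unfolding V0_def using R del by (simp add: content_cball)
    have cF: "compact (cball (0::real^'n) R1)" and cG: "compact (cball c (R0 + 2 * \<delta>))" by auto
    have Fout: "F x = 0" if "x \<notin> cball 0 R1" for x using F0[of x] that del by simp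
    have Gout: "G' x = 0" if "x \<notin> cball c (R0 + 2 * \<delta>)" for x
      using G1[of x] that by (simp add: G'_def dist_norm norm_minus_commute)
    have cint: "integrable lborel (\<lambda>x. indicator T x :: real)" if "compact T" for T :: "(real^'n) set"
      using that by (intro integrable_real_indicator emeasure_compact_finite) (auto intro: borel_compact)
    have Fi: "integrable lborel F" by (rule integrable_compact_support[OF smooth_continuous_on[OF sm(1)] cF Fout])
    have Gi: "integrable lborel G'" by (rule integrable_compact_support[OF smooth_continuous_on[OF sG'] cG Gout])
    have IF: "(LINT x|lborel. F x) \<le> V1"
    proof -
      have "(LINT x|lborel. F x) \<le> (LINT x|lborel. indicator (cball (0::real^'n) R1) x)"
        by (rule integral_mono[OF Fi cint[OF cF]]) (use b01 Fout in \<open>auto simp: indicator_def\<close>)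
      then show ?thesis by (simp add: V1_def)
    qed
    have IG: "(LINT x|lborel. G' x) \<le> V0"
    proof -
      have "(LINT x|lborel. G' x) \<le> (LINT x|lborel. indicator (cball c (R0 + 2 * \<delta>)) x)"
        by (rule integral_mono[OF Gi cint[OF cG]]) (use b01 Gout in \<open>auto simp: indicator_def G'_def\<close>)
      then show ?thesis by (simp add: V0c)
    qed
    note RF = integral_grad_radial[OF sm(1) cF Fout, of 0]
    note RG = integral_grad_radial[OF sG' cG Gout, of c]
    have skr: "smooth (\<lambda>x. \<kappa> x * \<rho> x)" by (intro smooth_intros sm)
    note BP = integral_by_parts_component[OF sm(1) skr cF Fout, of j]
    \<comment> \<open>A box in the core of the cylinder, within distance \<epsilon>/2 of the axis,
      on which \<open>F\<close> and \<kappa> equal 1 and the argument of \<rho> lies in the middle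
      half [1/4, 3/4].\<close>
    define Q where "Q = cbox (\<chi> i. if i = j then R1 - R0 + R0 / 8 else - (\<epsilon> / (2 * real N)))
        ((\<chi> i. if i = j then R1 - R0 + 3 * R0 / 8 else \<epsilon> / (2 * real N)) :: real^'n)"
    have gkrj: "grad (\<lambda>x. \<kappa> x * \<rho> x) x $ j = \<kappa> x * (2 * step' (qr x) / R0)" for x
      unfolding gkr gr gk by (simp add: axis_def)
    have onQ: "2 * m0 / R0 * indicator Q x \<le> F x * grad (\<lambda>x. \<kappa> x * \<rho> x) x $ j" for x
    proof (cases "x \<in> Q")
      case False
      then show ?thesis unfolding gkrj using b01[of x] step'_nonneg[of "qr x"] R by simp
    next
      case True
      then have xj: "R1 - R0 + R0 / 8 \<le> x $ j" "x $ j \<le> R1 - R0 + 3 * R0 / 8"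
        and xi: "\<And>i. i \<noteq> j \<Longrightarrow> - (\<epsilon> / (2 * real N)) \<le> x $ i \<and> x $ i \<le> \<epsilon> / (2 * real N)"
        unfolding Q_def mem_box_cart by (auto split: if_splits dest: spec)
      have "w x \<le> (\<Sum>i\<in>UNIV - {j}. (\<epsilon> / (2 * real N))\<^sup>2)"
        unfolding w_sum
      proof (rule sum_mono)
        fix i assume "i \<in> UNIV - {j}"
        then have "\<bar>x $ i\<bar> \<le> \<epsilon> / (2 * real N)" using xi[of i] by (simp add: abs_le_iff)
        then have "\<bar>x $ i\<bar>\<^sup>2 \<le> (\<epsilon> / (2 * real N))\<^sup>2" by (intro power_mono) auto
        then show "(x $ i)\<^sup>2 \<le> (\<epsilon> / (2 * real N))\<^sup>2" by simp
      qed
      also have "\<dots> = real (N - 1) * (\<epsilon> / (2 * real N))\<^sup>2" by (simp add: N_def card_Diff_singleton)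
      also have "\<dots> \<le> (real N)\<^sup>2 * (\<epsilon> / (2 * real N))\<^sup>2"
        using N by (intro mult_right_mono) (auto simp: power2_eq_square intro: order_trans[of _ "real N * 1"])
      also have "\<dots> = \<epsilon>\<^sup>2 / 4" using N by (simp add: power_divide power_mult_distrib)
      finally have wx: "w x \<le> \<epsilon>\<^sup>2 / 4" .
      have kx: "\<kappa> x = 1" by (rule k1[OF wx])
      have "norm x \<le> R1 - 2 * \<delta>"
      proof -
        have "norm x \<le> norm (x - (x $ j) *\<^sub>R ?e) + norm ((x $ j) *\<^sub>R ?e)"
          using norm_triangle_ineq[of "x - (x $ j) *\<^sub>R ?e" "(x $ j) *\<^sub>R ?e"] by simp
        moreover have "norm (x - (x $ j) *\<^sub>R ?e) \<le> \<epsilon>"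
        proof -
          have "(norm (x - (x $ j) *\<^sub>R ?e))\<^sup>2 \<le> \<epsilon>\<^sup>2" using wx w0[of x] by (simp add: w_norm)
          then show ?thesis using eps(1) by (simp add: power2_le_iff_abs_le)
        qed
        moreover have "norm ((x $ j) *\<^sub>R ?e) \<le> R1 - R0 + 3 * R0 / 8" using xj R by (simp add: norm_axis_1)
        ultimately show ?thesis using eps1 del by simp
      qed
      then have Fx: "F x = 1" by (rule F1)
      have "qr x \<in> {1/4..3/4}" unfolding qr_def using xj R by (simp add: field_simps)
      then have "m0 \<le> step' (qr x)" by (rule m0(2))
      then show ?thesis unfolding gkrj kx Fx using True R by (simp add: divide_right_mono)
    qed
    have cQ: "compact Q" and cS: "compact S" unfolding Q_def S_def by auto
    have volQ: "measure lborel Q = R0 / 4 * (\<epsilon> / real N) ^ (N - 1)"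
    proof -
      have "measure lborel Q = ((R1 - R0 + 3 * R0 / 8) - (R1 - R0 + R0 / 8)) * (2 * (\<epsilon> / (2 * real N))) ^ (CARD('n) - 1)"
        unfolding Q_def using R eps by (intro measure_axis_box) auto
      then show ?thesis by (simp add: N_def)
    qed
    \<comment> \<open>The saved perimeter, after integration by parts. Only \<rho> is differentiated
      because \<kappa> does not vary along the axis; the integrand is nonnegative and is bounded
      below on \<open>Q\<close>.\<close>
    have gain: "m * \<epsilon> ^ (N - 1) \<le> (LINT x|lborel. F x * grad (\<lambda>x. \<kappa> x * \<rho> x) x $ j)"
    proof -
      have "(LINT x|lborel. 2 * m0 / R0 * indicator Q x) \<le> (LINT x|lborel. F x * grad (\<lambda>x. \<kappa> x * \<rho> x) x $ j)"
        by (rule integral_mono[OF _ BP(3) onQ]) (use cint[OF cQ] in simp)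
      moreover have "(LINT x|lborel. 2 * m0 / R0 * indicator Q x) = 2 * m0 / R0 * (R0 / 4 * (\<epsilon> / real N) ^ (N - 1))"
        by (simp add: volQ)
      moreover have "\<dots> = m * \<epsilon> ^ (N - 1)" using R by (simp add: m_def power_divide)
      ultimately show ?thesis by simp
    qed
    \<comment> \<open>The factor 1 - \<kappa>\<rho> removes \<kappa>\<rho> |grad F|, which is at
      least -\<kappa>\<rho> times the j-th component of grad F. This lower bound is linear in the
      gradient and can be integrated by parts. For the inner cut-off only \<open>H\<close> \<le> 1
      is used.\<close>
    have pw: "norm (grad \<phi> x) \<le> - (grad F x \<bullet> (x - 0)) / (R1 - 2 * \<delta>) + grad F x $ j * (\<kappa> x * \<rho> x)
        + - (grad G' x \<bullet> (x - c)) / R0 + C / \<epsilon> * indicator S x" for x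
    proof -
      have dFG: "(\<lambda>x. F x * G x) differentiable (at x)" using dif by auto
      have "grad \<phi> x = (F x * G x) *\<^sub>R grad H x + H x *\<^sub>R (F x *\<^sub>R grad G x + G x *\<^sub>R grad F x)"
        unfolding \<phi>_def[abs_def] grad_mult[OF dFG smooth_differentiable[OF sH]] grad_mult[OF dif(1,2)] ..
      then have "norm (grad \<phi> x) \<le> norm ((F x * G x) *\<^sub>R grad H x) + (norm ((H x * F x) *\<^sub>R grad G x) + norm ((H x * G x) *\<^sub>R grad F x))"
        by (metis (no_types, lifting) add_left_mono norm_triangle_ineq order_trans scaleR_add_right scaleR_scaleR)
      moreover have "norm ((F x * G x) *\<^sub>R grad H x) \<le> C / \<epsilon> * indicator S x"
        using FGH[of x] b01[of x] by simp
      moreover have "norm ((H x * F x) *\<^sub>R grad G x) \<le> - (grad G' x \<bullet> (x - c)) / R0"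
      proof -
        have "norm ((H x * F x) *\<^sub>R grad G x) \<le> 1 * norm (grad G x)"
          unfolding norm_scaleR using H01[of x] b01[of x] by (intro mult_right_mono) (auto intro!: mult_le_one)
        also have "\<dots> \<le> - (grad G' x \<bullet> (x - c)) / R0"
          unfolding mult_1_left pos_le_divide_eq[OF R(1)] by (rule nG)
        finally show ?thesis .
      qed
      moreover have "norm ((H x * G x) *\<^sub>R grad F x) \<le> - (grad F x \<bullet> (x - 0)) / (R1 - 2 * \<delta>) + grad F x $ j * (\<kappa> x * \<rho> x)"
      proof -
        have "norm ((H x * G x) *\<^sub>R grad F x) \<le> (H x * 1) * norm (grad F x)"
          unfolding norm_scaleR abs_mult using H01[of x] b01[of x] by (intro mult_right_mono mult_mono) auto
        also have "\<dots> = norm (grad F x) - (\<kappa> x * \<rho> x) * norm (grad F x)" by (simp add: H_def algebra_simps)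
        also have "\<dots> \<le> - (grad F x \<bullet> (x - 0)) / (R1 - 2 * \<delta>) - (\<kappa> x * \<rho> x) * (- (grad F x $ j))"
        proof (intro diff_mono mult_left_mono)
          show "norm (grad F x) \<le> - (grad F x \<bullet> (x - 0)) / (R1 - 2 * \<delta>)"
            unfolding pos_le_divide_eq[OF Rd] by (rule nF(1))
        qed (use nF(2)[of x] b01[of x] in auto)
        finally show ?thesis by (simp add: mult.commute)
      qed
      ultimately show ?thesis by linarith
    qed
    have E: "energy 1 \<phi> \<le> real N * V1 / (R1 - 2 * \<delta>) + real N * V0 / R0 - m * \<epsilon> ^ (N - 1) + c1 * \<epsilon> ^ N"
    proof -
      have ei: "integrable lborel (\<lambda>x. norm (grad \<phi> x))"
        using test_function_integrals(1)[OF phi0 open_UNIV, of 1] by simp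
      have i1: "integrable lborel (\<lambda>x. - (grad F x \<bullet> (x - 0)) / (R1 - 2 * \<delta>))" using RF(2) by simp
      have i2: "integrable lborel (\<lambda>x. - (grad G' x \<bullet> (x - c)) / R0)" using RG(2) by simp
      have i3: "integrable lborel (\<lambda>x. C / \<epsilon> * indicator S x)" using cint[OF cS] by simp
      define f1 where "f1 x = - (grad F x \<bullet> (x - 0)) / (R1 - 2 * \<delta>)" for x
      define f2 where "f2 x = grad F x $ j * (\<kappa> x * \<rho> x)" for x
      define f3 where "f3 x = - (grad G' x \<bullet> (x - c)) / R0" for x
      define f4 where "f4 x = C / \<epsilon> * indicator S x" for x
      have "integrable lborel f1" unfolding f1_def[abs_def] by (rule i1)
      moreover have "integrable lborel f2" unfolding f2_def[abs_def] by (rule BP(2))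
      moreover have "integrable lborel f3" unfolding f3_def[abs_def] by (rule i2)
      moreover have "integrable lborel f4" unfolding f4_def[abs_def] by (rule i3)
      ultimately have fi: "integrable lborel f1" "integrable lborel f2" "integrable lborel f3" "integrable lborel f4"
        by simp_all
      have "energy 1 \<phi> \<le> (LINT x|lborel. f1 x + f2 x + f3 x + f4 x)"
        unfolding energy_1
      proof (rule integral_mono[OF ei])
        show "integrable lborel (\<lambda>x. f1 x + f2 x + f3 x + f4 x)" using fi by simp
        show "norm (grad \<phi> x) \<le> f1 x + f2 x + f3 x + f4 x" for x
          unfolding f1_def f2_def f3_def f4_def by (rule pw)
      qed
      also have "\<dots> = (LINT x|lborel. f1 x) + (LINT x|lborel. f2 x) + (LINT x|lborel. f3 x) + (LINT x|lborel. f4 x)"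
        using fi by simp
      also have "\<dots> = (LINT x|lborel. - (grad F x \<bullet> (x - 0)) / (R1 - 2 * \<delta>)) + (LINT x|lborel. grad F x $ j * (\<kappa> x * \<rho> x))
        + (LINT x|lborel. - (grad G' x \<bullet> (x - c)) / R0) + (LINT x|lborel. C / \<epsilon> * indicator S x)"
        unfolding f1_def f2_def f3_def f4_def ..
      also have "(LINT x|lborel. - (grad F x \<bullet> (x - 0)) / (R1 - 2 * \<delta>)) = real N * (LINT x|lborel. F x) / (R1 - 2 * \<delta>)"
        using RF(1) by (simp add: N_def)
      also have "(LINT x|lborel. - (grad G' x \<bullet> (x - c)) / R0) = real N * (LINT x|lborel. G' x) / R0"
        using RG(1) by (simp add: N_def)
      also have "(LINT x|lborel. C / \<epsilon> * indicator S x) = C / \<epsilon> * measure lborel S" by simp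
      also have "(LINT x|lborel. grad F x $ j * (\<kappa> x * \<rho> x)) = - (LINT x|lborel. F x * grad (\<lambda>x. \<kappa> x * \<rho> x) x $ j)"
        by (rule BP(1))
      finally have *: "energy 1 \<phi> \<le> real N * (LINT x|lborel. F x) / (R1 - 2 * \<delta>)
          + - (LINT x|lborel. F x * grad (\<lambda>x. \<kappa> x * \<rho> x) x $ j) + real N * (LINT x|lborel. G' x) / R0 + C / \<epsilon> * measure lborel S" .
      have "real N * (LINT x|lborel. F x) / (R1 - 2 * \<delta>) \<le> real N * V1 / (R1 - 2 * \<delta>)"
        using IF Rd by (intro divide_right_mono mult_left_mono) auto
      moreover have "real N * (LINT x|lborel. G' x) / R0 \<le> real N * V0 / R0"
        using IG R by (intro divide_right_mono mult_left_mono) auto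
      moreover have "C / \<epsilon> * measure lborel S = C * (2 ^ (N - 1) / R0) * \<epsilon> ^ N"
        unfolding volS using eps(1) by (simp add: field_simps)
      moreover have "C * (2 ^ (N - 1) / R0) * \<epsilon> ^ N \<le> c1 * \<epsilon> ^ N"
        unfolding c1_def using C0 R eps(1) by (intro mult_right_mono) auto
      ultimately show ?thesis using * gain by linarith
    qed
    define VM where "VM = measure lborel (cball (0::real^'n) (R1 - 2 * \<delta>))"
    have M: "mass 1 \<phi> \<ge> VM - V0 - c1 * \<epsilon> ^ N"
    proof -
      have phi_nn: "\<phi> x \<ge> 0" for x unfolding \<phi>_def using b01[of x] H01[of x] by simp
      \<comment> \<open>Between the two spheres \<kappa>\<rho> is non-zero only in \<open>S\<close>,
        so away from \<open>S\<close> and the two boundary layers the function equals 1.\<close>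
      have low: "indicator (cball 0 (R1 - 2 * \<delta>)) x - indicator (cball c (R0 + 2 * \<delta>)) x - indicator S x \<le> \<bar>\<phi> x\<bar>" for x :: "real^'n"
      proof (cases "norm x \<le> R1 - 2 * \<delta> \<and> R0 + 2 * \<delta> < norm (x - c) \<and> x \<notin> S")
        case True
        have "\<kappa> x * \<rho> x = 0"
        proof (rule ccontr)
          assume "\<kappa> x * \<rho> x \<noteq> 0"
          then have "\<not> x $ j \<le> R1 - R0" "\<not> \<epsilon>\<^sup>2 \<le> w x" using r_dead[of x] k_dead[of x] by auto
          then have "R1 - R0 < x $ j" "w x < \<epsilon>\<^sup>2" by linarith+
          moreover have "norm x < R1" "R0 < norm (x - c)" using True del by auto
          ultimately show False using inS True by blast
        qed
        then have "\<phi> x = 1" using F1[of x] G1[of x] True by (simp add: \<phi>_def H_def)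
        then show ?thesis by (simp add: indicator_def)
      next
        case False
        then show ?thesis using phi_nn[of x] by (auto simp: indicator_def dist_norm norm_minus_commute)
      qed
      have i: "integrable lborel (\<lambda>x. \<bar>\<phi> x\<bar>)" using test_function_integrals(2)[OF phi0 open_UNIV, of 1] by simp
      have ci: "integrable lborel (\<lambda>x. indicator (cball (0::real^'n) (R1 - 2 * \<delta>)) x :: real)" "integrable lborel (\<lambda>x. indicator (cball c (R0 + 2 * \<delta>)) x :: real)"
        "integrable lborel (\<lambda>x. indicator S x :: real)"
        using cint[of "cball (0::real^'n) (R1 - 2 * \<delta>)"] cint[OF cG] cint[OF cS] by simp_all
      have "(LINT x|lborel. indicator (cball (0::real^'n) (R1 - 2 * \<delta>)) x - indicator (cball c (R0 + 2 * \<delta>)) x - indicator S x :: real) \<le> mass 1 \<phi>"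
        unfolding mass_1 using ci i low by (intro integral_mono) auto
      then have "VM - V0 - measure lborel S \<le> mass 1 \<phi>"
        using ci by (simp add: VM_def V0c)
      moreover have "measure lborel S \<le> c1 * \<epsilon> ^ N"
      proof -
        have "measure lborel S = (1 * (2 ^ (N - 1) / R0)) * \<epsilon> ^ N * \<epsilon>" unfolding volS by simp
        also have "\<dots> \<le> (1 * (2 ^ (N - 1) / R0)) * \<epsilon> ^ N * 1"
          using eps1 eps(1) R by (intro mult_left_mono) auto
        also have "\<dots> \<le> c1 * \<epsilon> ^ N"
          unfolding c1_def mult_1_right using C0 R eps(1) by (intro mult_right_mono) auto
        finally show ?thesis .
      qed
      ultimately show ?thesis by simp
    qed
    show ?thesis using test E M unfolding V1_def V0_def VM_def by blast
  qed
  then show ?thesis using that[OF m c1 e0] unfolding N_def by blast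
qed

section \<open>Conclusion\<close>

lemma Lambda_inf_eq:
  fixes j :: "'n::finite"
  assumes "0 < R0" "0 \<le> s" "s < R1 - R0"
  shows "Lambda_inf j R0 R1 s = 2 / (R1 - R0 + s)"
proof -
  define r where "r = (R1 - R0 + s) / 2"
  have r: "r > 0" using assms by (simp add: r_def)
  define \<Omega> where "\<Omega> = eccentric_annulus j R0 R1 s"
  have \<Omega>: "open \<Omega>" unfolding \<Omega>_def by (rule eccentric_annulus_open)
  \<comment> \<open>Midpoint of the axis segment from -R1 to s - R0, the widest passage, opposite to
    the displacement of the hole; its half-length is \<open>r\<close>.\<close>
  define z where "z = ((s - R0 - R1) / 2) *\<^sub>R (axis j 1 :: real^'n)"
  have zn: "norm z = (R1 + R0 - s) / 2" using assms by (simp add: z_def norm_axis_1)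
  have zs: "norm (z - s *\<^sub>R axis j 1) = (R0 + R1 + s) / 2"
  proof -
    have "z - s *\<^sub>R axis j 1 = ((s - R0 - R1) / 2 - s) *\<^sub>R axis j 1"
      unfolding z_def by (simp add: scaleR_left_diff_distrib)
    then show ?thesis using assms by (simp add: norm_axis_1 field_simps)
  qed
  have ball: "ball z r \<subseteq> \<Omega>"
  proof
    fix x assume "x \<in> ball z r"
    then have x: "norm (x - z) < r" by (simp add: dist_norm norm_minus_commute)
    have "norm x \<le> norm z + norm (x - z)" using norm_triangle_ineq[of z "x - z"] by simp
    moreover have "norm (z - s *\<^sub>R axis j 1) \<le> norm (x - s *\<^sub>R axis j 1) + norm (x - z)"
      using norm_triangle_ineq4[of "x - s *\<^sub>R axis j 1" "x - z"] by simp
    ultimately show "x \<in> \<Omega>"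
      using x zn zs unfolding \<Omega>_def eccentric_annulus_eq[OF assms(1)] r_def mem_Collect_eq
      by (intro conjI; simp add: field_simps; linarith?)
  qed
  have "((\<lambda>p. first_eigenvalue p \<Omega> powr (1 / p)) \<longlongrightarrow> 1 / r) at_top"
  proof (rule order_tendstoI)
    fix b assume "1 / r < b"
    then show "eventually (\<lambda>p. first_eigenvalue p \<Omega> powr (1 / p) < b) at_top"
      by (rule first_eigenvalue_root_less[OF \<Omega> r ball])
  next
    fix a assume a: "a < 1 / r"
    \<comment> \<open>A single small t serves as 1 - \<alpha> and as the margin \<epsilon> of the
      lower bound, whose p-th root tends to (1 - t)/(r + t) for fixed t.\<close>
    have "((\<lambda>t. (1 - t) / (r + t)) \<longlongrightarrow> (1 - 0) / (r + 0)) (at_right 0)"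
      using r by (intro tendsto_intros) auto
    then have "eventually (\<lambda>t. a < (1 - t) / (r + t)) (at_right 0)"
      using a by (intro order_tendstoD) auto
    moreover have "eventually (\<lambda>t. 0 < t \<and> t < 1) (at_right (0::real))"
      by (auto simp: eventually_at_right_field intro!: exI[of _ 1])
    ultimately have "eventually (\<lambda>t. a < (1 - t) / (r + t) \<and> 0 < t \<and> t < 1) (at_right 0)"
      by eventually_elim simp
    then obtain t where t: "a < (1 - t) / (r + t)" "0 < t" "t < 1"
      using eventually_happens'[OF trivial_limit_at_right_real] by blast
    define al where "al = 1 - t"
    have al: "0 < al" "al < 1" using t by (auto simp: al_def)
    have est: "al powr (1 - 1 / p) / (r + t) \<le> first_eigenvalue p \<Omega> powr (1 / p)"
      if p: "p > 1" "(p - 1) * (1 - al) \<ge> 1 + (real CARD('n) - 1) / R0 * (r + t)" for p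
    proof -
      have "al powr (p - 1) * (r + t) powr (- p) \<le> first_eigenvalue p \<Omega>"
        unfolding \<Omega>_def r_def by (rule first_eigenvalue_annulus_ge[OF assms al t(2) p(1)]) (use p(2) in \<open>simp add: r_def\<close>)
      then have "(al powr (p - 1) * (r + t) powr (- p)) powr (1 / p) \<le> first_eigenvalue p \<Omega> powr (1 / p)"
        using p by (intro powr_mono2) auto
      moreover have "(al powr (p - 1) * (r + t) powr (- p)) powr (1 / p) = al powr (1 - 1 / p) / (r + t)"
      proof -
        have "(p - 1) * (1 / p) = 1 - 1 / p" "- p * (1 / p) = - 1" using p by (auto simp: field_simps)
        then show ?thesis unfolding powr_mult powr_powr using r t by (simp add: powr_minus_divide)
      qed
      ultimately show ?thesis by simp
    qed
    have "((\<lambda>p::real. 1 / p) \<longlongrightarrow> 0) at_top"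
      using tendsto_inverse_0_at_top[OF filterlim_ident] by (simp add: divide_inverse)
    then have "((\<lambda>p. al powr (1 - 1 / p) / (r + t)) \<longlongrightarrow> al powr (1 - 0) / (r + t)) at_top"
      using al r t by (intro tendsto_divide tendsto_powr tendsto_diff tendsto_const) auto
    moreover have "a < al powr (1 - 0) / (r + t)" using t al by (simp add: al_def)
    ultimately have e1: "eventually (\<lambda>p. a < al powr (1 - 1 / p) / (r + t)) at_top" by (rule order_tendstoD)
    \<comment> \<open>Threshold beyond which p is large enough for the curvature of the hole to be
      absorbed.\<close>
    define P where "P = max 1 ((1 + (real CARD('n) - 1) / R0 * (r + t)) / (1 - al) + 1)"
    show "eventually (\<lambda>p. a < first_eigenvalue p \<Omega> powr (1 / p)) at_top"
      using e1 eventually_gt_at_top[of P]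
    proof eventually_elim
      case (elim p)
      then have p: "p > 1" "(1 + (real CARD('n) - 1) / R0 * (r + t)) / (1 - al) \<le> p - 1" by (auto simp: P_def)
      then have "(p - 1) * (1 - al) \<ge> 1 + (real CARD('n) - 1) / R0 * (r + t)"
        using al by (simp add: pos_divide_le_eq)
      then show ?case using est[OF p(1)] elim(1) by simp
    qed
  qed
  then have "Lim at_top (\<lambda>p. first_eigenvalue p \<Omega> powr (1 / p)) = 1 / r"
    by (intro tendsto_Lim) auto
  then show ?thesis by (simp add: Lambda_inf_def lambda1_def \<Omega>_def r_def)
qed

lemma Lambda_1_eq_cheeger:
  assumes "0 < R0" "0 \<le> s" "s < R1 - R0"
  shows "Lambda_1 j R0 R1 s = cheeger (eccentric_annulus j R0 R1 s)"
  unfolding Lambda_1_def lambda1_def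
  by (intro tendsto_Lim first_eigenvalue_tendsto_cheeger eccentric_annulus_open eccentric_annulus_nonempty assms) simp

text \<open>In the limit \<delta> = 0 the bounds for the cusp function are perimeter minus m
  \<epsilon>^(N-1) plus c1 \<epsilon>^N for the energy, and volume minus c1 \<epsilon>^N for the
  mass, with perimeter and volume of the concentric annulus, whose quotient is \<open>H\<close>. The
  energy falls below \<open>H\<close> times the mass as soon as c1 (1 + H) \<epsilon>^N < m
  \<epsilon>^(N-1).\<close>

lemma cheeger_annulus_less:
  fixes j :: "'n::finite"
  assumes R: "0 < R0" "R0 < R1"
  obtains s where "0 \<le> s" "s < R1 - R0" "cheeger (eccentric_annulus j R0 R1 s) < cheeger (eccentric_annulus j R0 R1 0)"
proof -
  define N where "N = CARD('n)"
  have N: "N > 0" by (simp add: N_def)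
  define u where "u = unit_ball_vol (real N)"
  have u: "u > 0" by (simp add: u_def)
  have vol: "measure lborel (cball (0::real^'n) r) = u * r ^ N" if "r \<ge> 0" for r
    using that by (simp add: content_cball u_def N_def)
  define H where "H = real N * ((R1 ^ (N - 1) + R0 ^ (N - 1)) / (R1 ^ N - R0 ^ N))"
  have RN: "R0 ^ N < R1 ^ N" using R N by (intro power_strict_mono) auto
  have H0: "H > 0" unfolding H_def using N RN R by (intro mult_pos_pos divide_pos_pos add_pos_pos) auto
  have HV: "H * (u * R1 ^ N - u * R0 ^ N) = real N * u * (R1 ^ (N - 1) + R0 ^ (N - 1))"
  proof -
    have "H * (R1 ^ N - R0 ^ N) = real N * (R1 ^ (N - 1) + R0 ^ (N - 1))" unfolding H_def using RN by simp
    moreover have "H * (u * R1 ^ N - u * R0 ^ N) = H * (R1 ^ N - R0 ^ N) * u" by (simp add: algebra_simps)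
    ultimately show ?thesis by simp
  qed
  have pw: "r ^ N = r * r ^ (N - 1)" for r :: real using N by (cases N) auto
  obtain m c1 \<epsilon>0 where m: "m > 0" "c1 > 0" "\<epsilon>0 > 0"
    and test: "\<And>\<epsilon> \<delta>. 0 < \<epsilon> \<Longrightarrow> \<epsilon> < \<epsilon>0 \<Longrightarrow> 0 < \<delta> \<Longrightarrow> \<delta> < R0 / 4 \<Longrightarrow>
      \<exists>\<phi>. (\<forall>s. \<bar>R1 - R0 - s\<bar> < \<delta> \<longrightarrow> \<phi> \<in> test_functions (eccentric_annulus j R0 R1 s)) \<and>
        energy 1 \<phi> \<le> real N * measure lborel (cball (0::real^'n) R1) / (R1 - 2 * \<delta>)
          + real N * measure lborel (cball (0::real^'n) (R0 + 2 * \<delta>)) / R0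
          - m * \<epsilon> ^ (N - 1) + c1 * \<epsilon> ^ N \<and>
        mass 1 \<phi> \<ge> measure lborel (cball (0::real^'n) (R1 - 2 * \<delta>))
          - measure lborel (cball (0::real^'n) (R0 + 2 * \<delta>)) - c1 * \<epsilon> ^ N"
    using cusp_test_function[OF R, where j=j] unfolding N_def by metis
  define q where "q = c1 * (1 + H)"
  have q: "q > 0" unfolding q_def using m H0 by simp
  \<comment> \<open>With \<epsilon> \<le> m/(2 q) the losses use up at most half of the
    gain.\<close>
  define \<epsilon> where "\<epsilon> = min (\<epsilon>0 / 2) (m / (2 * q))"
  have eps: "0 < \<epsilon>" "\<epsilon> < \<epsilon>0" unfolding \<epsilon>_def using m q by auto
  have "\<epsilon> * (c1 * (1 + H)) \<le> m / (2 * q) * q"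
    unfolding q_def[symmetric] using q by (intro mult_right_mono) (simp_all add: \<epsilon>_def)
  also have "\<dots> = m / 2" using q by simp
  finally have "\<epsilon> * (c1 * (1 + H)) < m" using m by simp
  then have "\<epsilon> * (c1 * (1 + H)) * \<epsilon> ^ (N - 1) < m * \<epsilon> ^ (N - 1)" using eps by (intro mult_strict_right_mono) auto
  then have gain: "c1 * (1 + H) * \<epsilon> ^ N < m * \<epsilon> ^ (N - 1)" unfolding pw[of \<epsilon>] by (simp add: algebra_simps)
  define E where "E \<delta> = real N * (u * R1 ^ N) / (R1 - 2 * \<delta>) + real N * (u * (R0 + 2 * \<delta>) ^ N) / R0
          - m * \<epsilon> ^ (N - 1) + c1 * \<epsilon> ^ N" for \<delta>
  define V where "V \<delta> = u * (R1 - 2 * \<delta>) ^ N - u * (R0 + 2 * \<delta>) ^ N - c1 * \<epsilon> ^ N" for \<delta>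
  \<comment> \<open>\<epsilon> is fixed from here on; the strict inequality at \<delta> = 0 persists
    for small positive \<delta> by continuity.\<close>
  have "((\<lambda>\<delta>. H * V \<delta> - E \<delta>) \<longlongrightarrow> H * V 0 - E 0) (at_right 0)"
    unfolding V_def E_def using R by (intro tendsto_intros) auto
  moreover have "H * V 0 - E 0 > 0"
  proof -
    have "E 0 = real N * u * (R1 ^ (N - 1) + R0 ^ (N - 1)) - m * \<epsilon> ^ (N - 1) + c1 * \<epsilon> ^ N"
      unfolding E_def pw[of R1] pw[of "R0 + 2 * 0"] using R by (simp add: algebra_simps)
    moreover have "H * V 0 = real N * u * (R1 ^ (N - 1) + R0 ^ (N - 1)) - H * (c1 * \<epsilon> ^ N)"
      unfolding HV[symmetric] V_def by (simp add: algebra_simps)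
    ultimately show ?thesis using gain by (simp add: algebra_simps)
  qed
  ultimately have e1: "eventually (\<lambda>\<delta>. 0 < H * V \<delta> - E \<delta>) (at_right 0)" by (rule order_tendstoD)
  have e2: "eventually (\<lambda>\<delta>. 0 < \<delta> \<and> \<delta> < min (R0 / 4) (R1 - R0)) (at_right (0::real))"
    using R by (auto simp: eventually_at_right_field intro!: exI[of _ "min (R0 / 4) (R1 - R0)"])
  have "eventually (\<lambda>\<delta>. 0 < H * V \<delta> - E \<delta> \<and> 0 < \<delta> \<and> \<delta> < min (R0 / 4) (R1 - R0)) (at_right 0)"
    using e1 e2 by eventually_elim simp
  from eventually_happens'[OF _ this]
  obtain \<delta> where "0 < H * V \<delta> - E \<delta> \<and> 0 < \<delta> \<and> \<delta> < min (R0 / 4) (R1 - R0)" by auto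
  then have d: "0 < H * V \<delta> - E \<delta>" "0 < \<delta>" "\<delta> < R0 / 4" "\<delta> < R1 - R0" by simp_all
  obtain \<phi> where phi: "\<And>s. \<bar>R1 - R0 - s\<bar> < \<delta> \<Longrightarrow> \<phi> \<in> test_functions (eccentric_annulus j R0 R1 s)"
    "energy 1 \<phi> \<le> E \<delta>" "mass 1 \<phi> \<ge> V \<delta>"
    using test[OF eps d(2,3)] R d by (auto simp: vol E_def V_def)
  define s where "s = R1 - R0 - \<delta> / 2"
  have s: "0 \<le> s" "s < R1 - R0" "\<bar>R1 - R0 - s\<bar> < \<delta>" using d by (auto simp: s_def)
  have "E \<delta> < H * V \<delta>" using d by simp
  also have "\<dots> \<le> H * mass 1 \<phi>" using phi(3) H0 by (intro mult_left_mono) auto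
  finally have lt: "energy 1 \<phi> < H * mass 1 \<phi>" using phi(2) by simp
  then have M: "mass 1 \<phi> > 0" using energy_nonneg[of 1 \<phi>] H0 by (metis less_le_trans mult_less_cancel_left_pos mult_zero_right not_le)
  have "cheeger (eccentric_annulus j R0 R1 s) * mass 1 \<phi> < H * mass 1 \<phi>"
    using cheeger_le[OF phi(1)[OF s(3)]] lt by simp
  then have "cheeger (eccentric_annulus j R0 R1 s) < H" using M by simp
  also have "H \<le> cheeger (eccentric_annulus j R0 R1 0)"
    unfolding H_def N_def by (rule cheeger_annulus_0_ge[OF R])
  finally show ?thesis using that s by blast
qed

theorem theorem1p2:
  fixes j :: "'n::finite" and R0 R1 :: real
  assumes "CARD('n) \<ge> 2" and "0 < R0" and "R0 < R1"
  shows "continuous_on {0..<R1 - R0} (Lambda_inf j R0 R1) \<and>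
    continuous_on {0..<R1 - R0} (Lambda_1 j R0 R1) \<and>
    strict_antimono_on {0..<R1 - R0} (Lambda_inf j R0 R1) \<and>
    antimono_on {0..<R1 - R0} (Lambda_1 j R0 R1) \<and>
    (\<exists>s'\<in>{0..<R1 - R0}. Lambda_1 j R0 R1 0 = Lambda_1 j R0 R1 s' \<and>
      (\<forall>s\<in>{s'<..<R1 - R0}. Lambda_1 j R0 R1 s' > Lambda_1 j R0 R1 s))"
proof -
  let ?I = "{0..<R1 - R0}"
  define h where "h s = cheeger (eccentric_annulus j R0 R1 s)" for s
  have inf_eq: "Lambda_inf j R0 R1 s = 2 / (R1 - R0 + s)" if "s \<in> ?I" for s
    using Lambda_inf_eq[OF assms(2)] that by auto
  have one_eq: "Lambda_1 j R0 R1 s = h s" if "s \<in> ?I" for s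
    unfolding h_def using Lambda_1_eq_cheeger[OF assms(2)] that by auto
  have hc: "continuous_on ?I h"
    unfolding h_def by (rule continuous_on_cheeger_annulus[OF assms(2,3)])
  have anti: "h t \<le> h s" if "s \<in> ?I" "t \<in> ?I" "s \<le> t" for s t
    unfolding h_def using cheeger_annulus_antimono[OF assms(2)] that by auto
  have A: "continuous_on ?I (Lambda_inf j R0 R1)"
  proof -
    have "continuous_on ?I (\<lambda>s. 2 / (R1 - R0 + s))"
      using assms by (intro continuous_intros) auto
    then show ?thesis using continuous_on_cong[of ?I ?I "Lambda_inf j R0 R1" "\<lambda>s. 2 / (R1 - R0 + s)"] inf_eq by simp
  qed
  have B: "continuous_on ?I (Lambda_1 j R0 R1)"
    using hc continuous_on_cong[of ?I ?I "Lambda_1 j R0 R1" h] one_eq by simp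
  have C: "strict_antimono_on ?I (Lambda_inf j R0 R1)"
  proof (rule monotone_onI)
    fix s t assume st: "s \<in> ?I" "t \<in> ?I" "s < t"
    then show "Lambda_inf j R0 R1 s > Lambda_inf j R0 R1 t"
      unfolding inf_eq[OF st(1)] inf_eq[OF st(2)] using assms by (intro divide_strict_left_mono) auto
  qed
  have D: "antimono_on ?I (Lambda_1 j R0 R1)"
    by (rule monotone_onI) (use one_eq anti in auto)
  obtain s1 where s1: "0 \<le> s1" "s1 < R1 - R0" "h s1 < h 0"
    unfolding h_def using cheeger_annulus_less[OF assms(2,3)] by metis
  \<comment> \<open>The domain is half open, so the set where h equals h(0) is intersected with
    [0, s1] to make it compact; beyond s1 monotonicity keeps h at most h(s1) < h(0).\<close>
  define S where "S = {s \<in> {0..s1}. h s = h 0}"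
  have "compact S"
  proof -
    have "continuous_on {0..s1} h" by (rule continuous_on_subset[OF hc]) (use s1 in auto)
    then have "closed S" unfolding S_def
      using continuous_closed_preimage_constant[of "{0..s1}" h "h 0"] by simp
    moreover have "bounded S" unfolding S_def by (rule bounded_subset[of "{0..s1}"]) auto
    ultimately show ?thesis by (simp add: compact_eq_bounded_closed)
  qed
  moreover have "0 \<in> S" using s1 by (simp add: S_def)
  ultimately obtain s' where s': "s' \<in> S" "\<And>s. s \<in> S \<Longrightarrow> s \<le> s'"
    using compact_attains_sup[of S] by auto
  have I: "0 \<in> ?I" "s' \<in> ?I" using s' s1 assms by (auto simp: S_def)
  have "h s < h s'" if s: "s' < s" "s < R1 - R0" for s
  proof (cases "s \<le> s1")
    case True
    have "h s \<noteq> h 0" using s'(2)[of s] s I True by (force simp: S_def)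
    moreover have "h s \<le> h 0" using anti[of 0 s] s I by auto
    ultimately show ?thesis using s'(1) by (simp add: S_def)
  next
    case False
    have "h s \<le> h s1" using anti[of s1 s] s s1 False by auto
    with s1(3) s'(1) show ?thesis by (simp add: S_def)
  qed
  then have E: "\<exists>s'\<in>?I. Lambda_1 j R0 R1 0 = Lambda_1 j R0 R1 s' \<and>
      (\<forall>s\<in>{s'<..<R1 - R0}. Lambda_1 j R0 R1 s' > Lambda_1 j R0 R1 s)"
    using I s'(1) one_eq by (intro bexI[of _ s']) (auto simp: S_def)
  from A B C D E show ?thesis by blast
qed

end
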